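(* Assume that either $\mu=\alpha_1\alpha_2<1/4$, or $\alpha_1=\alpha_2\in[1/2,1)$. For every fixed deterministic $t>0$ and each choice of the sign $\pm$, $$\limsup_{h\downarrow0}\pm\frac{V_{t+h}-V_t}{\sqrt{4h\log\log(1/h)}}=1\qquad\text{almost surely.}$$
   Context: $\alpha_1,\alpha_2\in[-1,1]$, $\mu=\alpha_1\alpha_2$, $A=\begin{pmatrix}0&\alpha_1\\ \alpha_2&0\end{pmatrix}$, $x^A:=e^{(\log x)A}$ for $x>0$, $\mathbf e=(1,-1)^\top$. $V=\{V_t\}_{t\ge0}$ is the centered continuous real Gaussian process with $V_0=0$ given for $t>0$ by (a) $V_t=\int_0^t\mathbf e^\top(t/s)^A\,dB_s$ with $B$ a two-dimensional standard Brownian motion, if $\mu<1/4$; (b) $V_t=\sqrt2\int_0^t(t/s)^{-\alpha_1}\,dW_s$ with $W$ a standard Brownian motion, if $\alpha_1=\alpha_2\in[1/2,1)$. (Continuous modifications are taken.) *)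

theory Defs
  imports "HOL-Probability.Probability"
begin

definition matrix_exp :: "real^'n^'n \<Rightarrow> real^'n^'n" where
  "matrix_exp A = (\<Sum>k. (1 / fact k) *\<^sub>R (((**) A ^^ k) (mat 1)))"

definition powr_matrix :: "real \<Rightarrow> real^'n^'n \<Rightarrow> real^'n^'n" where
  "powr_matrix x A = matrix_exp (ln x *\<^sub>R A)"

definition A_mat :: "real \<Rightarrow> real \<Rightarrow> real^2^2" where
  "A_mat \<alpha>\<^sub>1 \<alpha>\<^sub>2 = vector [vector [0, \<alpha>\<^sub>1], vector [\<alpha>\<^sub>2, 0]]"

definition e_vec :: "real^2" where
  "e_vec = vector [1, -1]"

definition brownian_motion :: "'a measure \<Rightarrow> (real \<Rightarrow> 'a \<Rightarrow> real) \<Rightarrow> bool" where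
  "brownian_motion M W \<longleftrightarrow>
     prob_space M \<and>
     (\<forall>t\<ge>0. W t \<in> borel_measurable M) \<and>
     (AE \<omega> in M. W 0 \<omega> = 0) \<and>
     (\<forall>s t. 0 \<le> s \<and> s < t \<longrightarrow>
        distributed M lborel (\<lambda>\<omega>. W t \<omega> - W s \<omega>) (normal_density 0 (sqrt (t - s)))) \<and>
     (\<forall>(n::nat) \<tau>. 0 \<le> \<tau> 0 \<and> (\<forall>i<n. \<tau> i \<le> \<tau> (Suc i)) \<longrightarrow>
        prob_space.indep_vars M (\<lambda>_. borel) (\<lambda>i \<omega>. W (\<tau> (Suc i)) \<omega> - W (\<tau> i) \<omega>) {..<n}) \<and>
     (AE \<omega> in M. continuous_on {0..} (\<lambda>t. W t \<omega>))"

text \<open>Multidimensional standard Brownian motion: the coordinate processes are standard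
  one-dimensional Brownian motions and are independent as processes, i.e. as random elements
  of the product space over the time axis.\<close>

definition brownian_motion_vec :: "'a measure \<Rightarrow> (real \<Rightarrow> 'a \<Rightarrow> real^'n) \<Rightarrow> bool" where
  "brownian_motion_vec M B \<longleftrightarrow>
     (\<forall>i. brownian_motion M (\<lambda>t \<omega>. B t \<omega> $ i)) \<and>
     prob_space.indep_vars M (\<lambda>_. PiM {0..} (\<lambda>_. borel))
       (\<lambda>i \<omega>. \<lambda>t\<in>{0..}. B t \<omega> $ i) UNIV"

text \<open>A step function is given by a list of triples \<open>(a, b, c)\<close>, each contributing the value
  \<open>c\<close> on the interval \<open>(a, b]\<close>. The intervals may overlap.\<close>

definition step_fun :: "(real \<times> real \<times> 'b::euclidean_space) list \<Rightarrow> real \<Rightarrow> 'b" where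
  "step_fun xs s = (\<Sum>(a, b, c)\<leftarrow>xs. indicator {a<..b} s *\<^sub>R c)"

definition step_integral ::
    "(real \<Rightarrow> 'a \<Rightarrow> 'b::euclidean_space) \<Rightarrow> (real \<times> real \<times> 'b) list \<Rightarrow> 'a \<Rightarrow> real" where
  "step_integral B xs \<omega> = (\<Sum>(a, b, c)\<leftarrow>xs. c \<bullet> (B b \<omega> - B a \<omega>))"

text \<open>\<open>X\<close> is a version of the Wiener integral of the deterministic function \<open>f\<close> against \<open>B\<close>
  over \<open>(0, T]\<close>: the limit in mean square of the integrals of step functions converging to \<open>f\<close>
  in the space of square integrable functions. Square integrability of \<open>f\<close> is implied by the
  convergence. For vector-valued \<open>f\<close> and \<open>B\<close> the integrand is \<open>f s \<bullet> dB s\<close>; for type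
  \<open>real\<close> the inner product is multiplication.\<close>

definition has_wiener_integral ::
    "'a measure \<Rightarrow> (real \<Rightarrow> 'a \<Rightarrow> 'b::euclidean_space) \<Rightarrow> real \<Rightarrow> (real \<Rightarrow> 'b) \<Rightarrow> ('a \<Rightarrow> real) \<Rightarrow> bool" where
  "has_wiener_integral M B T f X \<longleftrightarrow>
     set_borel_measurable lborel {0<..T} f \<and> X \<in> borel_measurable M \<and>
     (\<exists>\<phi> :: nat \<Rightarrow> (real \<times> real \<times> 'b) list.
        (\<forall>n. \<forall>(a, b, c)\<in>set (\<phi> n). 0 \<le> a \<and> a \<le> b \<and> b \<le> T) \<and>
        (\<lambda>n. \<integral>\<^sup>+s\<in>{0<..T}. ennreal ((norm (step_fun (\<phi> n) s - f s))\<^sup>2) \<partial>lborel) \<longlonglongrightarrow> 0 \<and>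
        (\<lambda>n. \<integral>\<^sup>+\<omega>. ennreal ((step_integral B (\<phi> n) \<omega> - X \<omega>)\<^sup>2) \<partial>M) \<longlonglongrightarrow> 0)"

text \<open>Since \<open>v v* N\<close> denotes the product of a row vector with a matrix, the kernel in the first
  representation is \<open>e\<^sup>T (t/s)\<^sup>A\<close>.\<close>

definition V_repr_a ::
    "'a measure \<Rightarrow> real \<Rightarrow> real \<Rightarrow> (real \<Rightarrow> 'a \<Rightarrow> real^2) \<Rightarrow> (real \<Rightarrow> 'a \<Rightarrow> real) \<Rightarrow> bool" where
  "V_repr_a M \<alpha>\<^sub>1 \<alpha>\<^sub>2 B V \<longleftrightarrow>
     (\<forall>t>0. has_wiener_integral M B t (\<lambda>s. e_vec v* powr_matrix (t / s) (A_mat \<alpha>\<^sub>1 \<alpha>\<^sub>2)) (V t))"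

definition V_repr_b ::
    "'a measure \<Rightarrow> real \<Rightarrow> (real \<Rightarrow> 'a \<Rightarrow> real) \<Rightarrow> (real \<Rightarrow> 'a \<Rightarrow> real) \<Rightarrow> bool" where
  "V_repr_b M \<alpha>\<^sub>1 W V \<longleftrightarrow>
     (\<forall>t>0. \<exists>I. has_wiener_integral M W t (\<lambda>s. (t / s) powr (- \<alpha>\<^sub>1)) I \<and>
        V t \<in> borel_measurable M \<and> (AE \<omega> in M. V t \<omega> = sqrt 2 * I \<omega>))"

text \<open>That such a process is centered and Gaussian is a consequence of the representation by
  Wiener integrals.\<close>

definition V_process ::
    "'a measure \<Rightarrow> real \<Rightarrow> real \<Rightarrow> (real \<Rightarrow> 'a \<Rightarrow> real) \<Rightarrow> bool" where
  "V_process M \<alpha>\<^sub>1 \<alpha>\<^sub>2 V \<longleftrightarrow>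
     (AE \<omega> in M. V 0 \<omega> = 0) \<and>
     (AE \<omega> in M. continuous_on {0..} (\<lambda>t. V t \<omega>)) \<and>
     (\<alpha>\<^sub>1 * \<alpha>\<^sub>2 < 1/4 \<longrightarrow> (\<exists>B. brownian_motion_vec M B \<and> V_repr_a M \<alpha>\<^sub>1 \<alpha>\<^sub>2 B V)) \<and>
     (\<alpha>\<^sub>1 = \<alpha>\<^sub>2 \<and> \<alpha>\<^sub>1 \<in> {1/2..<1} \<longrightarrow> (\<exists>W. brownian_motion M W \<and> V_repr_b M \<alpha>\<^sub>1 W V))"

end

theory Submission
  imports Defs "HOL-Real_Asymp.Real_Asymp"
begin

text \<open>
  Both representations write \<open>V\<^sub>t\<close> as a Wiener integral whose kernel depends on \<open>t\<close> in a
  finite-dimensional way. If \<open>\<alpha>\<^sub>1 = \<alpha>\<^sub>2 = \<alpha>\<close> and \<open>V\<close> is driven by a scalar Brownian motion, then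
  \<open>((t + h) / s)\<^sup>-\<^sup>\<alpha>\<close> is the multiple \<open>((t + h) / t)\<^sup>-\<^sup>\<alpha>\<close> of \<open>(t / s)\<^sup>-\<^sup>\<alpha>\<close>. In the matrix case
  \<open>A\<^sup>2 = \<mu> I\<close>, so that \<open>x\<^sup>A = c(ln x) I + d(ln x) A\<close> with \<open>c, d\<close> the (possibly trigonometric or
  degenerate) hyperbolic cosine and sine, and their addition laws express the kernel at time
  \<open>t + h\<close> through the kernels at \<open>t\<close> and at one further fixed time \<open>t + h0\<close>, with coefficients that
  differ from \<open>1\<close> and \<open>0\<close> by \<open>O(h)\<close>. The contribution of the past \<open>(0, t]\<close> to \<open>V\<^sub>t\<^sub>+\<^sub>h - V\<^sub>t\<close> is
  therefore \<open>O(h)\<close> times fixed random variables. On \<open>(t, t + h]\<close> the kernel is Lipschitz and takes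
  the value \<open>e\<close> at the right end, so summation by parts gives \<open>e \<bullet> (B\<^sub>t\<^sub>+\<^sub>h - B\<^sub>t) + O(h)\<close>, with a
  constant that depends on the path but not on \<open>h\<close>. Altogether
  \<open>V\<^sub>t\<^sub>+\<^sub>h - V\<^sub>t = e \<bullet> (B\<^sub>t\<^sub>+\<^sub>h - B\<^sub>t) + O(h)\<close> almost surely (\<open>wiener_increment_linear_error\<close>).

  Since \<open>e = (1, -1)\<close> has length \<open>sqrt 2\<close>, the leading term is \<open>sqrt 2\<close> times a standard Brownian
  motion in \<open>h\<close> (\<open>brownian_motion_inner\<close>, \<open>brownian_motion_shift\<close>); in the scalar case the factor
  \<open>sqrt 2\<close> is part of the representation. The error \<open>O(h)\<close> is negligible against
  \<open>sqrt (h ln (ln (1 / h)))\<close>, so the claim is Khinchin's law of the iterated logarithm at the origin.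
  Its upper half (\<open>brownian_LIL_upper\<close>) follows from Levy's maximal inequality and the convergence
  half of the Borel-Cantelli lemma along a geometric sequence of times; its lower half
  (\<open>brownian_LIL_lower\<close>) from the independent increments along a sparse geometric sequence and the
  divergence half.
\<close>

section \<open>Gaussian tails and Levy's maximal inequality\<close>

text \<open>
  For \<open>y \<ge> x \<ge> 0\<close> one has \<open>y\<^sup>2 \<ge> x\<^sup>2 + (y - x)\<^sup>2\<close>. Hence beyond \<open>x\<close> the centred density is at most
  \<open>exp (- x\<^sup>2 / (2 s\<^sup>2))\<close> times the density with mean \<open>x\<close>, which has total mass \<open>1\<close>.
\<close>
lemma (in prob_space) normal_upper_tail:
  assumes X: "distributed M lborel X (normal_density 0 s)" and s: "s > 0" and x: "x \<ge> 0"
  shows "prob {\<omega>\<in>space M. x \<le> X \<omega>} \<le> exp (- x\<^sup>2 / (2 * s\<^sup>2))"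
proof -
  have [measurable]: "X \<in> borel_measurable M"
    using distributed_measurable[OF X] by simp
  have "emeasure M (X -` {x..} \<inter> space M) =
      (\<integral>\<^sup>+y. ennreal (normal_density 0 s y) * indicator {x..} y \<partial>lborel)"
    by (rule distributed_emeasure[OF X]) simp
  also have "\<dots> \<le> (\<integral>\<^sup>+y. ennreal (exp (- x\<^sup>2 / (2 * s\<^sup>2))) * ennreal (normal_density x s y) \<partial>lborel)"
  proof (intro nn_integral_mono)
    fix y :: real
    show "ennreal (normal_density 0 s y) * indicator {x..} y
        \<le> ennreal (exp (- x\<^sup>2 / (2 * s\<^sup>2))) * ennreal (normal_density x s y)"
    proof (cases "x \<le> y")
      case True
      have "0 \<le> 2 * x * (y - x)" using True x by simp
      then have "- y\<^sup>2 \<le> - x\<^sup>2 - (y - x)\<^sup>2" by (simp add: power2_eq_square algebra_simps)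
      then have "- y\<^sup>2 / (2 * s\<^sup>2) \<le> (- x\<^sup>2 - (y - x)\<^sup>2) / (2 * s\<^sup>2)"
        by (intro divide_right_mono) auto
      also have "\<dots> = - x\<^sup>2 / (2 * s\<^sup>2) + - (y - x)\<^sup>2 / (2 * s\<^sup>2)"
        by (simp add: diff_divide_distrib)
      finally have "exp (- y\<^sup>2 / (2 * s\<^sup>2)) \<le> exp (- x\<^sup>2 / (2 * s\<^sup>2)) * exp (- (y - x)\<^sup>2 / (2 * s\<^sup>2))"
        by (simp add: exp_add[symmetric])
      then have "normal_density 0 s y \<le> exp (- x\<^sup>2 / (2 * s\<^sup>2)) * normal_density x s y"
        using s unfolding normal_density_def by (simp add: field_simps)
      then show ?thesis using True by (simp add: ennreal_mult[symmetric] ennreal_leI)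
    qed auto
  qed
  also have "\<dots> = ennreal (exp (- x\<^sup>2 / (2 * s\<^sup>2)))"
    using nn_integral_eq_integral[OF integrable_normal_density[OF s, of x]] s
    by (subst nn_integral_cmult) auto
  also have "X -` {x..} \<inter> space M = {\<omega>\<in>space M. x \<le> X \<omega>}" by auto
  finally show ?thesis by (simp add: emeasure_eq_measure)
qed

text \<open>
  The density is at least its value at the right end of the window from \<open>x s\<close> to \<open>(x + 1 / x) s\<close>, and
  there the exponent has changed only by a bounded amount because \<open>(x + 1 / x)\<^sup>2 \<le> x\<^sup>2 + 3\<close>. Apart from
  the factor \<open>1 / x\<close> this matches the upper bound; at the scale of the iterated logarithm that factor
  is too weak to make a divergent series converge.
\<close>
lemma (in prob_space) normal_lower_tail:
  assumes X: "distributed M lborel X (normal_density 0 s)" and s: "s > 0" and x: "x \<ge> 1"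
  shows "exp (- 3 / 2) / sqrt (2 * pi) * (exp (- x\<^sup>2 / 2) / x) \<le> prob {\<omega>\<in>space M. x * s \<le> X \<omega>}"
proof -
  have [measurable]: "X \<in> borel_measurable M"
    using distributed_measurable[OF X] by simp
  define c where "c = exp (- (x + 1 / x)\<^sup>2 / 2) / sqrt (2 * pi * s\<^sup>2)"
  have c0: "c \<ge> 0" by (simp add: c_def)
  have "ennreal (c * (s / x)) = (\<integral>\<^sup>+y. ennreal c * indicator {x * s..(x + 1 / x) * s} y \<partial>lborel)"
    using s x c0 by (subst nn_integral_cmult_indicator)
      (auto simp: field_simps ennreal_mult[symmetric])
  also have "\<dots> \<le> (\<integral>\<^sup>+y. ennreal (normal_density 0 s y) * indicator {x * s..} y \<partial>lborel)"
  proof (intro nn_integral_mono)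
    fix y :: real
    show "ennreal c * indicator {x * s..(x + 1 / x) * s} y
        \<le> ennreal (normal_density 0 s y) * indicator {x * s..} y"
    proof (cases "y \<in> {x * s..(x + 1 / x) * s}")
      case True
      have "0 \<le> x * s" using x s by simp
      then have "y\<^sup>2 \<le> ((x + 1 / x) * s)\<^sup>2"
        using True by (intro power_mono) (auto intro: order_trans)
      then have "y\<^sup>2 / s\<^sup>2 \<le> (x + 1 / x)\<^sup>2"
        using s unfolding power_mult_distrib by (simp only: pos_divide_le_eq zero_less_power)
      then have "- (x + 1 / x)\<^sup>2 / 2 \<le> - y\<^sup>2 / (2 * s\<^sup>2)" by simp
      then have "c \<le> normal_density 0 s y"
        unfolding c_def normal_density_def by (simp add: divide_right_mono)
      then show ?thesis using True by (simp add: ennreal_leI)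
    qed auto
  qed
  also have "\<dots> = emeasure M (X -` {x * s..} \<inter> space M)"
    by (rule distributed_emeasure[OF X, symmetric]) simp
  also have "X -` {x * s..} \<inter> space M = {\<omega>\<in>space M. x * s \<le> X \<omega>}" by auto
  finally have *: "c * (s / x) \<le> prob {\<omega>\<in>space M. x * s \<le> X \<omega>}"
    by (simp add: emeasure_eq_measure)
  have "(x + 1 / x)\<^sup>2 = x\<^sup>2 + 2 + (1 / x)\<^sup>2" using x by (simp add: power2_sum)
  also have "(1 / x)\<^sup>2 \<le> 1" using x by (simp add: power_le_one)
  finally have "- x\<^sup>2 / 2 + - 3 / 2 \<le> - (x + 1 / x)\<^sup>2 / 2" by simp
  then have "exp (- 3 / 2) * exp (- x\<^sup>2 / 2) \<le> exp (- (x + 1 / x)\<^sup>2 / 2)"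
    by (simp add: exp_add[symmetric] add.commute)
  then have "exp (- 3 / 2) * exp (- x\<^sup>2 / 2) / (sqrt (2 * pi) * x)
      \<le> exp (- (x + 1 / x)\<^sup>2 / 2) / (sqrt (2 * pi) * x)"
    using x by (intro divide_right_mono) auto
  also have "\<dots> = c * (s / x)" using s x by (simp add: c_def real_sqrt_mult)
  finally show ?thesis using * by simp
qed

lemma (in prob_space) normal_nonneg_prob:
  assumes X: "distributed M lborel X (normal_density 0 s)" and s: "s > 0"
  shows "prob {\<omega>\<in>space M. 0 \<le> X \<omega>} \<ge> 1 / 2"
proof -
  have [measurable]: "X \<in> borel_measurable M"
    using distributed_measurable[OF X] by simp
  \<comment> \<open>\<open>X\<close> and \<open>- X\<close> have the same law, so neither sign has probability below \<open>1 / 2\<close>.\<close>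
  have X': "distributed M lborel (\<lambda>x. 0 + (-1) * X x) (normal_density 0 s)"
    using normal_density_affine[OF X s, of "-1" 0] by simp
  have "{\<omega>\<in>space M. 0 \<le> X \<omega>} = X -` {0..} \<inter> space M" by auto
  moreover have "{\<omega>\<in>space M. X \<omega> \<le> 0} = (\<lambda>x. 0 + (-1) * X x) -` {0..} \<inter> space M" by auto
  ultimately have eq: "prob {\<omega>\<in>space M. X \<omega> \<le> 0} = prob {\<omega>\<in>space M. 0 \<le> X \<omega>}"
    using distributed_emeasure[OF X, of "{0..}"] distributed_emeasure[OF X', of "{0..}"]
    by (simp add: emeasure_eq_measure) (metis ennreal_inj measure_nonneg)
  have "1 = prob ({\<omega>\<in>space M. X \<omega> \<le> 0} \<union> {\<omega>\<in>space M. 0 \<le> X \<omega>})"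
    by (subst prob_space[symmetric]) (auto intro!: arg_cong[where f=prob])
  also have "\<dots> \<le> prob {\<omega>\<in>space M. X \<omega> \<le> 0} + prob {\<omega>\<in>space M. 0 \<le> X \<omega>}"
    by (rule measure_Un_le) auto
  finally show ?thesis using eq by simp
qed

text \<open>
  Split according to the first index \<open>k\<close> at which the partial sum reaches \<open>x\<close>. The sum of the later
  terms is independent of that event and is nonnegative with probability at least \<open>1 / 2\<close>; if it is,
  the full sum is still at least \<open>x\<close>. The assumption on the later terms holds whenever their sums are
  symmetric.
\<close>
lemma (in prob_space) levy_maximal_inequality:
  fixes \<xi> :: "nat \<Rightarrow> 'a \<Rightarrow> real"
  assumes ind: "indep_vars (\<lambda>_. borel) \<xi> {..<n}"
    and tail: "\<And>k. k < n \<Longrightarrow> 1 / 2 \<le> prob {\<omega>\<in>space M. 0 \<le> (\<Sum>i\<in>{k..<n}. \<xi> i \<omega>)}"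
  shows "prob {\<omega>\<in>space M. \<exists>k\<le>n. x \<le> (\<Sum>i<k. \<xi> i \<omega>)} \<le> 2 * prob {\<omega>\<in>space M. x \<le> (\<Sum>i<n. \<xi> i \<omega>)}"
proof -
  have [measurable]: "\<xi> i \<in> borel_measurable M" if "i < n" for i
    using ind that by (auto simp: indep_vars_def)
  define S where "S k \<omega> = (\<Sum>i<k. \<xi> i \<omega>)" for k \<omega>
  have [measurable]: "S k \<in> borel_measurable M" if "k \<le> n" for k
    unfolding S_def using that by (intro borel_measurable_sum) auto
  define E where "E k = {\<omega>\<in>space M. x \<le> S k \<omega> \<and> (\<forall>j<k. S j \<omega> < x)}" for k
  define F where "F k = {\<omega>\<in>space M. 0 \<le> (\<Sum>i\<in>{k..<n}. \<xi> i \<omega>)}" for k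
  have Em[measurable]: "E k \<in> events" if "k \<le> n" for k
  proof -
    have "Measurable.pred M (\<lambda>\<omega>. x \<le> S k \<omega> \<and> (\<forall>j\<in>{..<k}. S j \<omega> < x))"
      apply measurable using that by auto
    then show ?thesis unfolding E_def by (simp add: pred_def Ball_def)
  qed
  have Fm[measurable]: "F k \<in> events" for k
    unfolding F_def by measurable
  have EF: "prob (E k \<inter> F k) = prob (E k) * prob (F k)" if "k \<le> n" for k
  proof -
    define SE where "SE = {f \<in> space (PiM {..<k} (\<lambda>_. borel :: real measure)).
        x \<le> (\<Sum>i<k. f i) \<and> (\<forall>j\<in>{..<k}. (\<Sum>i<j. f i) < x)}"
    define SF where "SF = {f \<in> space (PiM {k..<n} (\<lambda>_. borel :: real measure)). 0 \<le> (\<Sum>i\<in>{k..<n}. f i)}"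
    have 1: "SE \<in> sets (PiM {..<k} (\<lambda>_. borel))" unfolding SE_def by measurable
    have 2: "SF \<in> sets (PiM {k..<n} (\<lambda>_. borel))" unfolding SF_def by measurable
    have "indep_var (PiM {..<k} (\<lambda>_. borel)) (\<lambda>\<omega>. restrict (\<lambda>i. \<xi> i \<omega>) {..<k})
       (PiM {k..<n} (\<lambda>_. borel)) (\<lambda>\<omega>. restrict (\<lambda>i. \<xi> i \<omega>) {k..<n})"
      by (rule indep_var_restrict[OF ind]) (use that in auto)
    from indep_varD[OF this 1 2]
    have "prob ((\<lambda>\<omega>. (restrict (\<lambda>i. \<xi> i \<omega>) {..<k}, restrict (\<lambda>i. \<xi> i \<omega>) {k..<n})) -` (SE \<times> SF) \<inter> space M)
      = prob ((\<lambda>\<omega>. restrict (\<lambda>i. \<xi> i \<omega>) {..<k}) -` SE \<inter> space M)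
       * prob ((\<lambda>\<omega>. restrict (\<lambda>i. \<xi> i \<omega>) {k..<n}) -` SF \<inter> space M)" .
    moreover have "(\<lambda>\<omega>. restrict (\<lambda>i. \<xi> i \<omega>) {..<k}) -` SE \<inter> space M = E k"
      by (auto simp: SE_def E_def S_def space_PiM)
    moreover have "(\<lambda>\<omega>. restrict (\<lambda>i. \<xi> i \<omega>) {k..<n}) -` SF \<inter> space M = F k"
      by (auto simp: SF_def F_def space_PiM)
    moreover have "(\<lambda>\<omega>. (restrict (\<lambda>i. \<xi> i \<omega>) {..<k}, restrict (\<lambda>i. \<xi> i \<omega>) {k..<n})) -` (SE \<times> SF) \<inter> space M
       = ((\<lambda>\<omega>. restrict (\<lambda>i. \<xi> i \<omega>) {..<k}) -` SE \<inter> space M) \<inter> ((\<lambda>\<omega>. restrict (\<lambda>i. \<xi> i \<omega>) {k..<n}) -` SF \<inter> space M)"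
      by auto
    ultimately show ?thesis by simp
  qed
  have F2: "1 / 2 \<le> prob (F k)" if "k \<le> n" for k
  proof (cases "k = n")
    case True
    then show ?thesis by (simp add: F_def prob_space)
  next
    case False
    then show ?thesis using tail[of k] that by (simp add: F_def)
  qed
  have disjE: "disjoint_family_on E {..n}"
    by (auto simp: disjoint_family_on_def E_def) (metis linorder_neqE_nat not_less)
  have "{\<omega>\<in>space M. \<exists>k\<le>n. x \<le> S k \<omega>} \<subseteq> (\<Union>k\<in>{..n}. E k)"
  proof
    fix \<omega> assume \<omega>: "\<omega> \<in> {\<omega>\<in>space M. \<exists>k\<le>n. x \<le> S k \<omega>}"
    then obtain k where k: "k \<le> n" "x \<le> S k \<omega>" by auto
    \<comment> \<open>the first passage\<close>
    define m where "m = (LEAST k. x \<le> S k \<omega>)"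
    have "x \<le> S m \<omega>" "m \<le> k" using k unfolding m_def by (auto intro: LeastI Least_le)
    moreover have "\<forall>j<m. S j \<omega> < x" unfolding m_def using not_less_Least by force
    ultimately show "\<omega> \<in> (\<Union>k\<in>{..n}. E k)" using \<omega> k by (auto simp: E_def)
  qed
  then have "prob {\<omega>\<in>space M. \<exists>k\<le>n. x \<le> S k \<omega>} \<le> prob (\<Union>k\<in>{..n}. E k)"
    by (intro finite_measure_mono) auto
  also have "\<dots> = (\<Sum>k\<le>n. prob (E k))"
    using disjE by (intro finite_measure_finite_Union) auto
  also have "\<dots> \<le> (\<Sum>k\<le>n. 2 * prob (E k \<inter> F k))"
  proof (intro sum_mono)
    fix k assume k: "k \<in> {..n}"
    have "prob (E k) * (1 / 2) \<le> prob (E k) * prob (F k)"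
      using F2[of k] k by (intro mult_left_mono) auto
    then show "prob (E k) \<le> 2 * prob (E k \<inter> F k)" using EF[of k] k by simp
  qed
  also have "\<dots> = 2 * prob (\<Union>k\<in>{..n}. E k \<inter> F k)"
    unfolding sum_distrib_left[symmetric] using disjE
    by (subst finite_measure_finite_Union) (auto simp: disjoint_family_on_def)
  also have "prob (\<Union>k\<in>{..n}. E k \<inter> F k) \<le> prob {\<omega>\<in>space M. x \<le> S n \<omega>}"
  proof (intro finite_measure_mono)
    show "(\<Union>k\<in>{..n}. E k \<inter> F k) \<subseteq> {\<omega>\<in>space M. x \<le> S n \<omega>}"
    proof safe
      fix k \<omega> assume *: "k \<le> n" "\<omega> \<in> E k" "\<omega> \<in> F k"
      have "S n \<omega> = S k \<omega> + (\<Sum>i\<in>{k..<n}. \<xi> i \<omega>)"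
        unfolding S_def using * by (metis atLeast0LessThan sum.atLeastLessThan_concat zero_le)
      then show "x \<le> S n \<omega>" using * by (auto simp: E_def F_def)
    qed (auto simp: E_def)
  qed auto
  finally show ?thesis unfolding S_def by simp
qed

section \<open>The law of the iterated logarithm for Brownian motion at the origin\<close>

lemma brownian_motionD:
  assumes "brownian_motion M W"
  shows "prob_space M" and "0 \<le> t \<Longrightarrow> W t \<in> borel_measurable M"
    and "AE \<omega> in M. W 0 \<omega> = 0"
    and "0 \<le> s \<Longrightarrow> s < t \<Longrightarrow>
        distributed M lborel (\<lambda>\<omega>. W t \<omega> - W s \<omega>) (normal_density 0 (sqrt (t - s)))"
    and "0 \<le> \<tau> 0 \<Longrightarrow> (\<And>i. i < n \<Longrightarrow> \<tau> i \<le> \<tau> (Suc i)) \<Longrightarrow>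
        prob_space.indep_vars M (\<lambda>_. borel) (\<lambda>i \<omega>. W (\<tau> (Suc i)) \<omega> - W (\<tau> i) \<omega>) {..<n}"
    and "AE \<omega> in M. continuous_on {0..} (\<lambda>t. W t \<omega>)"
  using assms unfolding brownian_motion_def by blast+

lemma brownian_motion_uminus:
  assumes bm: "brownian_motion M W"
  shows "brownian_motion M (\<lambda>t \<omega>. - W t \<omega>)"
proof -
  interpret prob_space M using brownian_motionD(1)[OF bm] .
  show ?thesis
    unfolding brownian_motion_def
  proof (intro conjI allI impI)
    show "prob_space M" by unfold_locales
  next
    fix t :: real assume "0 \<le> t"
    then show "(\<lambda>\<omega>. - W t \<omega>) \<in> borel_measurable M"
      using brownian_motionD(2)[OF bm, of t] by measurable
  next
    show "AE \<omega> in M. - W 0 \<omega> = 0" using brownian_motionD(3)[OF bm] by simp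
  next
    fix s t :: real assume "0 \<le> s \<and> s < t"
    then have "distributed M lborel (\<lambda>\<omega>. 0 + (-1) * (W t \<omega> - W s \<omega>))
        (normal_density (0 + (-1) * 0) (\<bar>-1\<bar> * sqrt (t - s)))"
      using brownian_motionD(4)[OF bm, of s t] by (intro normal_density_affine) auto
    then show "distributed M lborel (\<lambda>\<omega>. - W t \<omega> - - W s \<omega>) (normal_density 0 (sqrt (t - s)))"
      by (simp add: algebra_simps)
  next
    fix n :: nat and \<tau> :: "nat \<Rightarrow> real"
    assume "0 \<le> \<tau> 0 \<and> (\<forall>i<n. \<tau> i \<le> \<tau> (Suc i))"
    then have "indep_vars (\<lambda>_. borel) (\<lambda>i \<omega>. - (W (\<tau> (Suc i)) \<omega> - W (\<tau> i) \<omega>)) {..<n}"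
      by (intro indep_vars_compose2[OF brownian_motionD(5)[OF bm]]) auto
    then show "indep_vars (\<lambda>_. borel) (\<lambda>i \<omega>. - W (\<tau> (Suc i)) \<omega> - - W (\<tau> i) \<omega>) {..<n}"
      by (simp add: algebra_simps)
  next
    show "AE \<omega> in M. continuous_on {0..} (\<lambda>t. - W t \<omega>)"
      using brownian_motionD(6)[OF bm] by eventually_elim (intro continuous_intros)
  qed
qed

text \<open>
  Levy's inequality applies to each dyadic grid of the interval with a bound that does not depend on
  the grid; the events increase with refinement, and continuity extends the conclusion from dyadic
  times to all times. An exceptional event takes the place of a supremum, because the process is
  continuous only almost surely and the supremum of a general path need not be measurable.
\<close>
lemma brownian_maximal_bound:
  assumes bm: "brownian_motion M W" and T: "T > 0" and x: "x \<ge> 0"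
  shows "\<exists>G\<in>sets M. measure M G \<le> 2 * exp (- x\<^sup>2 / (2 * T)) \<and>
           (AE \<omega> in M. \<omega> \<notin> G \<longrightarrow> (\<forall>s\<in>{0..T}. W s \<omega> \<le> x))"
proof -
  interpret prob_space M using brownian_motionD(1)[OF bm] .
  define \<tau> where "\<tau> m k = T * real k / 2 ^ m" for m k :: nat
  define \<xi> where "\<xi> m k \<omega> = W (\<tau> m (Suc k)) \<omega> - W (\<tau> m k) \<omega>" for m k \<omega>
  define G where "G m = {\<omega>\<in>space M. \<exists>k\<le>2 ^ m. x \<le> (\<Sum>i<k. \<xi> m i \<omega>)}" for m
  have \<tau>_nonneg: "0 \<le> \<tau> m k" for m k using T by (simp add: \<tau>_def)
  have \<tau>_mono: "\<tau> m k < \<tau> m l" if "k < l" for m k l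
    using T that by (simp add: \<tau>_def divide_strict_right_mono)
  have \<tau>_0: "\<tau> m 0 = 0" and \<tau>_T: "\<tau> m (2 ^ m) = T" for m by (auto simp: \<tau>_def)
  have tel: "(\<Sum>i\<in>{k..<l}. \<xi> m i \<omega>) = W (\<tau> m l) \<omega> - W (\<tau> m k) \<omega>" if "k \<le> l" for k l m \<omega>
    unfolding \<xi>_def using that by (rule sum_Suc_diff')
  have tel0: "(\<Sum>i<k. \<xi> m i \<omega>) = W (\<tau> m k) \<omega> - W 0 \<omega>" for k m \<omega>
    using tel[of 0 k m \<omega>] by (simp add: lessThan_atLeast0 \<tau>_0)
  have normal: "distributed M lborel (\<lambda>\<omega>. W (\<tau> m l) \<omega> - W (\<tau> m k) \<omega>)
      (normal_density 0 (sqrt (\<tau> m l - \<tau> m k)))" if "k < l" for k l m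
    using brownian_motionD(4)[OF bm \<tau>_nonneg \<tau>_mono[OF that]] .
  have Wm[measurable]: "W (\<tau> m k) \<in> borel_measurable M" for m k
    by (rule brownian_motionD(2)[OF bm \<tau>_nonneg])
  have W0m[measurable]: "W 0 \<in> borel_measurable M"
    by (rule brownian_motionD(2)[OF bm]) simp
  have Gm[measurable]: "G m \<in> events" for m
    unfolding G_def tel0 by measurable
  have PG: "prob (G m) \<le> 2 * exp (- x\<^sup>2 / (2 * T))" for m
  proof -
    have "prob (G m) \<le> 2 * prob {\<omega>\<in>space M. x \<le> (\<Sum>i<2 ^ m. \<xi> m i \<omega>)}"
      unfolding G_def
    proof (rule levy_maximal_inequality)
      show "indep_vars (\<lambda>_. borel) (\<xi> m) {..<2 ^ m}"
        unfolding \<xi>_def by (rule brownian_motionD(5)[OF bm]) (auto simp: \<tau>_0 intro!: less_imp_le \<tau>_mono)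
    next
      fix k :: nat assume k: "k < 2 ^ m"
      show "1 / 2 \<le> prob {\<omega> \<in> space M. 0 \<le> (\<Sum>i = k..<2 ^ m. \<xi> m i \<omega>)}"
        unfolding tel[OF less_imp_le[OF k]]
        by (rule normal_nonneg_prob[OF normal[OF k]]) (use \<tau>_mono[OF k] in simp)
    qed
    also have "prob {\<omega>\<in>space M. x \<le> (\<Sum>i<2 ^ m. \<xi> m i \<omega>)} \<le> exp (- x\<^sup>2 / (2 * (sqrt T)\<^sup>2))"
      unfolding tel0 using normal_upper_tail[OF normal[of 0 "2 ^ m" m] _ x] T by (simp add: \<tau>_0 \<tau>_T)
    finally show ?thesis using T by simp
  qed
  have inc: "incseq G"
  proof (rule incseq_SucI, safe)
    fix m \<omega> assume "\<omega> \<in> G m"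
    then obtain k where k: "\<omega> \<in> space M" "k \<le> 2 ^ m" "x \<le> W (\<tau> m k) \<omega> - W 0 \<omega>"
      unfolding G_def tel0 by auto
    moreover have "\<tau> m k = \<tau> (Suc m) (2 * k)" by (simp add: \<tau>_def)
    ultimately show "\<omega> \<in> G (Suc m)"
      unfolding G_def tel0 by (auto intro!: exI[of _ "2 * k"])
  qed
  have "prob (\<Union>m. G m) \<le> 2 * exp (- x\<^sup>2 / (2 * T))"
    by (rule LIMSEQ_le_const2[OF finite_Lim_measure_incseq[OF _ inc]]) (use PG in auto)
  moreover have "AE \<omega> in M. \<omega> \<notin> (\<Union>m. G m) \<longrightarrow> (\<forall>s\<in>{0..T}. W s \<omega> \<le> x)"
    using brownian_motionD(3)[OF bm] brownian_motionD(6)[OF bm] AE_space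
  proof eventually_elim
    fix \<omega> assume W0: "W 0 \<omega> = 0" and cont: "continuous_on {0..} (\<lambda>t. W t \<omega>)" and sp: "\<omega> \<in> space M"
    show "\<omega> \<notin> (\<Union>m. G m) \<longrightarrow> (\<forall>s\<in>{0..T}. W s \<omega> \<le> x)"
    proof (intro impI ballI)
      fix s assume notG: "\<omega> \<notin> (\<Union>m. G m)" and s: "s \<in> {0..T}"
      \<comment> \<open>Round \<open>s\<close> down to the dyadic grid of level \<open>m\<close>.\<close>
      define k where "k m = nat \<lfloor>s / T * 2 ^ m\<rfloor>" for m :: nat
      have st: "0 \<le> s / T * 2 ^ m" for m :: nat using s T by simp
      have k_le: "real (k m) \<le> s / T * 2 ^ m" and k_ge: "s / T * 2 ^ m - 1 \<le> real (k m)" for m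
        using st[of m] unfolding k_def by linarith+
      have k_le2: "k m \<le> 2 ^ m" for m
      proof -
        have "s / T * 2 ^ m \<le> 1 * 2 ^ m" using s T by (intro mult_right_mono) auto
        then have "real (k m) \<le> 2 ^ m" using k_le[of m] by linarith
        then show ?thesis by (metis of_nat_le_iff of_nat_numeral of_nat_power)
      qed
      have lim: "(\<lambda>m. \<tau> m (k m)) \<longlonglongrightarrow> s"
      proof (rule tendsto_sandwich[where f="\<lambda>m. s - T / 2 ^ m" and h="\<lambda>m. s"])
        show "\<forall>\<^sub>F m in sequentially. s - T / 2 ^ m \<le> \<tau> m (k m)"
        proof (intro always_eventually allI)
          fix m
          have "T / 2 ^ m * (s / T * 2 ^ m - 1) \<le> T / 2 ^ m * real (k m)"
            using k_ge T by (intro mult_left_mono) auto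
          then show "s - T / 2 ^ m \<le> \<tau> m (k m)" using T by (simp add: \<tau>_def right_diff_distrib)
        qed
        show "\<forall>\<^sub>F m in sequentially. \<tau> m (k m) \<le> s"
          using k_le T by (intro always_eventually allI) (simp add: \<tau>_def field_simps)
        have "(\<lambda>m. s - T * (1 / 2) ^ m) \<longlonglongrightarrow> s - T * 0"
          by (intro tendsto_intros LIMSEQ_power_zero) auto
        then show "(\<lambda>m. s - T / 2 ^ m) \<longlonglongrightarrow> s" by (simp add: power_divide)
      qed simp
      have "(\<lambda>m. W (\<tau> m (k m)) \<omega>) \<longlonglongrightarrow> W s \<omega>"
        by (rule continuous_on_tendsto_compose[OF cont lim]) (use s \<tau>_nonneg in auto)
      moreover have "W (\<tau> m (k m)) \<omega> \<le> x" for m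
        using notG sp k_le2[of m] W0 unfolding G_def tel0 by force
      ultimately show "W s \<omega> \<le> x" by (intro LIMSEQ_le_const2) auto
    qed
  qed
  ultimately show ?thesis by (intro bexI[of _ "\<Union>m. G m"]) auto
qed

definition lil_scale :: "real \<Rightarrow> real" where
  "lil_scale h = sqrt (2 * h * ln (ln (1 / h)))"

text \<open>
  The derivative of \<open>h ln (- ln h)\<close> is \<open>ln (- ln h) - 1 / (- ln h)\<close>. Up to \<open>exp (- e)\<close> the first term is at
  least \<open>1\<close> and the second at most \<open>1\<close>. Monotonicity carries bounds at the points of a geometric
  sequence to the times between them.
\<close>
lemma lil_scale_mono:
  assumes "0 < a" "a \<le> b" "b \<le> exp (- exp 1)"
  shows "lil_scale a \<le> lil_scale b"
proof -
  have e: "exp 1 \<le> - ln h" if "a \<le> h" "h \<le> b" for h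
  proof -
    have "0 < h" "h \<le> exp (- exp 1)" using that assms by auto
    then have "ln h \<le> - exp 1" by (metis ln_exp ln_le_cancel_iff exp_gt_zero)
    then show ?thesis by simp
  qed
  have "a * ln (- ln a) \<le> b * ln (- ln b)"
  proof (rule DERIV_nonneg_imp_nondecreasing[OF \<open>a \<le> b\<close>])
    fix h assume h: "a \<le> h" "h \<le> b"
    have h0: "0 < h" using h assms by simp
    have l0: "0 < - ln h" using e[OF h] exp_gt_zero[of "1::real"] by linarith
    have "((\<lambda>h. h * ln (- ln h)) has_real_derivative ln (- ln h) - 1 / (- ln h)) (at h)"
      using h0 l0 by (auto intro!: derivative_eq_intros simp: field_simps)
    moreover have "1 \<le> ln (- ln h)" using e[OF h] l0 by (simp add: ln_ge_iff)
    moreover have "1 / (- ln h) \<le> 1"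
    proof -
      have "1 \<le> exp (1::real)" by simp
      then have "1 \<le> - ln h" using e[OF h] by linarith
      then show ?thesis using divide_le_eq_1_pos[OF l0, of 1] by blast
    qed
    ultimately show "\<exists>y. ((\<lambda>h. h * ln (- ln h)) has_real_derivative y) (at h) \<and> 0 \<le> y"
      by (intro exI[of _ "ln (- ln h) - 1 / (- ln h)"]) auto
  qed
  then show ?thesis using assms by (simp add: lil_scale_def ln_div)
qed

lemma geometric_bracket:
  fixes \<theta> h :: real
  assumes "0 < \<theta>" "\<theta> < 1" "0 < h" "h < \<theta> ^ N"
  obtains n where "N \<le> n" "\<theta> ^ Suc n \<le> h" "h \<le> \<theta> ^ n"
proof -
  obtain m where "\<theta> ^ m < h" using real_arch_pow_inv[OF \<open>0 < h\<close> \<open>\<theta> < 1\<close>] by blast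
  then have ex: "\<theta> ^ m \<le> h" by simp
  define k where "k = (LEAST m. \<theta> ^ m \<le> h)"
  have k: "\<theta> ^ k \<le> h" unfolding k_def using ex by (rule LeastI)
  have Nk: "N < k"
  proof (rule ccontr)
    assume "\<not> N < k"
    then have "\<theta> ^ N \<le> \<theta> ^ k" using assms by (intro power_decreasing) auto
    then show False using k assms by linarith
  qed
  then obtain n where n: "k = Suc n" by (metis not_less_zero old.nat.exhaust)
  have "\<not> \<theta> ^ n \<le> h" using not_less_Least[of n "\<lambda>m. \<theta> ^ m \<le> h"] n unfolding k_def by simp
  then show ?thesis using that[of n] Nk k n by simp
qed

text \<open>
  Let \<open>\<theta> = 1 / (1 + \<epsilon>)\<close> and compare the maximum over \<open>[0, \<theta>\<^sup>n]\<close> with the threshold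
  \<open>(1 + \<epsilon>) lil_scale (\<theta>\<^sup>n\<^sup>+\<^sup>1)\<close>. By the maximal inequality the probability of exceeding it is of order
  \<open>n\<close> to the power \<open>- (1 + \<epsilon>)\<^sup>2 \<theta> = - (1 + \<epsilon>)\<close>, which is summable. By monotonicity of the scale the
  threshold is at most \<open>(1 + \<epsilon>) lil_scale h\<close> for \<open>h\<close> between \<open>\<theta>\<^sup>n\<^sup>+\<^sup>1\<close> and \<open>\<theta>\<^sup>n\<close>.
\<close>
lemma brownian_LIL_upper:
  assumes bm: "brownian_motion M W" and \<epsilon>: "\<epsilon> > 0"
  shows "AE \<omega> in M. \<forall>\<^sub>F h in at_right 0. W h \<omega> \<le> (1 + \<epsilon>) * lil_scale h"
proof -
  interpret prob_space M using brownian_motionD(1)[OF bm] .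
  define \<theta> where "\<theta> = 1 / (1 + \<epsilon>)"
  define L where "L = ln (1 + \<epsilon>)"
  have \<theta>: "0 < \<theta>" "\<theta> < 1" "\<theta> * (1 + \<epsilon>) = 1" using \<epsilon> by (auto simp: \<theta>_def)
  have L: "0 < L" using \<epsilon> by (simp add: L_def)
  have ln_pow: "ln (1 / \<theta> ^ n) = real n * L" for n
    using \<epsilon> by (simp add: \<theta>_def L_def power_divide ln_realpow)
  define x where "x n = (1 + \<epsilon>) * lil_scale (\<theta> ^ Suc n)" for n
  \<comment> \<open>For small \<open>n\<close> the iterated logarithm in \<open>x n\<close> may be negative; the maximum with \<open>0\<close> keeps the
    threshold admissible there and is eventually \<open>x n\<close> itself.\<close>
  have "\<exists>G. G \<in> events \<and> prob G \<le> 2 * exp (- (max 0 (x n))\<^sup>2 / (2 * \<theta> ^ n)) \<and>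
      (AE \<omega> in M. \<omega> \<notin> G \<longrightarrow> (\<forall>s\<in>{0..\<theta> ^ n}. W s \<omega> \<le> max 0 (x n)))" for n
    using brownian_maximal_bound[OF bm, of "\<theta> ^ n" "max 0 (x n)"] \<theta> by auto
  from choice[OF allI[OF this]] obtain G where G: "\<forall>n. G n \<in> events \<and>
      prob (G n) \<le> 2 * exp (- (max 0 (x n))\<^sup>2 / (2 * \<theta> ^ n)) \<and>
      (AE \<omega> in M. \<omega> \<notin> G n \<longrightarrow> (\<forall>s\<in>{0..\<theta> ^ n}. W s \<omega> \<le> max 0 (x n)))" ..
  then have Gm[measurable]: "G n \<in> events"
    and GP: "prob (G n) \<le> 2 * exp (- (max 0 (x n))\<^sup>2 / (2 * \<theta> ^ n))"
    and GA: "AE \<omega> in M. \<omega> \<notin> G n \<longrightarrow> (\<forall>s\<in>{0..\<theta> ^ n}. W s \<omega> \<le> max 0 (x n))" for n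
    by simp_all
  have evL: "\<forall>\<^sub>F n in sequentially. 1 \<le> real (Suc n) * L"
    using L by real_asymp
  have x_eq: "max 0 (x n) = x n"
    and xx: "2 * exp (- (max 0 (x n))\<^sup>2 / (2 * \<theta> ^ n)) = 2 * L powr - (1 + \<epsilon>) * (real (Suc n) powr - (1 + \<epsilon>))"
    if "1 \<le> real (Suc n) * L" for n
  proof -
    have l: "0 \<le> ln (real (Suc n) * L)" using that by simp
    have x: "x n = (1 + \<epsilon>) * sqrt (2 * \<theta> ^ Suc n * ln (real (Suc n) * L))"
      unfolding x_def lil_scale_def ln_pow ..
    then show *: "max 0 (x n) = x n" using l \<theta> \<epsilon> by (simp add: max_def)
    have "(x n)\<^sup>2 = (1 + \<epsilon>)\<^sup>2 * (2 * \<theta> ^ Suc n * ln (real (Suc n) * L))"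
      unfolding x power_mult_distrib using l \<theta> by (subst real_sqrt_pow2) auto
    also have "\<dots> = (\<theta> * (1 + \<epsilon>)) * (2 * \<theta> ^ n * ((1 + \<epsilon>) * ln (real (Suc n) * L)))"
      by (simp add: power2_eq_square algebra_simps)
    finally have "- (x n)\<^sup>2 / (2 * \<theta> ^ n) = - (1 + \<epsilon>) * ln (real (Suc n) * L)"
      using \<theta> by (simp del: of_nat_Suc add: field_simps)
    then have "2 * exp (- (max 0 (x n))\<^sup>2 / (2 * \<theta> ^ n)) = 2 * (real (Suc n) * L) powr - (1 + \<epsilon>)"
      unfolding * using L by (simp add: powr_def)
    then show "2 * exp (- (max 0 (x n))\<^sup>2 / (2 * \<theta> ^ n)) = 2 * L powr - (1 + \<epsilon>) * (real (Suc n) powr - (1 + \<epsilon>))"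
      using L by (simp add: powr_mult del: of_nat_Suc)
  qed
  have "summable (\<lambda>n. prob (G n))"
  proof (rule summable_comparison_test_ev)
    show "\<forall>\<^sub>F n in sequentially. norm (prob (G n)) \<le> 2 * L powr - (1 + \<epsilon>) * (real (Suc n) powr - (1 + \<epsilon>))"
      using evL
    proof eventually_elim
      fix n assume n: "1 \<le> real (Suc n) * L"
      show "norm (prob (G n)) \<le> 2 * L powr - (1 + \<epsilon>) * (real (Suc n) powr - (1 + \<epsilon>))"
        using GP[of n] unfolding xx[OF n] by simp
    qed
    have "summable (\<lambda>n. real n powr - (1 + \<epsilon>))"
      using \<epsilon> by (subst summable_real_powr_iff) auto
    then have "summable (\<lambda>n. real (Suc n) powr - (1 + \<epsilon>))"
      by (subst summable_Suc_iff)
    then show "summable (\<lambda>n. 2 * L powr - (1 + \<epsilon>) * (real (Suc n) powr - (1 + \<epsilon>)))"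
      by (rule summable_mult)
  qed
  then have "AE \<omega> in M. \<forall>\<^sub>F n in sequentially. \<omega> \<in> space M - G n"
    by (intro borel_cantelli_AE1) (auto simp: emeasure_eq_measure)
  moreover have "AE \<omega> in M. \<forall>n. \<omega> \<notin> G n \<longrightarrow> (\<forall>s\<in>{0..\<theta> ^ n}. W s \<omega> \<le> max 0 (x n))"
    using GA by (simp add: AE_all_countable)
  ultimately show ?thesis
  proof eventually_elim
    fix \<omega> assume ev: "\<forall>\<^sub>F n in sequentially. \<omega> \<in> space M - G n"
      and A: "\<forall>n. \<omega> \<notin> G n \<longrightarrow> (\<forall>s\<in>{0..\<theta> ^ n}. W s \<omega> \<le> max 0 (x n))"
    have "(\<lambda>n. \<theta> ^ n) \<longlonglongrightarrow> 0" using \<theta> by (intro LIMSEQ_power_zero) auto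
    then have "\<forall>\<^sub>F n in sequentially. \<theta> ^ n < exp (- exp 1)"
      by (rule order_tendstoD) simp
    with ev evL have "\<forall>\<^sub>F n in sequentially. \<omega> \<notin> G n \<and> 1 \<le> real (Suc n) * L \<and> \<theta> ^ n < exp (- exp 1)"
      by eventually_elim auto
    then obtain N where N: "\<And>n. N \<le> n \<Longrightarrow> \<omega> \<notin> G n \<and> 1 \<le> real (Suc n) * L \<and> \<theta> ^ n < exp (- exp 1)"
      by (auto simp: eventually_sequentially)
    have "\<forall>\<^sub>F h in at_right 0. h \<in> {0<..<\<theta> ^ N}"
      using \<theta> by (intro eventually_at_right_real) auto
    then show "\<forall>\<^sub>F h in at_right 0. W h \<omega> \<le> (1 + \<epsilon>) * lil_scale h"
    proof eventually_elim
      fix h assume h: "h \<in> {0<..<\<theta> ^ N}"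
      obtain n where n: "N \<le> n" "\<theta> ^ Suc n \<le> h" "h \<le> \<theta> ^ n"
        using geometric_bracket[OF \<theta>(1,2), of h N] h by auto
      have "W h \<omega> \<le> x n" using A N[OF n(1)] h n x_eq[of n] by fastforce
      also have "\<dots> \<le> (1 + \<epsilon>) * lil_scale h"
        unfolding x_def using \<epsilon> n N[OF n(1)] \<theta> by (intro mult_left_mono lil_scale_mono) auto
      finally show "W h \<omega> \<le> (1 + \<epsilon>) * lil_scale h" .
    qed
  qed
qed

text \<open>
  The probability that none of the events with index from \<open>m\<close> to \<open>N\<close> occurs is the product of the
  \<open>1 - p n \<le> exp (- p n)\<close>, and this tends to \<open>0\<close> as \<open>N\<close> grows because the series diverges.
\<close>
lemma (in prob_space) borel_cantelli_indep:
  fixes X :: "nat \<Rightarrow> 'a \<Rightarrow> real"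
  assumes ind: "\<And>N. indep_vars (\<lambda>_. borel) X {..<N}"
    and A: "\<And>n. A n \<in> sets borel"
    and div: "\<not> summable (\<lambda>n. prob {\<omega>\<in>space M. X n \<omega> \<in> A n})"
  shows "AE \<omega> in M. \<exists>\<^sub>F n in sequentially. X n \<omega> \<in> A n"
proof -
  define p where "p n = prob {\<omega>\<in>space M. X n \<omega> \<in> A n}" for n
  have Xm[measurable]: "X n \<in> borel_measurable M" for n
    using ind[of "Suc n"] by (auto simp: indep_vars_def)
  note A[measurable]
  have vim: "X n -` (- A n) \<inter> space M = {\<omega>\<in>space M. X n \<omega> \<notin> A n}" for n by auto
  have p': "prob {\<omega>\<in>space M. X n \<omega> \<notin> A n} = 1 - p n" for n
    unfolding p_def by (subst prob_compl[symmetric]) (auto intro!: arg_cong[where f=prob])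
  have "AE \<omega> in M. \<not> (\<forall>n\<ge>m. X n \<omega> \<notin> A n)" for m
  proof -
    define Z where "Z = {\<omega>\<in>space M. \<forall>n\<ge>m. X n \<omega> \<notin> A n}"
    have Zm[measurable]: "Z \<in> events" unfolding Z_def by measurable
    have Zle: "prob Z \<le> exp (- (\<Sum>n\<in>{m..<N}. p n))" if "m < N" for N
    proof -
      have "prob Z \<le> prob (\<Inter>n\<in>{m..<N}. X n -` (- A n) \<inter> space M)"
        by (intro finite_measure_mono) (use that in \<open>auto simp: Z_def\<close>)
      also have "\<dots> = (\<Prod>n\<in>{m..<N}. prob (X n -` (- A n) \<inter> space M))"
        by (rule indep_varsD[OF ind[of N]]) (use that in auto)
      also have "\<dots> = (\<Prod>n\<in>{m..<N}. 1 - p n)" unfolding vim p' ..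
      also have "\<dots> \<le> (\<Prod>n\<in>{m..<N}. exp (- p n))"
      proof (intro prod_mono conjI)
        fix n
        show "0 \<le> 1 - p n" by (simp add: p_def)
        show "1 - p n \<le> exp (- p n)" using exp_ge_add_one_self[of "- p n"] by simp
      qed
      also have "\<dots> = exp (- (\<Sum>n\<in>{m..<N}. p n))" by (simp add: exp_sum sum_negf[symmetric])
      finally show ?thesis .
    qed
    have "prob Z \<le> 0"
    proof (rule ccontr)
      assume "\<not> prob Z \<le> 0"
      then have Z0: "prob Z > 0" by simp
      have "(\<Sum>n<N. p n) \<le> (\<Sum>n<m. p n) + (- ln (prob Z))" for N
      proof (cases "m < N")
        case True
        have "ln (prob Z) \<le> - (\<Sum>n\<in>{m..<N}. p n)"
          using Zle[OF True] Z0 by (simp add: ln_ge_iff[symmetric] ln_le_cancel_iff[symmetric])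
        moreover have "(\<Sum>n<N. p n) = (\<Sum>n<m. p n) + (\<Sum>n\<in>{m..<N}. p n)"
          using True by (metis atLeast0LessThan sum.atLeastLessThan_concat zero_le less_imp_le)
        ultimately show ?thesis by simp
      next
        case False
        then have "(\<Sum>n<N. p n) \<le> (\<Sum>n<m. p n)"
          by (intro sum_mono2) (auto simp: p_def)
        moreover have "ln (prob Z) \<le> 0" using Z0 by simp
        ultimately show ?thesis by simp
      qed
      then have "summable p"
        by (intro summableI_nonneg_bounded) (auto simp: p_def)
      then show False using div by (simp add: p_def[abs_def])
    qed
    then have "AE \<omega> in M. \<omega> \<notin> Z"
      by (subst prob_eq_0[symmetric]) (auto intro: antisym)
    then show ?thesis using AE_space by eventually_elim (auto simp: Z_def)
  qed
  then have "AE \<omega> in M. \<forall>m. \<not> (\<forall>n\<ge>m. X n \<omega> \<notin> A n)"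
    by (simp add: AE_all_countable)
  then show ?thesis by eventually_elim (auto simp: frequently_sequentially)
qed

text \<open>
  Write \<open>W (q\<^sup>n) = (W (q\<^sup>n) - W (q\<^sup>n\<^sup>+\<^sup>1)) + W (q\<^sup>n\<^sup>+\<^sup>1)\<close> for a small ratio \<open>q\<close>. The differences are
  independent, and by the Gaussian lower tail they exceed \<open>\<gamma> sqrt (1 - q) lil_scale (q\<^sup>n)\<close> infinitely
  often for every \<open>\<gamma> < 1\<close>. By the upper law for \<open>- W\<close> the last term is eventually at least
  \<open>- 2 lil_scale (q\<^sup>n\<^sup>+\<^sup>1)\<close>, which is of order \<open>sqrt q lil_scale (q\<^sup>n)\<close> and so small against the main
  term.
\<close>
lemma brownian_LIL_lower:
  assumes bm: "brownian_motion M W" and \<epsilon>: "0 < \<epsilon>" "\<epsilon> < 1"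
  shows "AE \<omega> in M. \<exists>\<^sub>F h in at_right 0. (1 - \<epsilon>) * lil_scale h \<le> W h \<omega>"
proof -
  interpret prob_space M using brownian_motionD(1)[OF bm] .
  define \<gamma> where "\<gamma> = 1 - \<epsilon> / 2"
  have \<gamma>: "0 < \<gamma>" "\<gamma> < 1" using \<epsilon> by (auto simp: \<gamma>_def)
  \<comment> \<open>The constant to be compared with \<open>1 - \<epsilon>\<close>: main term \<open>\<gamma> sqrt (1 - q)\<close>, and twice the scale at the
    next time, which eventually is at most \<open>sqrt (2 q)\<close> times the scale at the present one.\<close>
  have "((\<lambda>q. \<gamma> * sqrt (1 - q) - 2 * sqrt (2 * q)) \<longlongrightarrow> \<gamma> * sqrt (1 - 0) - 2 * sqrt (2 * 0)) (at_right 0)"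
    by (intro tendsto_intros)
  then have "\<forall>\<^sub>F q in at_right 0. 1 - \<epsilon> < \<gamma> * sqrt (1 - q) - 2 * sqrt (2 * q)"
    by (rule order_tendstoD) (use \<epsilon> in \<open>simp add: \<gamma>_def\<close>)
  moreover have "\<forall>\<^sub>F q in at_right 0. (q::real) \<in> {0<..<1}"
    by (intro eventually_at_right_real) auto
  ultimately have "\<forall>\<^sub>F q in at_right 0. 1 - \<epsilon> < \<gamma> * sqrt (1 - q) - 2 * sqrt (2 * q) \<and> q \<in> {0<..<1}"
    by eventually_elim auto
  then obtain q where q0: "1 - \<epsilon> < \<gamma> * sqrt (1 - q) - 2 * sqrt (2 * q)" "q \<in> {0<..<1}"
    using eventually_happens'[OF trivial_limit_at_right_real] by blast
  then have q: "0 < q" "q < 1" by auto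
  define L where "L = - ln q"
  have L: "0 < L" using q by (simp add: L_def)
  have ln_pow: "ln (1 / q ^ n) = real n * L" for n
    using q by (simp add: L_def ln_div ln_realpow)
  have qpow: "0 < q ^ n" for n using q by simp
  define X where "X n \<omega> = W (q ^ n) \<omega> - W (q ^ Suc n) \<omega>" for n \<omega>
  define \<sigma> where "\<sigma> n = sqrt (q ^ n - q ^ Suc n)" for n
  define x where "x n = \<gamma> * sqrt (2 * ln (real n * L))" for n
  have \<sigma>: "0 < \<sigma> n" for n using q by (simp add: \<sigma>_def)
  have \<sigma>_eq: "\<sigma> n = sqrt (1 - q) * sqrt (q ^ n)" for n
    unfolding \<sigma>_def real_sqrt_mult[symmetric] by (simp add: algebra_simps)
  have x\<sigma>: "x n * \<sigma> n = \<gamma> * sqrt (1 - q) * lil_scale (q ^ n)" for n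
    unfolding x_def \<sigma>_eq lil_scale_def ln_pow by (simp add: real_sqrt_mult)
  have normal: "distributed M lborel (X n) (normal_density 0 (\<sigma> n))" for n
    unfolding X_def \<sigma>_def by (rule brownian_motionD(4)[OF bm]) (use q in auto)
  have indep: "indep_vars (\<lambda>_. borel) X {..<N}" for N
  proof -
    \<comment> \<open>The times \<open>q\<^sup>n\<close> decrease, whereas independence of increments is given for increasing times.\<close>
    define \<tau> where "\<tau> i = q ^ (N - i)" for i
    have *: "indep_vars (\<lambda>_. borel) (\<lambda>i \<omega>. W (\<tau> (Suc i)) \<omega> - W (\<tau> i) \<omega>) {..<N}"
      by (rule brownian_motionD(5)[OF bm]) (use q in \<open>auto simp: \<tau>_def intro!: power_decreasing\<close>)
    have "indep_vars (\<lambda>n. PiM {N - Suc n} (\<lambda>_. borel))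
        (\<lambda>n \<omega>. restrict (\<lambda>i. W (\<tau> (Suc i)) \<omega> - W (\<tau> i) \<omega>) {N - Suc n}) {..<N}"
      by (rule indep_vars_restrict[OF *]) (auto simp: disjoint_family_on_def)
    then have "indep_vars (\<lambda>_. borel) (\<lambda>n \<omega>. (restrict (\<lambda>i. W (\<tau> (Suc i)) \<omega> - W (\<tau> i) \<omega>)
        {N - Suc n}) (N - Suc n)) {..<N}"
      by (rule indep_vars_compose2[where Y="\<lambda>n f. f (N - Suc n)"]) simp
    also have "?this \<longleftrightarrow> indep_vars (\<lambda>_. borel) X {..<N}"
    proof (intro indep_vars_cong refl ext)
      fix n \<omega> assume "n \<in> {..<N}"
      then show "(restrict (\<lambda>i. W (\<tau> (Suc i)) \<omega> - W (\<tau> i) \<omega>) {N - Suc n}) (N - Suc n) = X n \<omega>"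
        by (simp add: X_def \<tau>_def Suc_diff_Suc del: power_Suc)
    qed
    finally show ?thesis .
  qed
  define c where "c = exp (- 3 / 2) / sqrt (2 * pi)"
  have c: "0 < c" by (simp add: c_def)
  have "\<not> summable (\<lambda>n. prob {\<omega>\<in>space M. X n \<omega> \<in> {x n * \<sigma> n..}})"
  proof
    assume sm: "summable (\<lambda>n. prob {\<omega>\<in>space M. X n \<omega> \<in> {x n * \<sigma> n..}})"
    \<comment> \<open>The lower tail bound is of order \<open>n\<close> to the power \<open>- \<gamma>\<^sup>2 = \<delta> - 1\<close>, divided by \<open>sqrt (ln n)\<close>, which
      is eventually above \<open>1 / n\<close> because \<open>\<delta> > 0\<close>.\<close>
    define \<delta> where "\<delta> = 1 - \<gamma>\<^sup>2"
    have \<delta>: "0 < \<delta>" using \<gamma> by (simp add: \<delta>_def power_less_one_iff abs_square_less_1)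
    have *: "\<forall>\<^sub>F n in sequentially. 1 \<le> \<gamma> * sqrt (2 * ln (real n * L))"
      using \<gamma>(1) L by real_asymp
    have **: "\<forall>\<^sub>F n in sequentially. 1 / real n \<le>
        c * (real n powr (\<delta> - 1) * L powr (\<delta> - 1) / (\<gamma> * sqrt (2 * ln (real n * L))))"
      using \<gamma>(1) L \<delta> c by real_asymp
    have ***: "\<forall>\<^sub>F n in sequentially. 1 \<le> real n * L \<and> 0 < real n"
      using L by (intro eventually_conj; real_asymp)
    have "\<forall>\<^sub>F n in sequentially. norm (1 / real n) \<le> prob {\<omega>\<in>space M. X n \<omega> \<in> {x n * \<sigma> n..}}"
      using * ** ***
    proof eventually_elim
      fix n assume 1: "1 \<le> \<gamma> * sqrt (2 * ln (real n * L))"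
        and 2: "1 / real n \<le> c * (real n powr (\<delta> - 1) * L powr (\<delta> - 1) / (\<gamma> * sqrt (2 * ln (real n * L))))"
        and 3: "1 \<le> real n * L \<and> 0 < real n"
      have "(x n)\<^sup>2 / 2 = \<gamma>\<^sup>2 * ln (real n * L)"
        unfolding x_def power_mult_distrib using 3 by (subst real_sqrt_pow2) auto
      then have "exp (- (x n)\<^sup>2 / 2) = (real n * L) powr (- \<gamma>\<^sup>2)"
        using 3 by (auto simp: powr_def)
      also have "\<dots> = real n powr (\<delta> - 1) * L powr (\<delta> - 1)"
        using L by (simp add: \<delta>_def powr_mult)
      finally have "1 / real n \<le> c * (exp (- (x n)\<^sup>2 / 2) / x n)"
        using 2 by (simp add: x_def)
      also have "\<dots> \<le> prob {\<omega>\<in>space M. x n * \<sigma> n \<le> X n \<omega>}"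
        unfolding c_def using 1 by (intro normal_lower_tail[OF normal \<sigma>]) (simp add: x_def)
      finally show "norm (1 / real n) \<le> prob {\<omega>\<in>space M. X n \<omega> \<in> {x n * \<sigma> n..}}" by simp
    qed
    from summable_comparison_test_ev[OF this sm]
    show False using not_summable_harmonic[where 'a=real] by (simp add: field_simps)
  qed
  then have "AE \<omega> in M. \<exists>\<^sub>F n in sequentially. X n \<omega> \<in> {x n * \<sigma> n..}"
    by (intro borel_cantelli_indep indep) auto
  moreover have "AE \<omega> in M. \<forall>\<^sub>F h in at_right 0. - W h \<omega> \<le> (1 + 1) * lil_scale h"
    by (rule brownian_LIL_upper[OF brownian_motion_uminus[OF bm]]) simp
  ultimately show ?thesis
  proof eventually_elim
    fix \<omega> assume io: "\<exists>\<^sub>F n in sequentially. X n \<omega> \<in> {x n * \<sigma> n..}"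
      and up: "\<forall>\<^sub>F h in at_right 0. - W h \<omega> \<le> (1 + 1) * lil_scale h"
    have "(\<lambda>n. q ^ n) \<longlonglongrightarrow> 0" using q by (intro LIMSEQ_power_zero) auto
    then have lim: "filterlim (\<lambda>n. q ^ n) (at_right 0) sequentially"
      using qpow q unfolding filterlim_at by (auto intro!: always_eventually)
    then have lim': "filterlim (\<lambda>n. q ^ Suc n) (at_right 0) sequentially"
      by (rule filterlim_compose[OF _ filterlim_Suc])
    have up': "\<forall>\<^sub>F n in sequentially. - W (q ^ Suc n) \<omega> \<le> (1 + 1) * lil_scale (q ^ Suc n)"
      using up lim' unfolding filterlim_iff by blast
    have ll: "\<forall>\<^sub>F n in sequentially. 0 \<le> ln (real n * L) \<and> ln (real (Suc n) * L) \<le> 2 * ln (real n * L)"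
      using L by (intro eventually_conj; real_asymp)
    have "\<exists>\<^sub>F n in sequentially. (1 - \<epsilon>) * lil_scale (q ^ n) \<le> W (q ^ n) \<omega>"
      using frequently_eventually_conj[OF io eventually_conj[OF up' ll]]
    proof (rule frequently_elim1)
      fix n assume *: "(- W (q ^ Suc n) \<omega> \<le> (1 + 1) * lil_scale (q ^ Suc n) \<and>
        0 \<le> ln (real n * L) \<and> ln (real (Suc n) * L) \<le> 2 * ln (real n * L)) \<and> X n \<omega> \<in> {x n * \<sigma> n..}"
      then have X: "X n \<omega> \<in> {x n * \<sigma> n..}" and W: "- W (q ^ Suc n) \<omega> \<le> (1 + 1) * lil_scale (q ^ Suc n)"
        and l0: "0 \<le> ln (real n * L)" and l2: "ln (real (Suc n) * L) \<le> 2 * ln (real n * L)" by blast+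
      have "2 * q ^ Suc n * ln (real (Suc n) * L) \<le> 2 * q ^ Suc n * (2 * ln (real n * L))"
        using q by (intro mult_left_mono l2) auto
      also have "\<dots> = (2 * q) * (2 * q ^ n * ln (real n * L))" by simp
      finally have "lil_scale (q ^ Suc n) \<le> sqrt (2 * q) * lil_scale (q ^ n)"
        unfolding lil_scale_def ln_pow real_sqrt_mult[symmetric] by (rule real_sqrt_le_mono)
      then have "\<gamma> * sqrt (1 - q) * lil_scale (q ^ n) - 2 * (sqrt (2 * q) * lil_scale (q ^ n)) \<le> W (q ^ n) \<omega>"
        using X W unfolding x\<sigma> X_def by auto
      moreover have "0 \<le> lil_scale (q ^ n)"
        unfolding lil_scale_def ln_pow using q l0 by simp
      then have "(1 - \<epsilon>) * lil_scale (q ^ n) \<le> (\<gamma> * sqrt (1 - q) - 2 * sqrt (2 * q)) * lil_scale (q ^ n)"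
        using q0 by (intro mult_right_mono) auto
      ultimately show "(1 - \<epsilon>) * lil_scale (q ^ n) \<le> W (q ^ n) \<omega>"
        by (simp add: algebra_simps)
    qed
    then show "\<exists>\<^sub>F h in at_right 0. (1 - \<epsilon>) * lil_scale h \<le> W h \<omega>"
      using lim unfolding frequently_def filterlim_iff by blast
  qed
qed

section \<open>Shifts and projections of Brownian motion\<close>

lemma brownian_motion_shift:
  assumes bm: "brownian_motion M W" and t: "t \<ge> 0"
  shows "brownian_motion M (\<lambda>h \<omega>. W (t + h) \<omega> - W t \<omega>)"
proof -
  interpret prob_space M using brownian_motionD(1)[OF bm] .
  show ?thesis
    unfolding brownian_motion_def
  proof (intro conjI allI impI)
    show "prob_space M" by unfold_locales
  next
    fix h :: real assume "0 \<le> h"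
    then show "(\<lambda>\<omega>. W (t + h) \<omega> - W t \<omega>) \<in> borel_measurable M"
      using t by (intro borel_measurable_diff brownian_motionD(2)[OF bm]) auto
  next
    fix r s :: real assume "0 \<le> r \<and> r < s"
    then show "distributed M lborel (\<lambda>\<omega>. W (t + s) \<omega> - W t \<omega> - (W (t + r) \<omega> - W t \<omega>))
        (normal_density 0 (sqrt (s - r)))"
      using brownian_motionD(4)[OF bm, of "t + r" "t + s"] t by simp
  next
    fix n :: nat and \<tau> :: "nat \<Rightarrow> real"
    assume "0 \<le> \<tau> 0 \<and> (\<forall>i<n. \<tau> i \<le> \<tau> (Suc i))"
    then show "indep_vars (\<lambda>_. borel) (\<lambda>i \<omega>. W (t + \<tau> (Suc i)) \<omega> - W t \<omega> - (W (t + \<tau> i) \<omega> - W t \<omega>)) {..<n}"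
      using brownian_motionD(5)[OF bm, of "\<lambda>i. t + \<tau> i" n] t by simp
  next
    show "AE \<omega> in M. continuous_on {0..} (\<lambda>h. W (t + h) \<omega> - W t \<omega>)"
      using brownian_motionD(6)[OF bm]
    proof eventually_elim
      fix \<omega> assume "continuous_on {0..} (\<lambda>t. W t \<omega>)"
      then have "continuous_on {0..} (\<lambda>h. W (t + h) \<omega>)"
        by (rule continuous_on_compose2) (use t in \<open>auto intro!: continuous_intros\<close>)
      then show "continuous_on {0..} (\<lambda>h. W (t + h) \<omega> - W t \<omega>)" by (intro continuous_intros)
    qed
  qed simp
qed

text \<open>
  If the families \<open>X i\<close> are independent of each other as random functions on \<open>K\<close>, and the members of
  each family are independent, then the probability of a finite intersection factors first over \<open>i\<close>
  and then over \<open>k\<close>.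
\<close>
lemma (in prob_space) indep_vars_family_product:
  fixes X :: "'i \<Rightarrow> 'k \<Rightarrow> 'a \<Rightarrow> 'b"
  assumes outer: "indep_vars (\<lambda>i. PiM K (\<lambda>_. N)) (\<lambda>i \<omega>. \<lambda>k\<in>K. X i k \<omega>) I"
    and inner: "\<And>i. i \<in> I \<Longrightarrow> indep_vars (\<lambda>_. N) (X i) K"
  shows "indep_vars (\<lambda>_. N) (\<lambda>(i, k). X i k) (I \<times> K)"
proof -
  have Xm: "X i k \<in> measurable M N" if "i \<in> I" "k \<in> K" for i k
    using inner[OF that(1)] that(2) by (auto simp: indep_vars_def)
  have "indep_sets (\<lambda>j. {(case j of (i, k) \<Rightarrow> X i k) -` A \<inter> space M |A. A \<in> sets N}) (I \<times> K)"
  proof (rule indep_setsI)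
    fix j assume "j \<in> I \<times> K"
    then show "{(case j of (i, k) \<Rightarrow> X i k) -` A \<inter> space M |A. A \<in> sets N} \<subseteq> events"
      using Xm by (auto intro: measurable_sets)
  next
    fix A J
    assume J: "J \<noteq> {}" "J \<subseteq> I \<times> K" "finite J"
      and A: "\<forall>j\<in>J. A j \<in> {(case j of (i, k) \<Rightarrow> X i k) -` A \<inter> space M |A. A \<in> sets N}"
    from A have "\<forall>j\<in>J. \<exists>C. C \<in> sets N \<and> A j = X (fst j) (snd j) -` C \<inter> space M"
      by (fastforce split: prod.splits)
    from bchoice[OF this] obtain C
      where C: "\<And>j. j \<in> J \<Longrightarrow> C j \<in> sets N"
        and AC: "\<And>j. j \<in> J \<Longrightarrow> A j = X (fst j) (snd j) -` C j \<inter> space M" by blast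
    define J1 where "J1 = fst ` J"
    define J2 where "J2 i = {k. (i, k) \<in> J}" for i
    have J1: "finite J1" "J1 \<noteq> {}" "J1 \<subseteq> I" using J by (auto simp: J1_def)
    have J2K: "J2 i \<subseteq> K" for i using J by (auto simp: J2_def)
    have J2f: "finite (J2 i)" for i
      by (rule finite_subset[of _ "snd ` J"]) (use J in \<open>force simp: J2_def\<close>, simp add: J)
    have J2: "J2 i \<noteq> {}" if "i \<in> J1" for i using that by (auto simp: J1_def J2_def)
    have Js: "J = Sigma J1 J2" by (force simp: J1_def J2_def)
    define D where "D i = {f \<in> space (PiM K (\<lambda>_. N)). \<forall>k\<in>J2 i. f k \<in> C (i, k)}" for i
    have Dm: "D i \<in> sets (PiM K (\<lambda>_. N))" if "i \<in> J1" for i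
    proof -
      have "D i = (\<Inter>k\<in>J2 i. (\<lambda>f. f k) -` C (i, k) \<inter> space (PiM K (\<lambda>_. N)))"
        using J2[OF that] by (auto simp: D_def)
      also have "\<dots> \<in> sets (PiM K (\<lambda>_. N))"
        using J2f J2[OF that] J2K C
        by (intro sets.finite_INT measurable_sets[OF measurable_component_singleton]) (auto simp: J2_def)
      finally show ?thesis .
    qed
    have D_eq: "(\<lambda>\<omega>. \<lambda>k\<in>K. X i k \<omega>) -` D i \<inter> space M = (\<Inter>k\<in>J2 i. X i k -` C (i, k) \<inter> space M)"
      if "i \<in> J1" for i
    proof -
      have "(\<lambda>k\<in>K. X i k \<omega>) \<in> space (PiM K (\<lambda>_. N))" if "\<omega> \<in> space M" for \<omega>
        using that \<open>i \<in> J1\<close> J1(3) by (auto simp: space_PiM intro!: measurable_space[OF Xm])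
      then show ?thesis using J2[OF that] J2K[of i] by (auto simp: D_def subset_iff)
    qed
    have "(\<Inter>j\<in>J. A j) = (\<Inter>i\<in>J1. (\<lambda>\<omega>. \<lambda>k\<in>K. X i k \<omega>) -` D i \<inter> space M)"
      using J1 J2 by (subst Js) (auto simp: D_eq AC Js)
    also have "prob \<dots> = (\<Prod>i\<in>J1. prob ((\<lambda>\<omega>. \<lambda>k\<in>K. X i k \<omega>) -` D i \<inter> space M))"
      by (rule indep_varsD[OF outer J1(2,1,3) Dm])
    also have "\<dots> = (\<Prod>i\<in>J1. \<Prod>k\<in>J2 i. prob (X i k -` C (i, k) \<inter> space M))"
    proof (intro prod.cong refl)
      fix i assume i: "i \<in> J1"
      show "prob ((\<lambda>\<omega>. \<lambda>k\<in>K. X i k \<omega>) -` D i \<inter> space M) = (\<Prod>k\<in>J2 i. prob (X i k -` C (i, k) \<inter> space M))"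
        unfolding D_eq[OF i]
        by (rule indep_varsD[OF inner J2 J2f J2K]) (use i J1 C in \<open>auto simp: J2_def\<close>)
    qed
    also have "\<dots> = (\<Prod>j\<in>J. prob (A j))"
      using J1 J2f by (subst prod.Sigma) (auto simp: Js AC intro!: prod.cong)
    finally show "prob (\<Inter>j\<in>J. A j) = (\<Prod>j\<in>J. prob (A j))" .
  qed
  then show ?thesis unfolding indep_vars_def2 using Xm by auto
qed

lemma brownian_motion_vecD:
  assumes "brownian_motion_vec M B"
  shows "brownian_motion M (\<lambda>t \<omega>. B t \<omega> $ i)"
    and "prob_space.indep_vars M (\<lambda>_. PiM {0..} (\<lambda>_. borel)) (\<lambda>i \<omega>. \<lambda>t\<in>{0..}. B t \<omega> $ i) UNIV"
  using assms unfolding brownian_motion_vec_def by auto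

text \<open>
  Increments are measurable functions of the coordinate path, so the independence of the coordinates
  as processes passes to any family of their increments.
\<close>
lemma brownian_motion_vec_increment_indep:
  assumes bv: "brownian_motion_vec M B" and \<tau>: "\<And>k. k \<in> K \<Longrightarrow> 0 \<le> \<rho> k \<and> 0 \<le> \<tau> k"
  shows "prob_space.indep_vars M (\<lambda>_. PiM K (\<lambda>_. borel))
    (\<lambda>i \<omega>. \<lambda>k\<in>K. B (\<tau> k) \<omega> $ i - B (\<rho> k) \<omega> $ i) UNIV"
proof -
  interpret prob_space M using brownian_motionD(1)[OF brownian_motion_vecD(1)[OF bv]] .
  have "(\<lambda>f. \<lambda>k\<in>K. f (\<tau> k) - f (\<rho> k)) \<in> measurable (PiM {0..} (\<lambda>_. borel)) (PiM K (\<lambda>_. borel :: real measure))"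
    using \<tau> by (intro measurable_restrict borel_measurable_diff measurable_component_singleton) auto
  from indep_vars_compose2[OF brownian_motion_vecD(2)[OF bv] this]
  have "indep_vars (\<lambda>_. PiM K (\<lambda>_. borel)) (\<lambda>i \<omega>. \<lambda>k\<in>K. (\<lambda>t\<in>{0..}. B t \<omega> $ i) (\<tau> k) - (\<lambda>t\<in>{0..}. B t \<omega> $ i) (\<rho> k)) UNIV" .
  also have "(\<lambda>i \<omega>. \<lambda>k\<in>K. (\<lambda>t\<in>{0..}. B t \<omega> $ i) (\<tau> k) - (\<lambda>t\<in>{0..}. B t \<omega> $ i) (\<rho> k))
      = (\<lambda>i \<omega>. \<lambda>k\<in>K. B (\<tau> k) \<omega> $ i - B (\<rho> k) \<omega> $ i)"
    using \<tau> by (auto simp: fun_eq_iff restrict_def)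
  finally show ?thesis .
qed

text \<open>
  All increments of all coordinates over successive intervals are jointly independent, hence so are
  their combinations interval by interval; and a combination of independent centred Gaussian variables
  with coefficient vector of length \<open>1\<close> keeps the variance.
\<close>
lemma brownian_motion_inner:
  fixes B :: "real \<Rightarrow> 'a \<Rightarrow> real^'n"
  assumes bv: "brownian_motion_vec M B" and u: "norm u = 1"
  shows "brownian_motion M (\<lambda>t \<omega>. u \<bullet> B t \<omega>)"
proof -
  note bm = brownian_motion_vecD(1)[OF bv]
  interpret prob_space M using brownian_motionD(1)[OF bm] .
  have inner: "u \<bullet> B t \<omega> - u \<bullet> B s \<omega> = (\<Sum>i\<in>UNIV. u $ i * (B t \<omega> $ i - B s \<omega> $ i))" for s t \<omega>
    by (simp add: inner_vec_def sum_subtractf right_diff_distrib)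
  show ?thesis
    unfolding brownian_motion_def
  proof (intro conjI allI impI)
    show "prob_space M" by unfold_locales
  next
    fix t :: real assume "0 \<le> t"
    then show "(\<lambda>\<omega>. u \<bullet> B t \<omega>) \<in> borel_measurable M"
      unfolding inner_vec_def using brownian_motionD(2)[OF bm, of t] by simp
  next
    have "AE \<omega> in M. \<forall>i. B 0 \<omega> $ i = 0"
      using brownian_motionD(3)[OF bm] by (subst AE_all_countable) auto
    then show "AE \<omega> in M. u \<bullet> B 0 \<omega> = 0"
      by eventually_elim (simp add: inner_vec_def)
  next
    fix s t :: real assume st: "0 \<le> s \<and> s < t"
    \<comment> \<open>A vanishing coefficient gives a degenerate summand, which has no density.\<close>
    define I where "I = {i. u $ i \<noteq> 0}"
    have I: "I \<noteq> {}"
    proof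
      assume "I = {}"
      then have "u = 0" by (auto simp: I_def vec_eq_iff)
      then show False using u by simp
    qed
    have "indep_vars (\<lambda>_. borel) (\<lambda>i \<omega>. u $ i * (\<lambda>k\<in>{()}. B t \<omega> $ i - B s \<omega> $ i) ()) UNIV"
      using st by (intro indep_vars_compose2[where Y="\<lambda>i f. u $ i * f ()",
          OF brownian_motion_vec_increment_indep[OF bv, of "{()}" "\<lambda>_. s" "\<lambda>_. t"]]) auto
    then have "indep_vars (\<lambda>_. borel) (\<lambda>i \<omega>. u $ i * (B t \<omega> $ i - B s \<omega> $ i)) I"
      by (intro indep_vars_subset[of _ _ UNIV I]) auto
    moreover have "distributed M lborel (\<lambda>\<omega>. u $ i * (B t \<omega> $ i - B s \<omega> $ i))
        (normal_density 0 (\<bar>u $ i\<bar> * sqrt (t - s)))" if "i \<in> I" for i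
      using normal_density_affine[OF brownian_motionD(4)[OF bm, of s t i], of "u $ i" 0] st that
      by (simp add: I_def)
    ultimately have "distributed M lborel (\<lambda>\<omega>. \<Sum>i\<in>I. u $ i * (B t \<omega> $ i - B s \<omega> $ i))
        (normal_density (\<Sum>i\<in>I. 0) (sqrt (\<Sum>i\<in>I. (\<bar>u $ i\<bar> * sqrt (t - s))\<^sup>2)))"
      using I st by (intro sum_indep_normal) (auto simp: I_def)
    moreover have "(\<lambda>\<omega>. \<Sum>i\<in>I. u $ i * (B t \<omega> $ i - B s \<omega> $ i)) = (\<lambda>\<omega>. u \<bullet> B t \<omega> - u \<bullet> B s \<omega>)"
      unfolding inner by (intro ext sum.mono_neutral_left) (auto simp: I_def)
    moreover have "(\<Sum>i\<in>I. (\<bar>u $ i\<bar> * sqrt (t - s))\<^sup>2) = (\<Sum>i\<in>UNIV. (u $ i)\<^sup>2) * (t - s)"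
      using st unfolding sum_distrib_right
      by (intro sum.mono_neutral_cong_left) (auto simp: I_def power_mult_distrib)
    moreover have "(\<Sum>i\<in>UNIV. (u $ i)\<^sup>2) = 1"
      using u by (simp add: norm_vec_def L2_set_def)
    ultimately show "distributed M lborel (\<lambda>\<omega>. u \<bullet> B t \<omega> - u \<bullet> B s \<omega>) (normal_density 0 (sqrt (t - s)))"
      by simp
  next
    fix n :: nat and \<tau> :: "nat \<Rightarrow> real"
    assume \<tau>: "0 \<le> \<tau> 0 \<and> (\<forall>i<n. \<tau> i \<le> \<tau> (Suc i))"
    have \<tau>_nonneg: "0 \<le> \<tau> k" if "k \<le> n" for k
      using that \<tau> by (induction k) (auto intro: order_trans simp: Suc_le_eq)
    define Z where "Z i k \<omega> = B (\<tau> (Suc k)) \<omega> $ i - B (\<tau> k) \<omega> $ i" for i k \<omega>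
    have "indep_vars (\<lambda>_. borel) (\<lambda>(i, k). Z i k) (UNIV \<times> {..<n})"
    proof (rule indep_vars_family_product)
      show "indep_vars (\<lambda>i. PiM {..<n} (\<lambda>_. borel)) (\<lambda>i \<omega>. \<lambda>k\<in>{..<n}. Z i k \<omega>) UNIV"
        unfolding Z_def by (rule brownian_motion_vec_increment_indep[OF bv]) (auto intro: \<tau>_nonneg)
      show "indep_vars (\<lambda>_. borel) (Z i) {..<n}" for i
        unfolding Z_def by (rule brownian_motionD(5)[OF bm]) (use \<tau> in auto)
    qed
    then have "indep_vars (\<lambda>k. PiM (UNIV \<times> {k}) (\<lambda>_. borel))
        (\<lambda>k \<omega>. restrict (\<lambda>j. (case j of (i, k) \<Rightarrow> Z i k) \<omega>) (UNIV \<times> {k})) {..<n}"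
      by (rule indep_vars_restrict) (auto simp: disjoint_family_on_def)
    then have "indep_vars (\<lambda>_. borel) (\<lambda>k \<omega>. \<Sum>i\<in>UNIV. u $ i *
        (restrict (\<lambda>j. (case j of (i, k) \<Rightarrow> Z i k) \<omega>) (UNIV \<times> {k})) (i, k)) {..<n}"
      by (rule indep_vars_compose2[where Y="\<lambda>k f. \<Sum>i\<in>UNIV. u $ i * f (i, k)"]) simp
    then show "indep_vars (\<lambda>_. borel) (\<lambda>k \<omega>. u \<bullet> B (\<tau> (Suc k)) \<omega> - u \<bullet> B (\<tau> k) \<omega>) {..<n}"
      unfolding inner by (simp add: Z_def)
  next
    have "AE \<omega> in M. \<forall>i. continuous_on {0..} (\<lambda>t. B t \<omega> $ i)"
      using brownian_motionD(6)[OF bm] by (subst AE_all_countable) auto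
    then show "AE \<omega> in M. continuous_on {0..} (\<lambda>t. u \<bullet> B t \<omega>)"
      unfolding inner_vec_def
      by eventually_elim (intro continuous_on_sum continuous_on_inner continuous_on_const; simp)
  qed
qed

section \<open>The isometry of Wiener integration\<close>

text \<open>
  This is the only feature of the integrator on which the isometry of Wiener integration rests: its
  increments define an orthogonal random measure with Lebesgue intensity, and components in orthogonal
  directions are uncorrelated. For an arbitrary Euclidean space it covers the scalar and the planar case at once.
\<close>
definition orthonormal_increments ::
    "'a measure \<Rightarrow> (real \<Rightarrow> 'a \<Rightarrow> 'b::euclidean_space) \<Rightarrow> bool" where
  "orthonormal_increments M B \<longleftrightarrow>
     (\<forall>t\<ge>0. B t \<in> borel_measurable M) \<and>
     (\<forall>a b c d u v. 0 \<le> a \<and> a \<le> b \<and> 0 \<le> c \<and> c \<le> d \<longrightarrow>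
        has_bochner_integral M (\<lambda>\<omega>. (u \<bullet> (B b \<omega> - B a \<omega>)) * (v \<bullet> (B d \<omega> - B c \<omega>)))
          ((u \<bullet> v) * measure lborel ({a<..b} \<inter> {c<..d})))"

text \<open>
  This form of the length of an overlap matches the polarization identity that is used for the
  covariance of two increments.
\<close>
lemma measure_Int_intervals:
  fixes a b c d :: real
  assumes "a \<le> b" "c \<le> d"
  shows "measure lborel ({a<..b} \<inter> {c<..d}) = (\<bar>b - c\<bar> + \<bar>a - d\<bar> - \<bar>b - d\<bar> - \<bar>a - c\<bar>) / 2"
proof -
  have "{a<..b} \<inter> {c<..d} = {max a c<..min b d}" by auto
  then show ?thesis using assms
    by (cases "max a c \<le> min b d") (auto simp: max_def min_def split: if_splits)
qed

lemma brownian_motion_increment_square: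
  assumes bm: "brownian_motion M W" and st: "0 \<le> s" "0 \<le> t"
  shows "has_bochner_integral M (\<lambda>\<omega>. (W t \<omega> - W s \<omega>)\<^sup>2) \<bar>t - s\<bar>"
proof -
  interpret prob_space M using brownian_motionD(1)[OF bm] .
  have *: "has_bochner_integral M (\<lambda>\<omega>. (W t \<omega> - W s \<omega>)\<^sup>2) (t - s)" if "0 \<le> s" "s < t" for s t
  proof -
    note D = brownian_motionD(4)[OF bm that]
    have "has_bochner_integral lborel (\<lambda>x. normal_density 0 (sqrt (t - s)) x * x\<^sup>2) (t - s)"
      using normal_moment_even[of "sqrt (t - s)" 0 1] that by (simp add: fact_numeral diff_divide_distrib)
    then show ?thesis
      using distributed_integrable[OF D, of "\<lambda>x. x\<^sup>2"] distributed_integral[OF D, of "\<lambda>x. x\<^sup>2"]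
      by (simp add: has_bochner_integral_iff)
  qed
  consider "s < t" | "t < s" | "s = t" by linarith
  then show ?thesis
  proof cases
    case 1
    then show ?thesis using *[of s t] st by simp
  next
    case 2
    then show ?thesis using *[of t s] st by (simp add: power2_commute)
  qed (simp add: has_bochner_integral_zero)
qed

lemma brownian_motion_increment_mean:
  assumes bm: "brownian_motion M W" and st: "0 \<le> s" "s \<le> t"
  shows "has_bochner_integral M (\<lambda>\<omega>. W t \<omega> - W s \<omega>) 0"
proof (cases "s = t")
  case False
  interpret prob_space M using brownian_motionD(1)[OF bm] .
  have D: "distributed M lborel (\<lambda>\<omega>. W t \<omega> - W s \<omega>) (normal_density 0 (sqrt (t - s)))"
    using brownian_motionD(4)[OF bm, of s t] st False by auto
  have "has_bochner_integral lborel (\<lambda>x. normal_density 0 (sqrt (t - s)) x * x) 0"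
    using normal_moment_nz_1[of "sqrt (t - s)" 0] st False by simp
  then show ?thesis
    using distributed_integrable[OF D, of "\<lambda>x. x"] distributed_integral[OF D, of "\<lambda>x. x"]
    by (simp add: has_bochner_integral_iff)
qed (simp add: has_bochner_integral_zero)

text \<open>
  By \<open>2 (b - a) (d - c) = (b - c)\<^sup>2 + (a - d)\<^sup>2 - (b - d)\<^sup>2 - (a - c)\<^sup>2\<close> the covariance of two
  increments is determined by the variances of increments, so that overlapping intervals need no
  separate treatment.
\<close>
lemma brownian_motion_increment_covariance:
  assumes bm: "brownian_motion M W" and le: "0 \<le> a" "a \<le> b" "0 \<le> c" "c \<le> d"
  shows "has_bochner_integral M (\<lambda>\<omega>. (W b \<omega> - W a \<omega>) * (W d \<omega> - W c \<omega>))
           (measure lborel ({a<..b} \<inter> {c<..d}))"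
proof -
  have nn: "0 \<le> b" "0 \<le> d" using le by auto
  have "has_bochner_integral M (\<lambda>\<omega>. (1 / 2) * ((W b \<omega> - W c \<omega>)\<^sup>2 + (W a \<omega> - W d \<omega>)\<^sup>2
        - (W b \<omega> - W d \<omega>)\<^sup>2 - (W a \<omega> - W c \<omega>)\<^sup>2))
      ((1 / 2) * (\<bar>b - c\<bar> + \<bar>a - d\<bar> - \<bar>b - d\<bar> - \<bar>a - c\<bar>))"
    using le nn by (intro has_bochner_integral_mult_right has_bochner_integral_diff
        has_bochner_integral_add brownian_motion_increment_square[OF bm])
  also have "(\<lambda>\<omega>. (1 / 2) * ((W b \<omega> - W c \<omega>)\<^sup>2 + (W a \<omega> - W d \<omega>)\<^sup>2
        - (W b \<omega> - W d \<omega>)\<^sup>2 - (W a \<omega> - W c \<omega>)\<^sup>2)) = (\<lambda>\<omega>. (W b \<omega> - W a \<omega>) * (W d \<omega> - W c \<omega>))"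
    by (simp add: fun_eq_iff power2_eq_square algebra_simps)
  finally show ?thesis unfolding measure_Int_intervals[OF le(2) le(4)] by simp
qed

lemma orthonormal_increments_brownian_motion:
  assumes bm: "brownian_motion M W"
  shows "orthonormal_increments M W"
  unfolding orthonormal_increments_def
proof (intro conjI allI impI)
  fix a b c d u v :: real
  assume le: "0 \<le> a \<and> a \<le> b \<and> 0 \<le> c \<and> c \<le> d"
  have "has_bochner_integral M (\<lambda>\<omega>. (u * v) * ((W b \<omega> - W a \<omega>) * (W d \<omega> - W c \<omega>)))
      ((u * v) * measure lborel ({a<..b} \<inter> {c<..d}))"
    using le by (intro has_bochner_integral_mult_right brownian_motion_increment_covariance[OF bm]) auto
  then show "has_bochner_integral M (\<lambda>\<omega>. (u \<bullet> (W b \<omega> - W a \<omega>)) * (v \<bullet> (W d \<omega> - W c \<omega>)))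
      ((u \<bullet> v) * measure lborel ({a<..b} \<inter> {c<..d}))"
    by (simp add: mult_ac)
qed (use brownian_motionD(2)[OF bm] in auto)

text \<open>
  Coordinates with different indices contribute nothing, being independent and centred; equal indices
  reduce to the scalar covariance.
\<close>
lemma orthonormal_increments_brownian_motion_vec:
  fixes B :: "real \<Rightarrow> 'a \<Rightarrow> real^'n"
  assumes bv: "brownian_motion_vec M B"
  shows "orthonormal_increments M B"
  unfolding orthonormal_increments_def
proof (intro conjI allI impI)
  note bm = brownian_motion_vecD(1)[OF bv]
  interpret prob_space M using brownian_motionD(1)[OF bm] .
  {
    fix t :: real assume "0 \<le> t"
    have "B t = (\<lambda>\<omega>. \<Sum>i\<in>UNIV. (B t \<omega> $ i) *\<^sub>R axis i 1)"
      by (simp add: fun_eq_iff vec_eq_iff axis_def if_distrib cong: if_cong)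
    also have "\<dots> \<in> borel_measurable M"
      using brownian_motionD(2)[OF bm \<open>0 \<le> t\<close>] by measurable
    finally show "B t \<in> borel_measurable M" .
  }
  fix a b c d :: real and u v :: "real^'n"
  assume le: "0 \<le> a \<and> a \<le> b \<and> 0 \<le> c \<and> c \<le> d"
  define m where "m = measure lborel ({a<..b} \<inter> {c<..d})"
  have ij: "has_bochner_integral M (\<lambda>\<omega>. (B b \<omega> $ i - B a \<omega> $ i) * (B d \<omega> $ j - B c \<omega> $ j))
      (if i = j then m else 0)" for i j
  proof (cases "i = j")
    case True
    then show ?thesis
      using brownian_motion_increment_covariance[OF bm[of i], of a b c d] le by (simp add: m_def)
  next
    case False
    have "indep_vars (\<lambda>_. PiM {False, True} (\<lambda>_. borel))
        (\<lambda>i \<omega>. \<lambda>k\<in>{False, True}. B (if k then d else b) \<omega> $ i - B (if k then c else a) \<omega> $ i) UNIV"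
      using le by (intro brownian_motion_vec_increment_indep[OF bv]) (auto intro: order_trans)
    note ind = this
    have comp: "(\<lambda>f. f i k) \<in> borel_measurable (PiM {i} (\<lambda>_. PiM {False, True} (\<lambda>_. borel :: real measure)))"
      for i :: 'n and k
      by (rule measurable_compose[OF _ measurable_component_singleton[of k "{False, True}"]])
         (auto intro: measurable_component_singleton)
    have disj: "{i} \<inter> {j} = {}" using False by simp
    from indep_var_compose[OF indep_var_restrict[OF ind disj subset_UNIV subset_UNIV]
        comp[of i False] comp[of j True]]
    have "indep_var borel ((\<lambda>f. f i False) \<circ> (\<lambda>\<omega>. \<lambda>i\<in>{i}. \<lambda>k\<in>{False, True}.
          B (if k then d else b) \<omega> $ i - B (if k then c else a) \<omega> $ i))
       borel ((\<lambda>f. f j True) \<circ> (\<lambda>\<omega>. \<lambda>j\<in>{j}. \<lambda>k\<in>{False, True}.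
          B (if k then d else b) \<omega> $ j - B (if k then c else a) \<omega> $ j))" .
    then have ind: "indep_var borel (\<lambda>\<omega>. B b \<omega> $ i - B a \<omega> $ i) borel (\<lambda>\<omega>. B d \<omega> $ j - B c \<omega> $ j)"
      by (simp add: comp_def)
    have "has_bochner_integral M (\<lambda>\<omega>. B b \<omega> $ i - B a \<omega> $ i) 0"
      "has_bochner_integral M (\<lambda>\<omega>. B d \<omega> $ j - B c \<omega> $ j) 0"
      using le by (auto intro!: brownian_motion_increment_mean[OF bm])
    then show ?thesis
      using indep_var_lebesgue_integral[OF ind] indep_var_integrable[OF ind] False
      by (simp add: has_bochner_integral_iff)
  qed
  have "has_bochner_integral M
      (\<lambda>\<omega>. \<Sum>i\<in>UNIV. \<Sum>j\<in>UNIV. (u $ i * v $ j) * ((B b \<omega> $ i - B a \<omega> $ i) * (B d \<omega> $ j - B c \<omega> $ j)))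
      (\<Sum>i\<in>UNIV. \<Sum>j\<in>UNIV. (u $ i * v $ j) * (if i = j then m else 0))"
    by (intro has_bochner_integral_sum has_bochner_integral_mult_right ij)
  also have "(\<lambda>\<omega>. \<Sum>i\<in>UNIV. \<Sum>j\<in>UNIV. (u $ i * v $ j) * ((B b \<omega> $ i - B a \<omega> $ i) * (B d \<omega> $ j - B c \<omega> $ j)))
      = (\<lambda>\<omega>. (u \<bullet> (B b \<omega> - B a \<omega>)) * (v \<bullet> (B d \<omega> - B c \<omega>)))"
    by (simp add: inner_vec_def sum_product mult_ac)
  also have "(\<Sum>i\<in>UNIV. \<Sum>j\<in>UNIV. (u $ i * v $ j) * (if i = j then m else 0)) = (u \<bullet> v) * m"
    by (simp add: inner_vec_def sum_distrib_right if_distrib cong: if_cong)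
  finally show "has_bochner_integral M (\<lambda>\<omega>. (u \<bullet> (B b \<omega> - B a \<omega>)) * (v \<bullet> (B d \<omega> - B c \<omega>)))
      ((u \<bullet> v) * measure lborel ({a<..b} \<inter> {c<..d}))" unfolding m_def .
qed

definition time_steps :: "(real \<times> real \<times> 'b) list \<Rightarrow> bool" where
  "time_steps xs \<longleftrightarrow> (\<forall>(a, b, c)\<in>set xs. 0 \<le> a \<and> a \<le> b)"

definition scale_steps :: "real \<Rightarrow> (real \<times> real \<times> 'b::real_vector) list \<Rightarrow> (real \<times> real \<times> 'b) list" where
  "scale_steps r xs = map (\<lambda>(a, b, c). (a, b, r *\<^sub>R c)) xs"

lemma time_steps_simps [simp]:
  "time_steps []"
  "time_steps ((a, b, c) # xs) \<longleftrightarrow> 0 \<le> a \<and> a \<le> b \<and> time_steps xs"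
  "time_steps (xs @ ys) \<longleftrightarrow> time_steps xs \<and> time_steps ys"
  "time_steps (scale_steps r xs) \<longleftrightarrow> time_steps xs"
  by (auto simp: time_steps_def scale_steps_def case_prod_unfold)

lemma step_fun_simps:
  "step_fun [] s = 0"
  "step_fun ((a, b, c) # xs) s = indicator {a<..b} s *\<^sub>R c + step_fun xs s"
  "step_fun (xs @ ys) s = step_fun xs s + step_fun ys s"
  "step_fun (scale_steps r xs) s = r *\<^sub>R step_fun xs s"
proof -
  show "step_fun (scale_steps r xs) s = r *\<^sub>R step_fun xs s"
    by (induction xs) (auto simp: step_fun_def scale_steps_def scaleR_right_distrib)
qed (simp_all add: step_fun_def)

lemma step_integral_simps:
  "step_integral B [] \<omega> = 0"
  "step_integral B ((a, b, c) # xs) \<omega> = c \<bullet> (B b \<omega> - B a \<omega>) + step_integral B xs \<omega>"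
  "step_integral B (xs @ ys) \<omega> = step_integral B xs \<omega> + step_integral B ys \<omega>"
  "step_integral B (scale_steps r xs) \<omega> = r * step_integral B xs \<omega>"
proof -
  show "step_integral B (scale_steps r xs) \<omega> = r * step_integral B xs \<omega>"
    by (induction xs) (auto simp: step_integral_def scale_steps_def distrib_left)
qed (simp_all add: step_integral_def)

lemma borel_measurable_step_fun [measurable]:
  fixes xs :: "(real \<times> real \<times> 'b::euclidean_space) list"
  shows "step_fun xs \<in> borel_measurable borel"
proof (induction xs)
  case Nil
  have "(step_fun [] :: real \<Rightarrow> 'b) = (\<lambda>s. 0)" by (simp add: fun_eq_iff step_fun_simps)
  then show ?case by simp
next
  case (Cons x xs)
  obtain a b c where x: "x = (a, b, c)" by (cases x)
  have "step_fun (x # xs) = (\<lambda>s. indicator {a<..b} s *\<^sub>R c + step_fun xs s)"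
    by (simp add: fun_eq_iff x step_fun_simps)
  then show ?case using Cons by simp
qed

lemma borel_measurable_step_integral:
  fixes B :: "real \<Rightarrow> 'a \<Rightarrow> 'b::euclidean_space"
  assumes "orthonormal_increments M B" "time_steps xs"
  shows "step_integral B xs \<in> borel_measurable M"
  using assms(2)
proof (induction xs)
  case Nil
  have "step_integral B [] = (\<lambda>s. 0)" by (simp add: fun_eq_iff step_integral_simps)
  then show ?case by simp
next
  case (Cons x xs)
  obtain a b c where x: "x = (a, b, c)" by (cases x)
  have [measurable]: "B a \<in> borel_measurable M" "B b \<in> borel_measurable M"
    using assms(1) Cons.prems by (auto simp: x orthonormal_increments_def)
  have "step_integral B (x # xs) = (\<lambda>\<omega>. c \<bullet> (B b \<omega> - B a \<omega>) + step_integral B xs \<omega>)"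
    by (simp add: fun_eq_iff x step_integral_simps)
  then show ?case using Cons by (simp add: x)
qed

text \<open>
  Both sides are bilinear in the two lists, so it suffices to compare single steps, which is the
  defining property of orthonormal increments. This holds even when the intervals of a list overlap.
\<close>
lemma step_integral_covariance:
  assumes orth: "orthonormal_increments M B" and "time_steps xs" "time_steps ys"
  shows "\<exists>r. has_bochner_integral M (\<lambda>\<omega>. step_integral B xs \<omega> * step_integral B ys \<omega>) r \<and>
             has_bochner_integral lborel (\<lambda>s. step_fun xs s \<bullet> step_fun ys s) r"
  using assms(2)
proof (induction xs)
  case Nil
  show ?case by (auto simp: step_fun_simps step_integral_simps intro!: exI[of _ 0])
next
  case (Cons x xs)
  obtain a b u where x: "x = (a, b, u)" by (cases x)
  have ab: "0 \<le> a" "a \<le> b" using Cons.prems by (auto simp: x)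
  have "\<exists>r. has_bochner_integral M (\<lambda>\<omega>. (u \<bullet> (B b \<omega> - B a \<omega>)) * step_integral B ys \<omega>) r \<and>
             has_bochner_integral lborel (\<lambda>s. (indicator {a<..b} s *\<^sub>R u) \<bullet> step_fun ys s) r"
    using assms(3)
  proof (induction ys)
    case Nil
    show ?case by (auto simp: step_fun_simps step_integral_simps intro!: exI[of _ 0])
  next
    case (Cons y ys)
    obtain c d v where y: "y = (c, d, v)" by (cases y)
    have cd: "0 \<le> c" "c \<le> d" using Cons.prems by (auto simp: y)
    obtain r where r: "has_bochner_integral M (\<lambda>\<omega>. (u \<bullet> (B b \<omega> - B a \<omega>)) * step_integral B ys \<omega>) r"
        "has_bochner_integral lborel (\<lambda>s. (indicator {a<..b} s *\<^sub>R u) \<bullet> step_fun ys s) r"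
      using Cons by (auto simp: y)
    define r0 where "r0 = (u \<bullet> v) * measure lborel ({a<..b} \<inter> {c<..d})"
    have 1: "has_bochner_integral M (\<lambda>\<omega>. (u \<bullet> (B b \<omega> - B a \<omega>)) * (v \<bullet> (B d \<omega> - B c \<omega>))) r0"
      using orth ab cd unfolding orthonormal_increments_def r0_def by blast
    have "{a<..b} \<inter> {c<..d} = {max a c<..min b d}" by auto
    then have "emeasure lborel ({a<..b} \<inter> {c<..d}) < \<infinity>"
      by (cases "max a c \<le> min b d") auto
    then have "has_bochner_integral lborel (\<lambda>s. (u \<bullet> v) * indicator ({a<..b} \<inter> {c<..d}) s) r0"
      unfolding r0_def by (intro has_bochner_integral_mult_right has_bochner_integral_real_indicator) auto
    also have "(\<lambda>s. (u \<bullet> v) * indicator ({a<..b} \<inter> {c<..d}) s)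
        = (\<lambda>s. (indicator {a<..b} s *\<^sub>R u) \<bullet> (indicator {c<..d} s *\<^sub>R v))"
      by (auto simp: fun_eq_iff indicator_def)
    finally have 2: "has_bochner_integral lborel
        (\<lambda>s. (indicator {a<..b} s *\<^sub>R u) \<bullet> (indicator {c<..d} s *\<^sub>R v)) r0" .
    show ?case
      using has_bochner_integral_add[OF 1 r(1)] has_bochner_integral_add[OF 2 r(2)]
      by (intro exI[of _ "r0 + r"]) (simp add: y step_fun_simps step_integral_simps distrib_left inner_add_right)
  qed
  then obtain r where r: "has_bochner_integral M (\<lambda>\<omega>. (u \<bullet> (B b \<omega> - B a \<omega>)) * step_integral B ys \<omega>) r"
      "has_bochner_integral lborel (\<lambda>s. (indicator {a<..b} s *\<^sub>R u) \<bullet> step_fun ys s) r" by blast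
  obtain q where q: "has_bochner_integral M (\<lambda>\<omega>. step_integral B xs \<omega> * step_integral B ys \<omega>) q"
      "has_bochner_integral lborel (\<lambda>s. step_fun xs s \<bullet> step_fun ys s) q"
    using Cons by (auto simp: x)
  show ?case
    using has_bochner_integral_add[OF r(1) q(1)] has_bochner_integral_add[OF r(2) q(2)]
    by (intro exI[of _ "r + q"]) (simp add: x step_fun_simps step_integral_simps distrib_right inner_add_left)
qed

lemma step_integral_isometry:
  assumes "orthonormal_increments M B" and "time_steps xs"
  shows "(\<integral>\<^sup>+\<omega>. ennreal ((norm (step_integral B xs \<omega>))\<^sup>2) \<partial>M)
       = (\<integral>\<^sup>+s. ennreal ((norm (step_fun xs s))\<^sup>2) \<partial>lborel)"
proof -
  obtain r where "has_bochner_integral M (\<lambda>\<omega>. step_integral B xs \<omega> * step_integral B xs \<omega>) r"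
    "has_bochner_integral lborel (\<lambda>s. step_fun xs s \<bullet> step_fun xs s) r"
    using step_integral_covariance[OF assms assms(2)] by blast
  then have *: "has_bochner_integral M (\<lambda>\<omega>. (norm (step_integral B xs \<omega>))\<^sup>2) r"
    "has_bochner_integral lborel (\<lambda>s. (norm (step_fun xs s))\<^sup>2) r"
    by (simp add: power2_eq_square, simp add: power2_norm_eq_inner)
  show ?thesis
    using * by (subst (1 2) nn_integral_eq_integral) (auto simp: has_bochner_integral_iff)
qed

definition L2_null :: "'a measure \<Rightarrow> (nat \<Rightarrow> 'a \<Rightarrow> 'b::euclidean_space) \<Rightarrow> bool" where
  "L2_null M F \<longleftrightarrow> (\<lambda>n. \<integral>\<^sup>+x. ennreal ((norm (F n x))\<^sup>2) \<partial>M) \<longlonglongrightarrow> 0"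

lemma L2_null_add:
  assumes [measurable]: "\<And>n. F n \<in> borel_measurable M" "\<And>n. G n \<in> borel_measurable M"
    and F: "L2_null M F" and G: "L2_null M G"
  shows "L2_null M (\<lambda>n x. F n x + G n x)"
proof -
  have "(\<lambda>n. 2 * (\<integral>\<^sup>+x. ennreal ((norm (F n x))\<^sup>2) \<partial>M) + 2 * (\<integral>\<^sup>+x. ennreal ((norm (G n x))\<^sup>2) \<partial>M))
      \<longlonglongrightarrow> 2 * 0 + 2 * 0"
    using F G unfolding L2_null_def by (intro tendsto_add ennreal_tendsto_cmult) auto
  then have lim: "(\<lambda>n. 2 * (\<integral>\<^sup>+x. ennreal ((norm (F n x))\<^sup>2) \<partial>M) + 2 * (\<integral>\<^sup>+x. ennreal ((norm (G n x))\<^sup>2) \<partial>M))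
      \<longlonglongrightarrow> 0" by simp
  have le: "(\<integral>\<^sup>+x. ennreal ((norm (F n x + G n x))\<^sup>2) \<partial>M)
      \<le> 2 * (\<integral>\<^sup>+x. ennreal ((norm (F n x))\<^sup>2) \<partial>M) + 2 * (\<integral>\<^sup>+x. ennreal ((norm (G n x))\<^sup>2) \<partial>M)" for n
  proof -
    have pw: "ennreal ((norm (F n x + G n x))\<^sup>2) \<le> 2 * ennreal ((norm (F n x))\<^sup>2) + 2 * ennreal ((norm (G n x))\<^sup>2)" for x
    proof -
      have "(norm (F n x + G n x))\<^sup>2 \<le> (norm (F n x) + norm (G n x))\<^sup>2"
        by (intro power_mono norm_triangle_ineq) auto
      also have "\<dots> \<le> 2 * (norm (F n x))\<^sup>2 + 2 * (norm (G n x))\<^sup>2"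
        using zero_le_power2[of "norm (F n x) - norm (G n x)"]
        by (simp add: power2_eq_square algebra_simps)
      finally have "ennreal ((norm (F n x + G n x))\<^sup>2) \<le> ennreal (2 * (norm (F n x))\<^sup>2 + 2 * (norm (G n x))\<^sup>2)"
        by (rule ennreal_leI)
      then show ?thesis by (simp add: ennreal_plus ennreal_mult)
    qed
    have "(\<integral>\<^sup>+x. ennreal ((norm (F n x + G n x))\<^sup>2) \<partial>M)
        \<le> (\<integral>\<^sup>+x. 2 * ennreal ((norm (F n x))\<^sup>2) + 2 * ennreal ((norm (G n x))\<^sup>2) \<partial>M)"
      by (intro nn_integral_mono pw)
    then show ?thesis by (simp add: nn_integral_add nn_integral_cmult)
  qed
  show ?thesis unfolding L2_null_def
    by (rule tendsto_sandwich[OF _ _ tendsto_const lim]) (use le in auto)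
qed

lemma L2_null_scaleR:
  assumes [measurable]: "\<And>n. F n \<in> borel_measurable M" and F: "L2_null M F"
  shows "L2_null M (\<lambda>n x. c *\<^sub>R F n x)"
proof -
  have "(\<integral>\<^sup>+x. ennreal ((norm (c *\<^sub>R F n x))\<^sup>2) \<partial>M) = ennreal (c\<^sup>2) * (\<integral>\<^sup>+x. ennreal ((norm (F n x))\<^sup>2) \<partial>M)" for n
    by (simp add: power_mult_distrib ennreal_mult nn_integral_cmult)
  moreover have "(\<lambda>n. ennreal (c\<^sup>2) * (\<integral>\<^sup>+x. ennreal ((norm (F n x))\<^sup>2) \<partial>M)) \<longlonglongrightarrow> ennreal (c\<^sup>2) * 0"
    using F unfolding L2_null_def by (intro ennreal_tendsto_cmult) auto
  ultimately show ?thesis unfolding L2_null_def by simp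
qed

lemma L2_null_AE_subseq:
  assumes [measurable]: "\<And>n. F n \<in> borel_measurable M" and F: "L2_null M F"
  shows "\<exists>r::nat \<Rightarrow> nat. strict_mono r \<and> (AE x in M. (\<lambda>n. F (r n) x) \<longlonglongrightarrow> 0)"
proof -
  have "\<forall>\<^sub>F n in sequentially. (\<integral>\<^sup>+x. ennreal ((norm (F n x))\<^sup>2) \<partial>M) < 1"
    using F unfolding L2_null_def by (rule order_tendstoD) simp
  then obtain N where N: "\<And>n. N \<le> n \<Longrightarrow> (\<integral>\<^sup>+x. ennreal ((norm (F n x))\<^sup>2) \<partial>M) < 1"
    by (auto simp: eventually_sequentially)
  define u where "u n x = (norm (F (n + N) x))\<^sup>2" for n x
  have int: "integrable M (u n)" for n
    unfolding u_def using N[of "n + N"] by (intro integrableI_bounded) (auto intro: order.strict_trans)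
  have "ennreal (\<integral>x. norm (u n x) \<partial>M) = (\<integral>\<^sup>+x. ennreal ((norm (F (n + N) x))\<^sup>2) \<partial>M)" for n
    using int[of n] unfolding u_def by (subst nn_integral_eq_integral[symmetric]) auto
  then have "(\<lambda>n. ennreal (\<integral>x. norm (u n x) \<partial>M)) \<longlonglongrightarrow> ennreal 0"
    using LIMSEQ_ignore_initial_segment[OF F[unfolded L2_null_def], of N] by simp
  then have "(\<lambda>n. \<integral>x. norm (u n x) \<partial>M) \<longlonglongrightarrow> 0"
    by (subst (asm) tendsto_ennreal_iff) auto
  from tendsto_L1_AE_subseq[OF int this]
  obtain r :: "nat \<Rightarrow> nat" where r: "strict_mono r" "AE x in M. (\<lambda>n. u (r n) x) \<longlonglongrightarrow> 0" by blast
  have "AE x in M. (\<lambda>n. F (r n + N) x) \<longlonglongrightarrow> 0"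
    using r(2)
  proof eventually_elim
    fix x assume "(\<lambda>n. u (r n) x) \<longlonglongrightarrow> 0"
    then have "(\<lambda>n. sqrt ((norm (F (r n + N) x))\<^sup>2)) \<longlonglongrightarrow> sqrt 0"
      unfolding u_def by (rule tendsto_real_sqrt)
    then show "(\<lambda>n. F (r n + N) x) \<longlonglongrightarrow> 0"
      by (simp add: tendsto_norm_zero_iff)
  qed
  moreover have "strict_mono (\<lambda>n. r n + N)" using r(1) by (simp add: strict_mono_def)
  ultimately show ?thesis by blast
qed

text \<open>
  A subsequence converges almost everywhere, and a bound that holds for all members survives the
  limit. Neither \<open>Z\<close> nor \<open>K\<close> is assumed to be measurable, so that \<open>K\<close> may come from a bound on a
  continuous path.
\<close>
lemma AE_bound_of_L2_limit:
  fixes S :: "nat \<Rightarrow> 'a \<Rightarrow> real"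
  assumes [measurable]: "\<And>n. S n \<in> borel_measurable M" "X \<in> borel_measurable M"
    and lim: "L2_null M (\<lambda>n \<omega>. S n \<omega> - X \<omega>)"
    and bound: "AE \<omega> in M. \<forall>n. \<bar>S n \<omega> - Z \<omega>\<bar> \<le> K \<omega>"
  shows "AE \<omega> in M. \<bar>X \<omega> - Z \<omega>\<bar> \<le> K \<omega>"
proof -
  have "\<exists>r::nat \<Rightarrow> nat. strict_mono r \<and> (AE x in M. (\<lambda>n. S (r n) x - X x) \<longlonglongrightarrow> 0)"
    by (rule L2_null_AE_subseq[OF _ lim]) measurable
  then obtain r :: "nat \<Rightarrow> nat" where "AE x in M. (\<lambda>n. S (r n) x - X x) \<longlonglongrightarrow> 0" by blast
  with bound show ?thesis
  proof eventually_elim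
    fix \<omega> assume b: "\<forall>n. \<bar>S n \<omega> - Z \<omega>\<bar> \<le> K \<omega>" and "(\<lambda>n. S (r n) \<omega> - X \<omega>) \<longlonglongrightarrow> 0"
    then have "(\<lambda>n. \<bar>S (r n) \<omega> - Z \<omega>\<bar>) \<longlonglongrightarrow> \<bar>X \<omega> - Z \<omega>\<bar>"
      by (intro tendsto_intros) (simp add: LIM_zero_iff)
    then show "\<bar>X \<omega> - Z \<omega>\<bar> \<le> K \<omega>" by (rule LIMSEQ_le_const2) (use b in auto)
  qed
qed

text \<open>
  Wiener integrals with the kernel extended by \<open>0\<close> to the whole line, so that integrals over different
  time intervals can be combined linearly.
\<close>
definition wiener_limit ::
    "'a measure \<Rightarrow> (real \<Rightarrow> 'a \<Rightarrow> 'b::euclidean_space) \<Rightarrow> (real \<Rightarrow> 'b) \<Rightarrow> ('a \<Rightarrow> real) \<Rightarrow> bool" where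
  "wiener_limit M B f X \<longleftrightarrow> f \<in> borel_measurable borel \<and> X \<in> borel_measurable M \<and>
     (\<exists>\<phi>. (\<forall>n. time_steps (\<phi> n)) \<and> L2_null lborel (\<lambda>n s. step_fun (\<phi> n) s - f s) \<and>
          L2_null M (\<lambda>n \<omega>. step_integral B (\<phi> n) \<omega> - X \<omega>))"

lemma wiener_limit_of_integral:
  assumes "has_wiener_integral M B T f X"
  shows "wiener_limit M B (\<lambda>s. indicator {0<..T} s *\<^sub>R f s) X"
proof -
  obtain \<phi> where \<phi>: "\<forall>n. \<forall>(a, b, c)\<in>set (\<phi> n). 0 \<le> a \<and> a \<le> b \<and> b \<le> T"
    and l1: "(\<lambda>n. \<integral>\<^sup>+s\<in>{0<..T}. ennreal ((norm (step_fun (\<phi> n) s - f s))\<^sup>2) \<partial>lborel) \<longlonglongrightarrow> 0"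
    and l2: "(\<lambda>n. \<integral>\<^sup>+\<omega>. ennreal ((step_integral B (\<phi> n) \<omega> - X \<omega>)\<^sup>2) \<partial>M) \<longlonglongrightarrow> 0"
    using assms unfolding has_wiener_integral_def by blast
  have zero: "step_fun xs s = 0" if "\<forall>(a, b, c)\<in>set xs. 0 \<le> a \<and> a \<le> b \<and> b \<le> T" "s \<notin> {0<..T}"
    for xs :: "(real \<times> real \<times> 'b) list" and s
    using that by (induction xs) (auto simp: step_fun_simps indicator_def)
  have "(\<integral>\<^sup>+s\<in>{0<..T}. ennreal ((norm (step_fun (\<phi> n) s - f s))\<^sup>2) \<partial>lborel)
      = (\<integral>\<^sup>+s. ennreal ((norm (step_fun (\<phi> n) s - indicator {0<..T} s *\<^sub>R f s))\<^sup>2) \<partial>lborel)" for n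
    using zero[OF \<phi>[THEN spec, of n]] by (intro nn_integral_cong) (auto split: split_indicator)
  then have "L2_null lborel (\<lambda>n s. step_fun (\<phi> n) s - indicator {0<..T} s *\<^sub>R f s)"
    using l1 unfolding L2_null_def by simp
  moreover have "L2_null M (\<lambda>n \<omega>. step_integral B (\<phi> n) \<omega> - X \<omega>)"
    using l2 unfolding L2_null_def by simp
  moreover have "time_steps (\<phi> n)" for n using \<phi> by (auto simp: time_steps_def)
  moreover have "(\<lambda>s. indicator {0<..T} s *\<^sub>R f s) \<in> borel_measurable borel" "X \<in> borel_measurable M"
    using assms by (auto simp: has_wiener_integral_def set_borel_measurable_def)
  ultimately show ?thesis unfolding wiener_limit_def by blast
qed

lemma wiener_limit_add:
  assumes orth: "orthonormal_increments M B"
    and "wiener_limit M B f X" "wiener_limit M B g Y"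
  shows "wiener_limit M B (\<lambda>s. f s + g s) (\<lambda>\<omega>. X \<omega> + Y \<omega>)"
proof -
  obtain \<phi> where \<phi>: "\<forall>n. time_steps (\<phi> n)" "L2_null lborel (\<lambda>n s. step_fun (\<phi> n) s - f s)"
      "L2_null M (\<lambda>n \<omega>. step_integral B (\<phi> n) \<omega> - X \<omega>)"
    using assms(2) by (auto simp: wiener_limit_def)
  obtain \<psi> where \<psi>: "\<forall>n. time_steps (\<psi> n)" "L2_null lborel (\<lambda>n s. step_fun (\<psi> n) s - g s)"
      "L2_null M (\<lambda>n \<omega>. step_integral B (\<psi> n) \<omega> - Y \<omega>)"
    using assms(3) by (auto simp: wiener_limit_def)
  have [measurable]: "f \<in> borel_measurable borel" "g \<in> borel_measurable borel"
      "X \<in> borel_measurable M" "Y \<in> borel_measurable M"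
    using assms(2,3) by (auto simp: wiener_limit_def)
  have [measurable]: "step_integral B (\<phi> n) \<in> borel_measurable M" "step_integral B (\<psi> n) \<in> borel_measurable M" for n
    using \<phi>(1) \<psi>(1) by (auto intro: borel_measurable_step_integral[OF orth])
  have "L2_null lborel (\<lambda>n s. (step_fun (\<phi> n) s - f s) + (step_fun (\<psi> n) s - g s))"
    by (intro L2_null_add \<phi> \<psi>) measurable
  moreover have "L2_null M (\<lambda>n \<omega>. (step_integral B (\<phi> n) \<omega> - X \<omega>) + (step_integral B (\<psi> n) \<omega> - Y \<omega>))"
    by (intro L2_null_add \<phi> \<psi>) measurable
  ultimately show ?thesis
    unfolding wiener_limit_def using \<phi>(1) \<psi>(1)
    by (intro conjI exI[of _ "\<lambda>n. \<phi> n @ \<psi> n"])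
       (simp_all add: step_fun_simps step_integral_simps algebra_simps)
qed

lemma wiener_limit_scaleR:
  assumes orth: "orthonormal_increments M B" and "wiener_limit M B f X"
  shows "wiener_limit M B (\<lambda>s. c *\<^sub>R f s) (\<lambda>\<omega>. c * X \<omega>)"
proof -
  obtain \<phi> where \<phi>: "\<forall>n. time_steps (\<phi> n)" "L2_null lborel (\<lambda>n s. step_fun (\<phi> n) s - f s)"
      "L2_null M (\<lambda>n \<omega>. step_integral B (\<phi> n) \<omega> - X \<omega>)"
    using assms(2) by (auto simp: wiener_limit_def)
  have [measurable]: "f \<in> borel_measurable borel" "X \<in> borel_measurable M"
    using assms(2) by (auto simp: wiener_limit_def)
  have [measurable]: "step_integral B (\<phi> n) \<in> borel_measurable M" for n
    using \<phi>(1) by (auto intro: borel_measurable_step_integral[OF orth])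
  have "L2_null lborel (\<lambda>n s. c *\<^sub>R (step_fun (\<phi> n) s - f s))"
    by (intro L2_null_scaleR \<phi>) measurable
  moreover have "L2_null M (\<lambda>n \<omega>. c *\<^sub>R (step_integral B (\<phi> n) \<omega> - X \<omega>))"
    by (intro L2_null_scaleR \<phi>) measurable
  ultimately show ?thesis
    unfolding wiener_limit_def using \<phi>(1)
    by (intro conjI exI[of _ "\<lambda>n. scale_steps c (\<phi> n)"])
       (simp_all add: step_fun_simps step_integral_simps algebra_simps)
qed

text \<open>
  The value of the integral does not depend on the approximating sequence: two such sequences differ
  by step functions that tend to \<open>0\<close> in mean square, and the isometry transfers this to their integrals.
\<close>
lemma wiener_limit_approximation:
  assumes orth: "orthonormal_increments M B" and W: "wiener_limit M B f X"
    and \<psi>: "\<And>n. time_steps (\<psi> n)" and l\<psi>: "L2_null lborel (\<lambda>n s. step_fun (\<psi> n) s - f s)"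
  shows "L2_null M (\<lambda>n \<omega>. step_integral B (\<psi> n) \<omega> - X \<omega>)"
proof -
  obtain \<phi> where \<phi>: "\<forall>n. time_steps (\<phi> n)" "L2_null lborel (\<lambda>n s. step_fun (\<phi> n) s - f s)"
      "L2_null M (\<lambda>n \<omega>. step_integral B (\<phi> n) \<omega> - X \<omega>)"
    using W by (auto simp: wiener_limit_def)
  have [measurable]: "f \<in> borel_measurable borel" "X \<in> borel_measurable M"
    using W by (auto simp: wiener_limit_def)
  have [measurable]: "step_integral B (\<phi> n) \<in> borel_measurable M" "step_integral B (\<psi> n) \<in> borel_measurable M" for n
    using \<phi>(1) \<psi> by (auto intro: borel_measurable_step_integral[OF orth])
  define D where "D n = \<psi> n @ scale_steps (- 1) (\<phi> n)" for n
  have D: "time_steps (D n)" for n using \<psi> \<phi>(1) by (simp add: D_def)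
  have "L2_null lborel (\<lambda>n s. (step_fun (\<psi> n) s - f s) + (- 1) *\<^sub>R (step_fun (\<phi> n) s - f s))"
    by (intro L2_null_add L2_null_scaleR l\<psi> \<phi>) measurable
  then have "L2_null lborel (\<lambda>n s. step_fun (D n) s)"
    by (simp add: D_def step_fun_simps)
  then have "L2_null M (\<lambda>n \<omega>. step_integral B (D n) \<omega>)"
    unfolding L2_null_def step_integral_isometry[OF orth D] .
  then have "L2_null M (\<lambda>n \<omega>. step_integral B (\<psi> n) \<omega> - step_integral B (\<phi> n) \<omega>)"
    by (simp add: D_def step_integral_simps)
  then have "L2_null M (\<lambda>n \<omega>. (step_integral B (\<psi> n) \<omega> - step_integral B (\<phi> n) \<omega>)
      + (step_integral B (\<phi> n) \<omega> - X \<omega>))"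
    by (intro L2_null_add \<phi>) measurable
  then show ?thesis by simp
qed

section \<open>Increments of Wiener integrals with a regular kernel\<close>

lemma step_fun_partition:
  "step_fun (map (\<lambda>i. (p i, p (Suc i), c i)) [0..<N]) s = (\<Sum>i<N. indicator {p i<..p (Suc i)} s *\<^sub>R c i)"
  by (induction N) (simp_all add: step_fun_simps)

lemma step_integral_partition:
  "step_integral B (map (\<lambda>i. (p i, p (Suc i), c i)) [0..<N]) \<omega> = (\<Sum>i<N. c i \<bullet> (B (p (Suc i)) \<omega> - B (p i) \<omega>))"
  by (induction N) (simp_all add: step_integral_simps)

lemma sum_indicator_partition:
  fixes p :: "nat \<Rightarrow> real"
  assumes "incseq p"
  shows "(\<Sum>i<N. indicator {p i<..p (Suc i)} s) = (indicator {p 0<..p N} s :: real)"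
proof (induction N)
  case (Suc N)
  have "p 0 \<le> p N" "p N \<le> p (Suc N)" using assms by (auto simp: incseq_def)
  then show ?case using Suc by (auto simp: indicator_def)
qed simp

lemma sum_inner_by_parts:
  fixes x y :: "nat \<Rightarrow> 'b::real_inner"
  shows "(\<Sum>i<N. x (Suc i) \<bullet> (y (Suc i) - y i))
       = x N \<bullet> (y N - y 0) - (\<Sum>i<N. (x (Suc i) - x i) \<bullet> (y i - y 0))"
  by (induction N) (simp_all add: inner_diff_left inner_diff_right)

text \<open>
  On an equidistant partition let the step function take the value of \<open>\<kappa>\<close> at the right end of each
  subinterval. Summation by parts moves the differences from the integrator to \<open>\<kappa>\<close>, where they are
  controlled by the Lipschitz constant. The resulting bound is pathwise and does not depend on the
  partition, so it passes to the limit.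
\<close>
lemma lipschitz_steps:
  fixes \<kappa> :: "real \<Rightarrow> 'b::euclidean_space" and B :: "real \<Rightarrow> 'a \<Rightarrow> 'b"
  assumes uv: "0 \<le> u" "u \<le> v" and L: "0 \<le> L"
    and lip: "\<And>r s. r \<in> {u..v} \<Longrightarrow> s \<in> {u..v} \<Longrightarrow> norm (\<kappa> r - \<kappa> s) \<le> L * \<bar>r - s\<bar>"
  obtains \<psi> where "\<And>n. time_steps (\<psi> n)"
    and "L2_null lborel (\<lambda>n s. step_fun (\<psi> n) s - indicator {u<..v} s *\<^sub>R \<kappa> s)"
    and "\<And>n \<omega> K. (\<And>s. s \<in> {u..v} \<Longrightarrow> norm (B s \<omega> - B u \<omega>) \<le> K) \<Longrightarrow>
      \<bar>step_integral B (\<psi> n) \<omega> - \<kappa> v \<bullet> (B v \<omega> - B u \<omega>)\<bar> \<le> L * (v - u) * K"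
proof -
  define p where "p n i = u + (v - u) * (real i / real (Suc n))" for n i
  define \<psi> where "\<psi> n = map (\<lambda>i. (p n i, p n (Suc i), \<kappa> (p n (Suc i)))) [0..<Suc n]" for n
  have p0: "p n 0 = u" and pN: "p n (Suc n) = v" for n by (auto simp: p_def)
  have pmono: "incseq (p n)" for n
    unfolding p_def using uv by (intro incseq_SucI add_left_mono mult_left_mono divide_right_mono) auto
  have pin: "p n i \<in> {u..v}" if "i \<le> Suc n" for n i
    using pmono[of n, unfolded incseq_def, rule_format, of 0 i]
      pmono[of n, unfolded incseq_def, rule_format, OF that] by (simp add: p0 pN)
  have pdiff: "p n (Suc i) - p n i = (v - u) / real (Suc n)" for n i
    unfolding p_def by (simp only: add_diff_cancel_left right_diff_distrib[symmetric]
        diff_divide_distrib[symmetric]) simp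
  show thesis
  proof
    show "time_steps (\<psi> n)" for n
    proof -
      have "0 \<le> p n i \<and> p n i \<le> p n (Suc i)" if "i < Suc n" for i
        using pin[of i n] that uv pmono[of n] by (auto simp: incseq_Suc_iff)
      then show ?thesis by (auto simp: \<psi>_def time_steps_def)
    qed
  next
    have bd: "norm (step_fun (\<psi> n) s - indicator {u<..v} s *\<^sub>R \<kappa> s)
        \<le> L * ((v - u) / real (Suc n)) * indicator {u<..v} s" for n s
    proof -
      \<comment> \<open>At most one \<open>I i\<close> is nonzero, and they add up to the indicator of the whole interval.\<close>
      define I where "I i = (indicator {p n i<..p n (Suc i)} s :: real)" for i
      have I: "(\<Sum>i<Suc n. I i) = indicator {u<..v} s"
        unfolding I_def sum_indicator_partition[OF pmono] p0 pN ..
      have E: "step_fun (\<psi> n) s = (\<Sum>i<Suc n. I i *\<^sub>R \<kappa> (p n (Suc i)))"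
        unfolding \<psi>_def I_def by (rule step_fun_partition)
      have "step_fun (\<psi> n) s - indicator {u<..v} s *\<^sub>R \<kappa> s
          = (\<Sum>i<Suc n. I i *\<^sub>R (\<kappa> (p n (Suc i)) - \<kappa> s))"
        unfolding E I[symmetric] scaleR_right_diff_distrib sum_subtractf scaleR_sum_left ..
      also have "norm \<dots> \<le> (\<Sum>i<Suc n. I i * (L * ((v - u) / real (Suc n))))"
      proof (rule order_trans[OF norm_sum], rule sum_mono)
        fix i assume i: "i \<in> {..<Suc n}"
        show "norm (I i *\<^sub>R (\<kappa> (p n (Suc i)) - \<kappa> s)) \<le> I i * (L * ((v - u) / real (Suc n)))"
        proof (cases "s \<in> {p n i<..p n (Suc i)}")
          case True
          have "s \<in> {u..v}" "p n (Suc i) \<in> {u..v}"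
            using True pin[of i n] pin[of "Suc i" n] i by auto
          then have "norm (\<kappa> (p n (Suc i)) - \<kappa> s) \<le> L * \<bar>p n (Suc i) - s\<bar>" by (intro lip)
          also have "\<dots> \<le> L * ((v - u) / real (Suc n))"
            using True pdiff[of n i] L by (intro mult_left_mono) auto
          finally show ?thesis using True by (simp add: I_def)
        qed (simp add: I_def)
      qed
      also have "\<dots> = L * ((v - u) / real (Suc n)) * indicator {u<..v} s"
        unfolding sum_distrib_right[symmetric] I by (simp add: mult.commute)
      finally show ?thesis .
    qed
    have le: "(\<integral>\<^sup>+s. ennreal ((norm (step_fun (\<psi> n) s - indicator {u<..v} s *\<^sub>R \<kappa> s))\<^sup>2) \<partial>lborel)
        \<le> ennreal ((L * ((v - u) / real (Suc n)))\<^sup>2 * (v - u))" for n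
    proof -
      have "(\<integral>\<^sup>+s. ennreal ((norm (step_fun (\<psi> n) s - indicator {u<..v} s *\<^sub>R \<kappa> s))\<^sup>2) \<partial>lborel)
          \<le> (\<integral>\<^sup>+s. ennreal ((L * ((v - u) / real (Suc n)))\<^sup>2) * indicator {u<..v} s \<partial>lborel)"
      proof (intro nn_integral_mono)
        fix s
        have "(norm (step_fun (\<psi> n) s - indicator {u<..v} s *\<^sub>R \<kappa> s))\<^sup>2
            \<le> (L * ((v - u) / real (Suc n)) * indicator {u<..v} s)\<^sup>2"
          by (intro power_mono bd) simp
        then show "ennreal ((norm (step_fun (\<psi> n) s - indicator {u<..v} s *\<^sub>R \<kappa> s))\<^sup>2)
            \<le> ennreal ((L * ((v - u) / real (Suc n)))\<^sup>2) * indicator {u<..v} s"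
          by (auto simp: indicator_def intro!: ennreal_leI)
      qed
      also have "\<dots> = ennreal ((L * ((v - u) / real (Suc n)))\<^sup>2 * (v - u))"
        using uv by (subst nn_integral_cmult_indicator) (auto simp: ennreal_mult)
      finally show ?thesis .
    qed
    have "(\<lambda>n. (L * ((v - u) * (1 / real (Suc n))))\<^sup>2 * (v - u)) \<longlonglongrightarrow> (L * ((v - u) * 0))\<^sup>2 * (v - u)"
      by (intro tendsto_intros LIMSEQ_Suc[OF lim_1_over_n])
    then have "(\<lambda>n. ennreal ((L * ((v - u) / real (Suc n)))\<^sup>2 * (v - u))) \<longlonglongrightarrow> ennreal 0"
      by (intro tendsto_ennrealI) simp
    then have lim: "(\<lambda>n. ennreal ((L * ((v - u) / real (Suc n)))\<^sup>2 * (v - u))) \<longlonglongrightarrow> 0" by simp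
    show "L2_null lborel (\<lambda>n s. step_fun (\<psi> n) s - indicator {u<..v} s *\<^sub>R \<kappa> s)"
      unfolding L2_null_def by (rule tendsto_sandwich[OF _ _ tendsto_const lim]) (use le in auto)
  next
    fix n \<omega> K
    assume K: "\<And>s. s \<in> {u..v} \<Longrightarrow> norm (B s \<omega> - B u \<omega>) \<le> K"
    have E: "step_integral B (\<psi> n) \<omega> = (\<Sum>i<Suc n. \<kappa> (p n (Suc i)) \<bullet> (B (p n (Suc i)) \<omega> - B (p n i) \<omega>))"
      unfolding \<psi>_def by (rule step_integral_partition)
    have "step_integral B (\<psi> n) \<omega> - \<kappa> v \<bullet> (B v \<omega> - B u \<omega>)
        = - (\<Sum>i<Suc n. (\<kappa> (p n (Suc i)) - \<kappa> (p n i)) \<bullet> (B (p n i) \<omega> - B u \<omega>))"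
      using sum_inner_by_parts[of "\<lambda>i. \<kappa> (p n i)" "\<lambda>i. B (p n i) \<omega>" "Suc n"]
      unfolding E p0 pN by linarith
    then have "\<bar>step_integral B (\<psi> n) \<omega> - \<kappa> v \<bullet> (B v \<omega> - B u \<omega>)\<bar>
        \<le> (\<Sum>i<Suc n. \<bar>(\<kappa> (p n (Suc i)) - \<kappa> (p n i)) \<bullet> (B (p n i) \<omega> - B u \<omega>)\<bar>)"
      using sum_abs[of "\<lambda>i. (\<kappa> (p n (Suc i)) - \<kappa> (p n i)) \<bullet> (B (p n i) \<omega> - B u \<omega>)" "{..<Suc n}"]
      by (simp only: abs_minus_cancel)
    also have "\<dots> \<le> (\<Sum>i<Suc n. L * ((v - u) / real (Suc n)) * K)"
    proof (rule sum_mono)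
      fix i assume i: "i \<in> {..<Suc n}"
      have "norm (\<kappa> (p n (Suc i)) - \<kappa> (p n i)) \<le> L * \<bar>p n (Suc i) - p n i\<bar>"
        using i by (intro lip pin) auto
      also have "\<dots> = L * ((v - u) / real (Suc n))" unfolding pdiff using uv by simp
      finally have 1: "norm (\<kappa> (p n (Suc i)) - \<kappa> (p n i)) \<le> L * ((v - u) / real (Suc n))" .
      have 2: "norm (B (p n i) \<omega> - B u \<omega>) \<le> K" using i by (intro K pin) auto
      show "\<bar>(\<kappa> (p n (Suc i)) - \<kappa> (p n i)) \<bullet> (B (p n i) \<omega> - B u \<omega>)\<bar> \<le> L * ((v - u) / real (Suc n)) * K"
        by (rule order_trans[OF Cauchy_Schwarz_ineq2 mult_mono[OF 1 2]]) (use L uv in auto)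
    qed
    also have "\<dots> = L * (v - u) * K" by (simp del: of_nat_Suc)
    finally show "\<bar>step_integral B (\<psi> n) \<omega> - \<kappa> v \<bullet> (B v \<omega> - B u \<omega>)\<bar> \<le> L * (v - u) * K" .
  qed
qed

text \<open>
  The relation between the kernels on \<open>(0, t]\<close> says that \<open>V (t + h) - (1 + a) V t - b V (t + h0)\<close> has a
  kernel that vanishes there. What remains are integrals of Lipschitz functions over \<open>(t, t + h]\<close> and
  \<open>(t, t + h0]\<close>, which are compared with \<open>e \<bullet> (B (t + h) - B t)\<close> and \<open>e \<bullet> (B (t + h0) - B t)\<close> by means of
  the partitions above. Using a second value of \<open>V\<close> in place of a separate integral over the past makes
  it unnecessary to construct any further Wiener integral.
\<close>
lemma wiener_increment_bound:
  fixes B :: "real \<Rightarrow> 'a \<Rightarrow> 'b::euclidean_space" and k :: "real \<Rightarrow> real \<Rightarrow> 'b"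
  assumes orth: "orthonormal_increments M B"
    and t: "0 < t" and h: "0 < h" "h \<le> h0"
    and V: "\<And>u. 0 < u \<Longrightarrow> has_wiener_integral M B u (k u) (V u)"
    and rel: "\<And>s. s \<in> {0<..t} \<Longrightarrow> k (t + h) s - k t s = a *\<^sub>R k t s + b *\<^sub>R k (t + h0) s"
    and diag: "\<And>u. u \<in> {t..t + h0} \<Longrightarrow> k u u = e"
    and L: "0 \<le> L"
    and lip: "\<And>u r s. u \<in> {t..t + h0} \<Longrightarrow> r \<in> {t..u} \<Longrightarrow> s \<in> {t..u} \<Longrightarrow> norm (k u r - k u s) \<le> L * \<bar>r - s\<bar>"
    and K: "AE \<omega> in M. \<forall>s\<in>{t..t + h0}. norm (B s \<omega> - B t \<omega>) \<le> K \<omega>"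
  shows "AE \<omega> in M. \<bar>V (t + h) \<omega> - V t \<omega> - e \<bullet> (B (t + h) \<omega> - B t \<omega>)\<bar>
    \<le> \<bar>a\<bar> * \<bar>V t \<omega>\<bar> + \<bar>b\<bar> * (\<bar>V (t + h0) \<omega>\<bar> + \<bar>e \<bullet> (B (t + h0) \<omega> - B t \<omega>)\<bar> + L * h0 * K \<omega>) + L * h * K \<omega>"
proof -
  obtain \<psi>1 where \<psi>1: "\<And>n. time_steps (\<psi>1 n)"
    "L2_null lborel (\<lambda>n s. step_fun (\<psi>1 n) s - indicator {t<..t + h} s *\<^sub>R k (t + h) s)"
    "\<And>n \<omega> K. (\<And>s. s \<in> {t..t + h} \<Longrightarrow> norm (B s \<omega> - B t \<omega>) \<le> K) \<Longrightarrow>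
      \<bar>step_integral B (\<psi>1 n) \<omega> - k (t + h) (t + h) \<bullet> (B (t + h) \<omega> - B t \<omega>)\<bar> \<le> L * (t + h - t) * K"
    by (rule lipschitz_steps[of t "t + h" L "k (t + h)" B]) (use t h L lip in auto)
  obtain \<psi>2 where \<psi>2: "\<And>n. time_steps (\<psi>2 n)"
    "L2_null lborel (\<lambda>n s. step_fun (\<psi>2 n) s - indicator {t<..t + h0} s *\<^sub>R k (t + h0) s)"
    "\<And>n \<omega> K. (\<And>s. s \<in> {t..t + h0} \<Longrightarrow> norm (B s \<omega> - B t \<omega>) \<le> K) \<Longrightarrow>
      \<bar>step_integral B (\<psi>2 n) \<omega> - k (t + h0) (t + h0) \<bullet> (B (t + h0) \<omega> - B t \<omega>)\<bar> \<le> L * (t + h0 - t) * K"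
    by (rule lipschitz_steps[of t "t + h0" L "k (t + h0)" B]) (use t h L lip in auto)
  define X where "X \<omega> = V (t + h) \<omega> + ((- (1 + a)) * V t \<omega> + (- b) * V (t + h0) \<omega>)" for \<omega>
  define f where "f s = indicator {0<..t + h} s *\<^sub>R k (t + h) s + ((- (1 + a)) *\<^sub>R (indicator {0<..t} s *\<^sub>R k t s)
      + (- b) *\<^sub>R (indicator {0<..t + h0} s *\<^sub>R k (t + h0) s))" for s
  have W: "wiener_limit M B f X"
    unfolding f_def X_def using t h
    by (intro wiener_limit_add[OF orth] wiener_limit_scaleR[OF orth] wiener_limit_of_integral V) auto
  \<comment> \<open>The past cancels.\<close>
  have f_eq: "f s = indicator {t<..t + h} s *\<^sub>R k (t + h) s + (- b) *\<^sub>R (indicator {t<..t + h0} s *\<^sub>R k (t + h0) s)" for s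
  proof (cases "s \<in> {0<..t}")
    case True
    then have "f s = k (t + h) s - k t s - (a *\<^sub>R k t s + b *\<^sub>R k (t + h0) s)"
      using h by (simp add: f_def algebra_simps)
    then show ?thesis using rel[OF True] True by simp
  next
    case False
    then show ?thesis using t h by (auto simp: f_def indicator_def)
  qed
  have kmeas: "(\<lambda>s. indicator {0<..u} s *\<^sub>R k u s) \<in> borel_measurable borel" if "0 < u" for u
    using V[OF that] by (auto simp: has_wiener_integral_def set_borel_measurable_def)
  have meas: "(\<lambda>s. indicator {t<..u} s *\<^sub>R k u s) \<in> borel_measurable borel" if "t < u" for u
  proof -
    have "(\<lambda>s. indicator {t<..u} s *\<^sub>R k u s) = (\<lambda>s. indicator {t<..} s *\<^sub>R (indicator {0<..u} s *\<^sub>R k u s))"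
      using t by (auto simp: fun_eq_iff indicator_def)
    also have "\<dots> \<in> borel_measurable borel"
      using that t by (intro borel_measurable_scaleR borel_measurable_indicator kmeas) auto
    finally show ?thesis .
  qed
  have [measurable]: "(\<lambda>s. indicator {t<..t + h} s *\<^sub>R k (t + h) s) \<in> borel_measurable borel"
      "(\<lambda>s. indicator {t<..t + h0} s *\<^sub>R k (t + h0) s) \<in> borel_measurable borel"
    using h by (auto intro!: meas)
  define \<psi> where "\<psi> n = \<psi>1 n @ scale_steps (- b) (\<psi>2 n)" for n
  have \<psi>: "time_steps (\<psi> n)" for n using \<psi>1 \<psi>2 by (simp add: \<psi>_def)
  have "L2_null lborel (\<lambda>n s. (step_fun (\<psi>1 n) s - indicator {t<..t + h} s *\<^sub>R k (t + h) s)
      + (- b) *\<^sub>R (step_fun (\<psi>2 n) s - indicator {t<..t + h0} s *\<^sub>R k (t + h0) s))"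
    by (intro L2_null_add L2_null_scaleR \<psi>1 \<psi>2) measurable
  then have "L2_null lborel (\<lambda>n s. step_fun (\<psi> n) s - f s)"
    by (simp add: f_eq \<psi>_def step_fun_simps algebra_simps)
  then have lim: "L2_null M (\<lambda>n \<omega>. step_integral B (\<psi> n) \<omega> - X \<omega>)"
    by (rule wiener_limit_approximation[OF orth W \<psi>])
  define Z where "Z \<omega> = e \<bullet> (B (t + h) \<omega> - B t \<omega>) - b * (e \<bullet> (B (t + h0) \<omega> - B t \<omega>))" for \<omega>
  have "AE \<omega> in M. \<bar>X \<omega> - Z \<omega>\<bar> \<le> L * h * K \<omega> + \<bar>b\<bar> * (L * h0 * K \<omega>)"
  proof (rule AE_bound_of_L2_limit[OF _ _ lim])
    show "step_integral B (\<psi> n) \<in> borel_measurable M" for n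
      by (rule borel_measurable_step_integral[OF orth \<psi>])
    show "X \<in> borel_measurable M" using W by (simp add: wiener_limit_def)
    show "AE \<omega> in M. \<forall>n. \<bar>step_integral B (\<psi> n) \<omega> - Z \<omega>\<bar> \<le> L * h * K \<omega> + \<bar>b\<bar> * (L * h0 * K \<omega>)"
      using K
    proof eventually_elim
      fix \<omega> assume K\<omega>: "\<forall>s\<in>{t..t + h0}. norm (B s \<omega> - B t \<omega>) \<le> K \<omega>"
      show "\<forall>n. \<bar>step_integral B (\<psi> n) \<omega> - Z \<omega>\<bar> \<le> L * h * K \<omega> + \<bar>b\<bar> * (L * h0 * K \<omega>)"
      proof
        fix n
        have 1: "\<bar>step_integral B (\<psi>1 n) \<omega> - e \<bullet> (B (t + h) \<omega> - B t \<omega>)\<bar> \<le> L * h * K \<omega>"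
          using \<psi>1(3)[of \<omega> "K \<omega>" n] K\<omega> diag[of "t + h"] h by simp
        have "\<bar>step_integral B (\<psi>2 n) \<omega> - e \<bullet> (B (t + h0) \<omega> - B t \<omega>)\<bar> \<le> L * h0 * K \<omega>"
          using \<psi>2(3)[of \<omega> "K \<omega>" n] K\<omega> diag[of "t + h0"] h by simp
        then have "\<bar>b\<bar> * \<bar>step_integral B (\<psi>2 n) \<omega> - e \<bullet> (B (t + h0) \<omega> - B t \<omega>)\<bar> \<le> \<bar>b\<bar> * (L * h0 * K \<omega>)"
          by (intro mult_left_mono) auto
        then have 2: "\<bar>b * (step_integral B (\<psi>2 n) \<omega> - e \<bullet> (B (t + h0) \<omega> - B t \<omega>))\<bar> \<le> \<bar>b\<bar> * (L * h0 * K \<omega>)"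
          by (simp add: abs_mult)
        have "step_integral B (\<psi> n) \<omega> - Z \<omega> = (step_integral B (\<psi>1 n) \<omega> - e \<bullet> (B (t + h) \<omega> - B t \<omega>))
            - b * (step_integral B (\<psi>2 n) \<omega> - e \<bullet> (B (t + h0) \<omega> - B t \<omega>))"
          by (simp add: \<psi>_def Z_def step_integral_simps right_diff_distrib)
        then show "\<bar>step_integral B (\<psi> n) \<omega> - Z \<omega>\<bar> \<le> L * h * K \<omega> + \<bar>b\<bar> * (L * h0 * K \<omega>)"
          using 1 2 by linarith
      qed
    qed
  qed
  then show ?thesis
  proof eventually_elim
    fix \<omega> assume b: "\<bar>X \<omega> - Z \<omega>\<bar> \<le> L * h * K \<omega> + \<bar>b\<bar> * (L * h0 * K \<omega>)"
    have "V (t + h) \<omega> - V t \<omega> - e \<bullet> (B (t + h) \<omega> - B t \<omega>)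
        = (X \<omega> - Z \<omega>) + a * V t \<omega> + b * V (t + h0) \<omega> - b * (e \<bullet> (B (t + h0) \<omega> - B t \<omega>))"
      by (simp add: X_def Z_def algebra_simps)
    then have "\<bar>V (t + h) \<omega> - V t \<omega> - e \<bullet> (B (t + h) \<omega> - B t \<omega>)\<bar>
        \<le> \<bar>X \<omega> - Z \<omega>\<bar> + \<bar>a * V t \<omega>\<bar> + \<bar>b * V (t + h0) \<omega>\<bar> + \<bar>b * (e \<bullet> (B (t + h0) \<omega> - B t \<omega>))\<bar>"
      by linarith
    then show "\<bar>V (t + h) \<omega> - V t \<omega> - e \<bullet> (B (t + h) \<omega> - B t \<omega>)\<bar>
        \<le> \<bar>a\<bar> * \<bar>V t \<omega>\<bar> + \<bar>b\<bar> * (\<bar>V (t + h0) \<omega>\<bar> + \<bar>e \<bullet> (B (t + h0) \<omega> - B t \<omega>)\<bar> + L * h0 * K \<omega>) + L * h * K \<omega>"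
      using b by (simp add: abs_mult distrib_left)
  qed
qed

section \<open>Regularity of the two kernels\<close>

text \<open>
  The coefficients of \<open>1\<close> and \<open>A\<close> in the powers of an element \<open>A\<close> with \<open>A\<^sup>2 = \<mu>\<close>.
\<close>
fun quadratic_powers :: "real \<Rightarrow> nat \<Rightarrow> real \<times> real" where
  "quadratic_powers \<mu> 0 = (1, 0)"
| "quadratic_powers \<mu> (Suc k) = (\<mu> * snd (quadratic_powers \<mu> k), fst (quadratic_powers \<mu> k))"

lemma matrix_power_quadratic:
  fixes A :: "real^'n^'n"
  assumes A: "A ** A = \<mu> *\<^sub>R mat 1"
  shows "((**) (x *\<^sub>R A) ^^ k) (mat 1)
       = x ^ k *\<^sub>R (fst (quadratic_powers \<mu> k) *\<^sub>R mat 1 + snd (quadratic_powers \<mu> k) *\<^sub>R A)"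
  by (induction k)
     (simp_all add: matrix_add_ldistrib matrix_scalar_ac scalar_matrix_assoc[symmetric] A algebra_simps)

lemma quadratic_powers_bound:
  "\<bar>fst (quadratic_powers \<mu> k)\<bar> \<le> max 1 \<bar>\<mu>\<bar> ^ k \<and> \<bar>snd (quadratic_powers \<mu> k)\<bar> \<le> max 1 \<bar>\<mu>\<bar> ^ k"
proof (induction k)
  case (Suc k)
  have "\<bar>\<mu>\<bar> * \<bar>snd (quadratic_powers \<mu> k)\<bar> \<le> max 1 \<bar>\<mu>\<bar> * max 1 \<bar>\<mu>\<bar> ^ k"
    using Suc by (intro mult_mono) auto
  moreover have "1 * \<bar>fst (quadratic_powers \<mu> k)\<bar> \<le> max 1 \<bar>\<mu>\<bar> * max 1 \<bar>\<mu>\<bar> ^ k"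
    using Suc by (intro mult_mono) auto
  ultimately show ?case by (simp add: abs_mult)
qed simp

text \<open>
  Explicitly, \<open>c x = cosh (sqrt \<mu> x)\<close> and \<open>d x = sinh (sqrt \<mu> x) / sqrt \<mu>\<close> for \<open>\<mu> > 0\<close>, the
  corresponding trigonometric functions for \<open>\<mu> < 0\<close>, and \<open>1\<close> and \<open>x\<close> for \<open>\<mu> = 0\<close>. Defining both by
  their power series and recording the differential equations treats the three cases alike.
\<close>
lemma matrix_exp_quadratic:
  fixes A :: "real^'n^'n"
  assumes A: "A ** A = \<mu> *\<^sub>R mat 1"
  obtains c d :: "real \<Rightarrow> real"
  where "\<And>x. matrix_exp (x *\<^sub>R A) = c x *\<^sub>R mat 1 + d x *\<^sub>R A"
    and "\<And>x. (c has_real_derivative \<mu> * d x) (at x)"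
    and "\<And>x. (d has_real_derivative c x) (at x)"
    and "c 0 = 1" and "d 0 = 0"
proof -
  define P where "P k = fst (quadratic_powers \<mu> k) / fact k" for k
  define Q where "Q k = snd (quadratic_powers \<mu> k) / fact k" for k
  have dom: "summable (\<lambda>k. p k / fact k * x ^ k)" if "\<And>k. \<bar>p k\<bar> \<le> max 1 \<bar>\<mu>\<bar> ^ k" for p :: "nat \<Rightarrow> real" and x
  proof (rule summable_comparison_test')
    show "summable (\<lambda>k. inverse (fact k) * (max 1 \<bar>\<mu>\<bar> * \<bar>x\<bar>) ^ k)" by (rule summable_exp)
    show "norm (p k / fact k * x ^ k) \<le> inverse (fact k) * (max 1 \<bar>\<mu>\<bar> * \<bar>x\<bar>) ^ k" for k
      using mult_right_mono[OF that[of k], of "\<bar>x\<bar> ^ k / fact k"]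
      by (simp add: abs_mult power_abs power_mult_distrib field_simps)
  qed
  have sP: "summable (\<lambda>k. P k * x ^ k)" and sQ: "summable (\<lambda>k. Q k * x ^ k)" for x
    unfolding P_def Q_def by (rule dom, use quadratic_powers_bound in blast)+
  define c where "c x = (\<Sum>k. P k * x ^ k)" for x
  define d where "d x = (\<Sum>k. Q k * x ^ k)" for x
  have dP: "diffs P = (\<lambda>k. \<mu> * Q k)" and dQ: "diffs Q = P"
    by (auto simp: fun_eq_iff diffs_def P_def Q_def simp del: of_nat_Suc)
  show thesis
  proof
    fix x
    have "(\<lambda>k. (P k * x ^ k) *\<^sub>R mat 1 + (Q k * x ^ k) *\<^sub>R A) sums (c x *\<^sub>R mat 1 + d x *\<^sub>R A)"
      unfolding c_def d_def by (intro sums_add sums_scaleR_left summable_sums sP sQ)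
    then have "(\<lambda>k. (1 / fact k) *\<^sub>R ((**) (x *\<^sub>R A) ^^ k) (mat 1)) sums (c x *\<^sub>R mat 1 + d x *\<^sub>R A)"
      by (simp add: matrix_power_quadratic[OF A] P_def Q_def scaleR_add_right mult_ac)
    then show "matrix_exp (x *\<^sub>R A) = c x *\<^sub>R mat 1 + d x *\<^sub>R A"
      unfolding matrix_exp_def by (rule sums_unique[symmetric])
    have "(c has_real_derivative (\<Sum>k. diffs P k * x ^ k)) (at x)"
      unfolding c_def by (rule termdiffs_strong_converges_everywhere[OF sP])
    moreover have "(\<Sum>k. diffs P k * x ^ k) = \<mu> * d x"
      unfolding dP d_def by (simp add: suminf_mult[OF sQ] mult.assoc)
    ultimately show "(c has_real_derivative \<mu> * d x) (at x)" by simp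
    have "(d has_real_derivative (\<Sum>k. diffs Q k * x ^ k)) (at x)"
      unfolding d_def by (rule termdiffs_strong_converges_everywhere[OF sQ])
    then show "(d has_real_derivative c x) (at x)" by (simp add: dQ c_def)
  qed (simp_all only: c_def d_def powser_zero, simp_all add: P_def Q_def)
qed

text \<open>
  With \<open>w = x + y\<close> held fixed, the right-hand sides at \<open>(z, w - z)\<close> have derivative \<open>0\<close> in \<open>z\<close>;
  compare \<open>z = x\<close> with \<open>z = 0\<close>.
\<close>
lemma quadratic_exp_addition:
  fixes c d :: "real \<Rightarrow> real"
  assumes c': "\<And>x. (c has_real_derivative \<mu> * d x) (at x)"
    and d': "\<And>x. (d has_real_derivative c x) (at x)"
    and 0: "c 0 = 1" "d 0 = 0"
  shows "c (x + y) = c x * c y + \<mu> * d x * d y" and "d (x + y) = c x * d y + d x * c y"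
proof -
  have reflect: "((\<lambda>z. x + y - z) has_real_derivative - 1) (at z)" for z
    by (auto intro!: derivative_eq_intros)
  have c2: "((\<lambda>z. c (x + y - z)) has_real_derivative - (\<mu> * d (x + y - z))) (at z)" for z
    using DERIV_chain2[OF c' reflect] by simp
  have d2: "((\<lambda>z. d (x + y - z)) has_real_derivative - c (x + y - z)) (at z)" for z
    using DERIV_chain2[OF d' reflect] by simp
  have "((\<lambda>z. c z * c (x + y - z) + \<mu> * d z * d (x + y - z)) has_real_derivative 0) (at z)" for z
    by (rule derivative_eq_intros c' d' c2 d2 refl)+ (simp add: algebra_simps)
  from DERIV_isconst_all[OF allI[OF this], of 0 x]
  show "c (x + y) = c x * c y + \<mu> * d x * d y" using 0 by simp
  have "((\<lambda>z. c z * d (x + y - z) + d z * c (x + y - z)) has_real_derivative 0) (at z)" for z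
    by (rule derivative_eq_intros c' d' c2 d2 refl)+ (simp add: algebra_simps)
  from DERIV_isconst_all[OF allI[OF this], of 0 x]
  show "d (x + y) = c x * d y + d x * c y" using 0 by simp
qed

text \<open>
  The properties of a kernel that make the increment of its Wiener integral at \<open>t\<close> equal to
  \<open>e \<bullet> (B (t + h) - B t)\<close> up to \<open>O(h)\<close>: on the past the kernel at \<open>t + h\<close> is a combination of the kernels
  at \<open>t\<close> and \<open>t + h0\<close>, close to the former; after \<open>t\<close> it is Lipschitz, with value \<open>e\<close> on the diagonal.
\<close>
definition regular_kernel :: "(real \<Rightarrow> real \<Rightarrow> 'b::euclidean_space) \<Rightarrow> 'b \<Rightarrow> real \<Rightarrow>
    real \<Rightarrow> real \<Rightarrow> real \<Rightarrow> bool" where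
  "regular_kernel k e t h0 C L \<longleftrightarrow> 0 < h0 \<and> 0 \<le> C \<and> 0 \<le> L \<and>
     (\<forall>h\<in>{0<..h0}. \<exists>a b. \<bar>a\<bar> \<le> C * h \<and> \<bar>b\<bar> \<le> C * h \<and>
        (\<forall>s\<in>{0<..t}. k (t + h) s - k t s = a *\<^sub>R k t s + b *\<^sub>R k (t + h0) s)) \<and>
     (\<forall>u\<in>{t..t + h0}. k u u = e) \<and>
     (\<forall>u\<in>{t..t + h0}. \<forall>r\<in>{t..u}. \<forall>s\<in>{t..u}. norm (k u r - k u s) \<le> L * \<bar>r - s\<bar>)"

lemma ln_lipschitz:
  fixes r s t :: real
  assumes "0 < t" "t \<le> r" "t \<le> s"
  shows "\<bar>ln r - ln s\<bar> \<le> \<bar>r - s\<bar> / t"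
proof -
  have "ln x - ln y \<le> \<bar>x - y\<bar> / t" if "t \<le> x" "t \<le> y" for x y
  proof -
    have "ln x - ln y \<le> (x - y) / y" using that assms by (intro ln_diff_le) auto
    also have "\<dots> \<le> \<bar>x - y\<bar> / y" using that assms by (intro divide_right_mono) auto
    also have "\<dots> \<le> \<bar>x - y\<bar> / t" using that assms by (intro divide_left_mono) auto
    finally show ?thesis .
  qed
  from this[of r s] this[of s r] show ?thesis using assms by (simp add: abs_minus_commute abs_le_iff)
qed

text \<open>
  As functions of \<open>s\<close>, the kernels at all times lie in a two-dimensional space, by the addition laws
  for \<open>c\<close> and \<open>d\<close>. The kernels at \<open>t\<close> and \<open>t + h0\<close> span it when \<open>d\<close> does not vanish at
  \<open>ln ((t + h0) / t)\<close>, which holds for small \<open>h0\<close> because \<open>d\<close> has derivative \<open>1\<close> at \<open>0\<close>. Solving for the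
  coefficients gives \<open>b = d y / d y0\<close> and \<open>a = c y - 1 - b c y0\<close> with \<open>y = ln ((t + h) / t)\<close>.
\<close>
lemma regular_kernel_quadratic:
  fixes c d :: "real \<Rightarrow> real" and e f :: "'b::euclidean_space"
  assumes c': "\<And>x. (c has_real_derivative \<mu> * d x) (at x)"
    and d': "\<And>x. (d has_real_derivative c x) (at x)"
    and 0: "c 0 = 1" "d 0 = 0" and t: "0 < t"
    and k: "\<And>u s. 0 < s \<Longrightarrow> 0 < u \<Longrightarrow> k u s = c (ln (u / s)) *\<^sub>R e + d (ln (u / s)) *\<^sub>R f"
  shows "\<exists>h0 C L. regular_kernel k e t h0 C L"
proof -
  note add = quadratic_exp_addition[OF c' d' 0]
  obtain \<delta> where \<delta>: "0 < \<delta>" "\<And>h. 0 < h \<Longrightarrow> h < \<delta> \<Longrightarrow> d 0 < d (0 + h)"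
    using DERIV_pos_inc_right[OF d'[of 0]] 0 by auto
  define y0 where "y0 = \<delta> / 2"
  have y0: "0 < y0" "0 < d y0" using \<delta>(1) \<delta>(2)[of y0] 0 by (auto simp: y0_def)
  have "continuous_on {0..y0} c" "continuous_on {0..y0} d"
    by (rule DERIV_continuous_on[OF has_field_derivative_at_within[OF c']]
        DERIV_continuous_on[OF has_field_derivative_at_within[OF d']])+
  then have "bounded (c ` {0..y0} \<union> d ` {0..y0})"
    by (intro bounded_Un[THEN iffD2] conjI compact_imp_bounded compact_continuous_image) auto
  then obtain m where m: "0 < m" "\<And>x. x \<in> {0..y0} \<Longrightarrow> \<bar>c x\<bar> \<le> m \<and> \<bar>d x\<bar> \<le> m"
    unfolding bounded_pos by auto
  define n where "n = max 1 \<bar>\<mu>\<bar> * m"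
  have n: "m \<le> n" "\<bar>\<mu>\<bar> * m \<le> n" "0 < n"
    using m(1) by (auto simp: n_def mult_le_cancel_right1 intro!: mult_right_mono mult_pos_pos)
  have lc: "\<bar>c x - c y\<bar> \<le> n * \<bar>x - y\<bar>" and ld: "\<bar>d x - d y\<bar> \<le> n * \<bar>x - y\<bar>"
    if "x \<in> {0..y0}" "y \<in> {0..y0}" for x y
  proof -
    have "\<bar>\<mu> * d z\<bar> \<le> n" if "z \<in> {0..y0}" for z
      using mult_left_mono[of "\<bar>d z\<bar>" m "\<bar>\<mu>\<bar>"] m(2)[OF that] n(2) by (simp add: abs_mult)
    then show "\<bar>c x - c y\<bar> \<le> n * \<bar>x - y\<bar>"
      using field_differentiable_bound[of "{0..y0}" c "\<lambda>z. \<mu> * d z" n x y] c' that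
      by (auto intro: has_field_derivative_at_within)
    show "\<bar>d x - d y\<bar> \<le> n * \<bar>x - y\<bar>"
    proof -
      have "norm (c z) \<le> n" if "z \<in> {0..y0}" for z using m(2)[OF that] n(1) by simp
      then show ?thesis
        using field_differentiable_bound[of "{0..y0}" d c n x y] d' that
        by (auto intro: has_field_derivative_at_within)
    qed
  qed
  define h0 where "h0 = t * (exp y0 - 1)"
  have h0: "0 < h0" using t y0 by (simp add: h0_def)
  have y0_eq: "ln ((t + h0) / t) = y0" using t by (simp add: h0_def field_simps)
  have ln_in: "ln (u / s) \<in> {0..y0}" if "u \<in> {t..t + h0}" "s \<in> {t..u}" for u s
  proof -
    have "1 \<le> u / s" using that t by simp
    moreover have "u / s \<le> (t + h0) / t" using that t by (intro frac_le) auto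
    ultimately have "ln (u / s) \<le> ln ((t + h0) / t)" "0 \<le> ln (u / s)"
      by (simp_all only: ln_ge_zero ln_mono)
    then show ?thesis using y0_eq by simp
  qed
  define C where "C = (n + (n * m + n) / d y0) / t"
  have C: "0 \<le> C" using n m t y0 by (simp add: C_def)
  define L where "L = n * (norm e + norm f) / t"
  have L: "0 \<le> L" using n t by (simp add: L_def)
  have rel: "\<exists>a b. \<bar>a\<bar> \<le> C * h \<and> \<bar>b\<bar> \<le> C * h \<and>
        (\<forall>s\<in>{0<..t}. k (t + h) s - k t s = a *\<^sub>R k t s + b *\<^sub>R k (t + h0) s)"
    if h: "h \<in> {0<..h0}" for h
  proof -
    define y where "y = ln ((t + h) / t)"
    have y: "y \<in> {0..y0}" unfolding y_def using h t by (intro ln_in) auto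
    have yh: "y \<le> h / t"
      using ln_add_one_self_le_self[of "h / t"] h t by (simp add: y_def add_divide_distrib)
    have dy: "\<bar>d y\<bar> \<le> n * (h / t)"
      using ld[OF y, of 0] y y0 0 mult_left_mono[OF yh, of n] n by simp
    have cy: "\<bar>c y - 1\<bar> \<le> n * (h / t)"
      using lc[OF y, of 0] y y0 0 mult_left_mono[OF yh, of n] n by simp
    define b where "b = d y / d y0"
    define a where "a = c y - 1 - b * c y0"
    have bb: "\<bar>b\<bar> \<le> n * (h / t) / d y0"
      using divide_right_mono[OF dy, of "d y0"] y0 by (simp add: b_def)
    have Ch: "C * h = n * (h / t) + n * (h / t) / d y0 * m + n * (h / t) / d y0"
      using t y0 by (simp add: C_def field_simps)
    have nn: "0 \<le> n * (h / t)" "0 \<le> n * (h / t) / d y0" "0 \<le> n * (h / t) / d y0 * m"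
      using n m t y0 h by auto
    have "\<bar>b * c y0\<bar> \<le> (n * (h / t) / d y0) * m"
      unfolding abs_mult using bb m(2)[of y0] y0 by (intro mult_mono) auto
    then have "\<bar>a\<bar> \<le> n * (h / t) + n * (h / t) / d y0 * m" using cy by (simp add: a_def)
    also have "\<dots> \<le> C * h" using nn unfolding Ch by linarith
    finally have A: "\<bar>a\<bar> \<le> C * h" .
    note bb
    also have "n * (h / t) / d y0 \<le> C * h" using nn unfolding Ch by linarith
    finally have B: "\<bar>b\<bar> \<le> C * h" .
    have "k (t + h) s - k t s = a *\<^sub>R k t s + b *\<^sub>R k (t + h0) s" if s: "s \<in> {0<..t}" for s
    proof -
      define x where "x = ln (t / s)"
      have 1: "ln ((t + h) / s) = x + y" and 2: "ln ((t + h0) / s) = x + y0"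
        unfolding x_def y_def y0_eq[symmetric] using s t h h0 by (auto simp: ln_div)
      have bd: "b * d y0 = d y" using y0 by (simp add: b_def)
      have "k (t + h) s = c (x + y) *\<^sub>R e + d (x + y) *\<^sub>R f"
        "k t s = c x *\<^sub>R e + d x *\<^sub>R f"
        "k (t + h0) s = c (x + y0) *\<^sub>R e + d (x + y0) *\<^sub>R f"
        using k[of s "t + h"] k[of s t] k[of s "t + h0"] s t h h0 1 2 by (auto simp: x_def)
      note k3 = this
      have c3: "c (x + y) - c x = a * c x + b * c (x + y0)"
        unfolding add a_def bd[symmetric] by (simp add: algebra_simps)
      have d3: "d (x + y) - d x = a * d x + b * d (x + y0)"
        unfolding add a_def bd[symmetric] by (simp add: algebra_simps)
      have "k (t + h) s - k t s = (c (x + y) - c x) *\<^sub>R e + (d (x + y) - d x) *\<^sub>R f"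
        unfolding k3 by (simp add: algebra_simps)
      also have "\<dots> = a *\<^sub>R k t s + b *\<^sub>R k (t + h0) s"
        unfolding c3 d3 k3 by (simp add: algebra_simps)
      finally show ?thesis .
    qed
    then show ?thesis using A B by blast
  qed
  have diag: "k u u = e" if "u \<in> {t..t + h0}" for u
    using k[of u u] that t 0 by simp
  have lip: "norm (k u r - k u s) \<le> L * \<bar>r - s\<bar>"
    if u: "u \<in> {t..t + h0}" and r: "r \<in> {t..u}" and s: "s \<in> {t..u}" for u r s
  proof -
    let ?x = "ln (u / r)" and ?y = "ln (u / s)"
    have xy: "\<bar>?x - ?y\<bar> \<le> \<bar>r - s\<bar> / t"
      using ln_lipschitz[of t s r] u r s t by (simp add: ln_div abs_minus_commute)
    have "k u r - k u s = (c ?x - c ?y) *\<^sub>R e + (d ?x - d ?y) *\<^sub>R f"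
      using k[of r u] k[of s u] u r s t by (simp add: algebra_simps)
    then have "norm (k u r - k u s) \<le> \<bar>c ?x - c ?y\<bar> * norm e + \<bar>d ?x - d ?y\<bar> * norm f"
      using norm_triangle_ineq[of "(c ?x - c ?y) *\<^sub>R e" "(d ?x - d ?y) *\<^sub>R f"] by simp
    also have "\<dots> \<le> (n * (\<bar>r - s\<bar> / t)) * norm e + (n * (\<bar>r - s\<bar> / t)) * norm f"
      using lc[OF ln_in[OF u r] ln_in[OF u s]] ld[OF ln_in[OF u r] ln_in[OF u s]]
        mult_left_mono[OF xy, of n] n by (intro add_mono mult_right_mono) auto
    also have "\<dots> = L * \<bar>r - s\<bar>" by (simp add: L_def algebra_simps add_divide_distrib)
    finally show ?thesis .
  qed
  show ?thesis
    unfolding regular_kernel_def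
    by (intro exI[of _ h0] exI[of _ C] exI[of _ L] conjI h0 C L ballI rel diag lip)
qed

text \<open>
  Here all kernels are multiples of the kernel at \<open>t\<close>, so \<open>b = 0\<close> and any \<open>h0\<close> will do.
\<close>
lemma regular_kernel_powr:
  assumes t: "0 < t" and \<alpha>: "0 \<le> \<alpha>"
  shows "regular_kernel (\<lambda>u s. (u / s) powr (- \<alpha>) :: real) 1 t 1 (\<alpha> / t) (\<alpha> / t)"
proof -
  have lx: "\<bar>exp (- \<alpha> * x) - exp (- \<alpha> * y)\<bar> \<le> \<alpha> * \<bar>x - y\<bar>" if "0 \<le> x" "0 \<le> y" for x y :: real
  proof -
    have "norm (exp (- \<alpha> * x) - exp (- \<alpha> * y)) \<le> \<alpha> * norm (x - y)"
    proof (rule field_differentiable_bound[of "{0..}" _ "\<lambda>z. - \<alpha> * exp (- \<alpha> * z)"])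
      show "((\<lambda>z. exp (- \<alpha> * z)) has_field_derivative - \<alpha> * exp (- \<alpha> * z)) (at z within {0..})" for z
        by (auto intro!: derivative_eq_intros)
      show "norm (- \<alpha> * exp (- \<alpha> * z)) \<le> \<alpha>" if "z \<in> {0..}" for z
        using that \<alpha> mult_left_mono[of "exp (- (\<alpha> * z))" 1 \<alpha>] by (simp add: abs_mult)
    qed (use that in auto)
    then show ?thesis by simp
  qed
  have k: "(u / s) powr (- \<alpha>) = exp (- \<alpha> * ln (u / s))" if "0 < u" "0 < s" for u s :: real
    using that by (simp add: powr_def)
  have rel: "\<exists>a b. \<bar>a\<bar> \<le> (\<alpha> / t) * h \<and> \<bar>b\<bar> \<le> (\<alpha> / t) * h \<and>
        (\<forall>s\<in>{0<..t}. ((t + h) / s) powr (- \<alpha>) - (t / s) powr (- \<alpha>)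
          = a *\<^sub>R (t / s) powr (- \<alpha>) + b *\<^sub>R ((t + 1) / s) powr (- \<alpha>))"
    if h: "h \<in> {0<..1}" for h
  proof -
    have l: "0 \<le> ln ((t + h) / t)" "ln ((t + h) / t) \<le> h / t"
      using ln_add_one_self_le_self[of "h / t"] h t by (auto simp: add_divide_distrib)
    have "\<bar>((t + h) / t) powr (- \<alpha>) - 1\<bar> \<le> \<alpha> * ln ((t + h) / t)"
      using lx[of "ln ((t + h) / t)" 0] l h t by (simp add: k)
    also have "\<dots> \<le> \<alpha> * (h / t)" by (intro mult_left_mono l \<alpha>)
    finally have "\<bar>((t + h) / t) powr (- \<alpha>) - 1\<bar> \<le> (\<alpha> / t) * h" by simp
    moreover have "((t + h) / s) powr (- \<alpha>) - (t / s) powr (- \<alpha>)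
        = (((t + h) / t) powr (- \<alpha>) - 1) *\<^sub>R (t / s) powr (- \<alpha>) + 0 *\<^sub>R ((t + 1) / s) powr (- \<alpha>)"
      if s: "s \<in> {0<..t}" for s
    proof -
      have "((t + h) / s) powr (- \<alpha>) = ((t + h) / t * (t / s)) powr (- \<alpha>)" using t by simp
      also have "\<dots> = ((t + h) / t) powr (- \<alpha>) * (t / s) powr (- \<alpha>)"
        by (rule powr_mult)
      finally show ?thesis by (simp add: left_diff_distrib)
    qed
    moreover have "\<bar>0\<bar> \<le> (\<alpha> / t) * h" using h t \<alpha> by simp
    ultimately show ?thesis by blast
  qed
  have lip: "norm ((u / r) powr (- \<alpha>) - (u / s) powr (- \<alpha>)) \<le> (\<alpha> / t) * \<bar>r - s\<bar>"
    if "u \<in> {t..t + 1}" "r \<in> {t..u}" "s \<in> {t..u}" for u r s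
  proof -
    have "\<bar>(u / r) powr (- \<alpha>) - (u / s) powr (- \<alpha>)\<bar> \<le> \<alpha> * \<bar>ln (u / r) - ln (u / s)\<bar>"
      using lx[of "ln (u / r)" "ln (u / s)"] that t by (simp add: k)
    also have "\<dots> \<le> \<alpha> * (\<bar>r - s\<bar> / t)"
      using ln_lipschitz[of t s r] that t by (intro mult_left_mono \<alpha>) (simp add: ln_div abs_minus_commute)
    finally show ?thesis by simp
  qed
  show ?thesis
    unfolding regular_kernel_def
    by (intro conjI ballI rel lip) (use t \<alpha> in auto)
qed

section \<open>The law of the iterated logarithm for the process\<close>

text \<open>
  The factor \<open>R\<close> is random but the same for all \<open>h\<close>. The exceptional null set may depend on \<open>h\<close>.
\<close>
lemma wiener_increment_linear_error:
  fixes B :: "real \<Rightarrow> 'a \<Rightarrow> 'b::euclidean_space"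
  assumes orth: "orthonormal_increments M B"
    and cont: "AE \<omega> in M. continuous_on {0..} (\<lambda>t. B t \<omega>)"
    and V: "\<And>u. 0 < u \<Longrightarrow> has_wiener_integral M B u (k u) (V u)"
    and t: "0 < t" and reg: "regular_kernel k e t h0 C L"
  obtains R where "\<And>h. h \<in> {0<..h0} \<Longrightarrow>
      AE \<omega> in M. \<bar>V (t + h) \<omega> - V t \<omega> - e \<bullet> (B (t + h) \<omega> - B t \<omega>)\<bar> \<le> R \<omega> * h"
proof -
  have h0: "0 < h0" and C: "0 \<le> C" and L: "0 \<le> L"
    and rel: "\<forall>h\<in>{0<..h0}. \<exists>a b. \<bar>a\<bar> \<le> C * h \<and> \<bar>b\<bar> \<le> C * h \<and>
        (\<forall>s\<in>{0<..t}. k (t + h) s - k t s = a *\<^sub>R k t s + b *\<^sub>R k (t + h0) s)"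
    and diag: "\<forall>u\<in>{t..t + h0}. k u u = e"
    and lip: "\<forall>u\<in>{t..t + h0}. \<forall>r\<in>{t..u}. \<forall>s\<in>{t..u}. norm (k u r - k u s) \<le> L * \<bar>r - s\<bar>"
    using reg unfolding regular_kernel_def by - (elim conjE, assumption)+
  define K where "K \<omega> = (SOME K. \<forall>s\<in>{t..t + h0}. norm (B s \<omega> - B t \<omega>) \<le> K)" for \<omega>
  have K: "AE \<omega> in M. \<forall>s\<in>{t..t + h0}. norm (B s \<omega> - B t \<omega>) \<le> K \<omega>"
    using cont
  proof eventually_elim
    fix \<omega> assume "continuous_on {0..} (\<lambda>t. B t \<omega>)"
    then have "continuous_on {t..t + h0} (\<lambda>s. B s \<omega>)"
      by (rule continuous_on_subset) (use t in auto)
    then have "continuous_on {t..t + h0} (\<lambda>s. B s \<omega> - B t \<omega>)"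
      by (intro continuous_intros)
    then have "bounded ((\<lambda>s. B s \<omega> - B t \<omega>) ` {t..t + h0})"
      by (intro compact_imp_bounded compact_continuous_image) auto
    then have "\<exists>K. \<forall>s\<in>{t..t + h0}. norm (B s \<omega> - B t \<omega>) \<le> K"
      unfolding bounded_iff by auto
    then show "\<forall>s\<in>{t..t + h0}. norm (B s \<omega> - B t \<omega>) \<le> K \<omega>"
      unfolding K_def by (rule someI_ex)
  qed
  define D where "D \<omega> = \<bar>V (t + h0) \<omega>\<bar> + \<bar>e \<bullet> (B (t + h0) \<omega> - B t \<omega>)\<bar> + L * h0 * K \<omega>" for \<omega>
  show thesis
  proof
    fix h assume h: "h \<in> {0<..h0}"
    from bspec[OF rel h] obtain a b where "\<bar>a\<bar> \<le> C * h \<and> \<bar>b\<bar> \<le> C * h \<and>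
        (\<forall>s\<in>{0<..t}. k (t + h) s - k t s = a *\<^sub>R k t s + b *\<^sub>R k (t + h0) s)"
      by (elim exE)
    then have a: "\<bar>a\<bar> \<le> C * h" and b: "\<bar>b\<bar> \<le> C * h"
      and ab: "\<And>s. s \<in> {0<..t} \<Longrightarrow> k (t + h) s - k t s = a *\<^sub>R k t s + b *\<^sub>R k (t + h0) s"
      by simp_all
    have "AE \<omega> in M. \<bar>V (t + h) \<omega> - V t \<omega> - e \<bullet> (B (t + h) \<omega> - B t \<omega>)\<bar>
        \<le> \<bar>a\<bar> * \<bar>V t \<omega>\<bar> + \<bar>b\<bar> * D \<omega> + L * h * K \<omega>"
      unfolding D_def
      by (rule wiener_increment_bound[OF orth t _ _ V ab _ L _ K]) (use h diag lip in auto)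
    then show "AE \<omega> in M. \<bar>V (t + h) \<omega> - V t \<omega> - e \<bullet> (B (t + h) \<omega> - B t \<omega>)\<bar>
        \<le> (C * \<bar>V t \<omega>\<bar> + C * D \<omega> + L * K \<omega>) * h"
      using K
    proof eventually_elim
      fix \<omega> assume *: "\<bar>V (t + h) \<omega> - V t \<omega> - e \<bullet> (B (t + h) \<omega> - B t \<omega>)\<bar>
          \<le> \<bar>a\<bar> * \<bar>V t \<omega>\<bar> + \<bar>b\<bar> * D \<omega> + L * h * K \<omega>"
        and K\<omega>: "\<forall>s\<in>{t..t + h0}. norm (B s \<omega> - B t \<omega>) \<le> K \<omega>"
      have "0 \<le> K \<omega>" using K\<omega>[rule_format, of t] h0 by simp
      then have D0: "0 \<le> D \<omega>" using L h0 by (simp add: D_def)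
      have "\<bar>a\<bar> * \<bar>V t \<omega>\<bar> \<le> C * h * \<bar>V t \<omega>\<bar>" using a by (rule mult_right_mono) simp
      moreover have "\<bar>b\<bar> * D \<omega> \<le> C * h * D \<omega>" using b D0 by (rule mult_right_mono)
      ultimately show "\<bar>V (t + h) \<omega> - V t \<omega> - e \<bullet> (B (t + h) \<omega> - B t \<omega>)\<bar>
          \<le> (C * \<bar>V t \<omega>\<bar> + C * D \<omega> + L * K \<omega>) * h"
        using * by (simp add: algebra_simps)
    qed
  qed
qed

lemma continuous_le_0_of_rationals:
  fixes g :: "real \<Rightarrow> real"
  assumes cont: "continuous_on {0..h0} g" and rat: "\<And>q. q \<in> \<rat> \<Longrightarrow> q \<in> {0<..h0} \<Longrightarrow> g q \<le> 0"
    and h: "h \<in> {0<..h0}"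
  shows "g h \<le> 0"
proof -
  have "\<exists>q\<in>\<rat>. h - h / real (n + 2) < q \<and> q < h" for n
    using h by (intro Rats_dense_in_real) (simp add: field_simps)
  then obtain q where q: "\<And>n. q n \<in> \<rat>" "\<And>n. h - h / real (n + 2) < q n" "\<And>n. q n < h"
    by metis
  have q0: "q n \<in> {0<..h0}" for n
  proof -
    have "0 \<le> h - h / real (n + 2)" using h by (simp add: field_simps)
    then show ?thesis using q(2)[of n] q(3)[of n] h by auto
  qed
  have lim: "q \<longlonglongrightarrow> h"
  proof (rule tendsto_sandwich[where h="\<lambda>n. h" and f="\<lambda>n. h - h / real (n + 2)"])
    have "(\<lambda>n. h - h * (1 / real (n + 2))) \<longlonglongrightarrow> h - h * 0"
      by (intro tendsto_intros LIMSEQ_ignore_initial_segment[OF lim_1_over_n])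
    then show "(\<lambda>n. h - h / real (n + 2)) \<longlonglongrightarrow> h" by simp
  qed (use q in \<open>auto intro!: always_eventually less_imp_le\<close>)
  have "(\<lambda>n. g (q n)) \<longlonglongrightarrow> g h"
    by (rule continuous_on_tendsto_compose[OF cont lim])
       (use q0 h in \<open>auto intro!: always_eventually simp: less_imp_le\<close>)
  then show ?thesis by (rule LIMSEQ_le_const2) (use rat[OF q(1) q0] in auto)
qed

lemma Limsup_ereal_eqI:
  fixes X :: "'a \<Rightarrow> real"
  assumes up: "\<And>\<epsilon>. 0 < \<epsilon> \<Longrightarrow> \<forall>\<^sub>F x in F. X x \<le> l + \<epsilon>"
    and low: "\<And>\<epsilon>. 0 < \<epsilon> \<Longrightarrow> \<exists>\<^sub>F x in F. l - \<epsilon> \<le> X x"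
  shows "Limsup F (\<lambda>x. ereal (X x)) = ereal l"
proof (rule antisym)
  show "Limsup F (\<lambda>x. ereal (X x)) \<le> ereal l"
  proof (rule ereal_le_epsilon2)
    fix \<epsilon> :: real assume "0 < \<epsilon>"
    then show "Limsup F (\<lambda>x. ereal (X x)) \<le> ereal l + ereal \<epsilon>"
      using up[of \<epsilon>] by (intro Limsup_bounded) (simp add: plus_ereal.simps)
  qed
  show "ereal l \<le> Limsup F (\<lambda>x. ereal (X x))"
  proof (rule ccontr)
    assume "\<not> ereal l \<le> Limsup F (\<lambda>x. ereal (X x))"
    then have "Limsup F (\<lambda>x. ereal (X x)) < ereal l" by simp
    then obtain y where y: "Limsup F (\<lambda>x. ereal (X x)) < ereal y" "ereal y < ereal l"
      using ereal_dense2 by blast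
    from Limsup_lessD[OF y(1)] have "\<forall>\<^sub>F x in F. X x < y" by simp
    with frequently_eventually_conj[OF low[of "l - y"]] y(2)
    have "\<exists>\<^sub>F x in F. X x < y \<and> l - (l - y) \<le> X x" by auto
    then show False by (auto dest: frequently_ex)
  qed
qed

text \<open>
  Each \<open>h\<close> has its own null set in the assumption. For rational \<open>h\<close> they can be collected into one,
  and continuity of the paths then gives the bound for all \<open>h\<close> simultaneously. After division by
  \<open>sqrt 2 lil_scale h\<close> the error tends to \<open>0\<close>.
\<close>
lemma lil_of_linear_error:
  assumes bm: "brownian_motion M W" and t: "0 \<le> t"
    and contV: "AE \<omega> in M. continuous_on {0..} (\<lambda>t. V t \<omega>)"
    and h0: "0 < h0"
    and err: "\<And>h. h \<in> {0<..h0} \<Longrightarrow> AE \<omega> in M. \<bar>V (t + h) \<omega> - V t \<omega> - sqrt 2 * W h \<omega>\<bar> \<le> R \<omega> * h"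
    and \<sigma>: "\<sigma> \<in> {1, -1 :: real}"
  shows "AE \<omega> in M. Limsup (at_right 0)
           (\<lambda>h. ereal (\<sigma> * ((V (t + h) \<omega> - V t \<omega>) / sqrt (4 * h * ln (ln (1 / h)))))) = 1"
proof -
  have bm\<sigma>: "brownian_motion M (\<lambda>h \<omega>. \<sigma> * W h \<omega>)"
    using \<sigma> bm brownian_motion_uminus[OF bm] by auto
  have up: "AE \<omega> in M. \<forall>n::nat. \<forall>\<^sub>F h in at_right 0. \<sigma> * W h \<omega> \<le> (1 + 1 / real (n + 2)) * lil_scale h"
    unfolding AE_all_countable by (intro allI brownian_LIL_upper[OF bm\<sigma>]) simp
  have low: "AE \<omega> in M. \<forall>n::nat. \<exists>\<^sub>F h in at_right 0. (1 - 1 / real (n + 2)) * lil_scale h \<le> \<sigma> * W h \<omega>"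
    unfolding AE_all_countable by (intro allI brownian_LIL_lower[OF bm\<sigma>]) auto
  have rat: "AE \<omega> in M. \<forall>q\<in>\<rat> \<inter> {0<..h0}. \<bar>V (t + q) \<omega> - V t \<omega> - sqrt 2 * W q \<omega>\<bar> \<le> R \<omega> * q"
    using err by (subst AE_ball_countable) (auto intro: countable_subset[OF _ countable_rat])
  show ?thesis
    using up low rat contV brownian_motionD(6)[OF bm]
  proof eventually_elim
    fix \<omega>
    assume up: "\<forall>n::nat. \<forall>\<^sub>F h in at_right 0. \<sigma> * W h \<omega> \<le> (1 + 1 / real (n + 2)) * lil_scale h"
      and low: "\<forall>n::nat. \<exists>\<^sub>F h in at_right 0. (1 - 1 / real (n + 2)) * lil_scale h \<le> \<sigma> * W h \<omega>"
      and rat: "\<forall>q\<in>\<rat> \<inter> {0<..h0}. \<bar>V (t + q) \<omega> - V t \<omega> - sqrt 2 * W q \<omega>\<bar> \<le> R \<omega> * q"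
      and cV: "continuous_on {0..} (\<lambda>t. V t \<omega>)" and cW: "continuous_on {0..} (\<lambda>t. W t \<omega>)"
    have err0: "\<bar>V (t + h) \<omega> - V t \<omega> - sqrt 2 * W h \<omega>\<bar> - R \<omega> * h \<le> 0" if "h \<in> {0<..h0}" for h
    proof (rule continuous_le_0_of_rationals[OF _ _ that])
      have "continuous_on {0..h0} (\<lambda>h. V (t + h) \<omega>)"
        by (rule continuous_on_compose2[OF cV]) (use t in \<open>auto intro!: continuous_intros\<close>)
      then show "continuous_on {0..h0} (\<lambda>h. \<bar>V (t + h) \<omega> - V t \<omega> - sqrt 2 * W h \<omega>\<bar> - R \<omega> * h)"
        by (intro continuous_intros continuous_on_subset[OF cW]) auto
    qed (use rat in auto)
    have R: "\<bar>V (t + h) \<omega> - V t \<omega> - sqrt 2 * W h \<omega>\<bar> \<le> \<bar>R \<omega>\<bar> * h" if "h \<in> {0<..h0}" for h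
    proof -
      have "R \<omega> * h \<le> \<bar>R \<omega>\<bar> * h" using that by (intro mult_right_mono) auto
      then show ?thesis using err0[OF that] by linarith
    qed
    define Y where "Y h = \<sigma> * ((V (t + h) \<omega> - V t \<omega>) / sqrt (4 * h * ln (ln (1 / h))))" for h
    define \<rho> where "\<rho> h = \<bar>R \<omega>\<bar> * (h / (sqrt 2 * lil_scale h))" for h
    have "((\<lambda>h::real. h / sqrt (2 * h * ln (ln (1 / h)))) \<longlongrightarrow> 0) (at_right 0)"
      by real_asymp
    then have "((\<lambda>h. \<bar>R \<omega>\<bar> * (1 / sqrt 2 * (h / lil_scale h))) \<longlongrightarrow> \<bar>R \<omega>\<bar> * (1 / sqrt 2 * 0)) (at_right 0)"
      unfolding lil_scale_def by (intro tendsto_intros)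
    then have \<rho>0: "(\<rho> \<longlongrightarrow> 0) (at_right 0)" by (simp add: \<rho>_def[abs_def])
    have "\<forall>\<^sub>F h::real in at_right 0. 0 < 2 * h * ln (ln (1 / h))" by real_asymp
    then have pos: "\<forall>\<^sub>F h in at_right 0. 0 < lil_scale h"
      unfolding lil_scale_def by eventually_elim simp
    have small: "\<forall>\<^sub>F h in at_right 0. h \<in> {0<..<h0}"
      using h0 by (intro eventually_at_right_real)
    have Y: "\<forall>\<^sub>F h in at_right 0. \<bar>Y h - \<sigma> * W h \<omega> / lil_scale h\<bar> \<le> \<rho> h"
      using pos small
    proof eventually_elim
      fix h assume p: "0 < lil_scale h" and h: "h \<in> {0<..<h0}"
      have "4 * h * ln (ln (1 / h)) = 2 * (2 * h * ln (ln (1 / h)))" by simp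
      then have sq: "sqrt (4 * h * ln (ln (1 / h))) = sqrt 2 * lil_scale h"
        unfolding lil_scale_def by (simp only: real_sqrt_mult)
      have "Y h - \<sigma> * W h \<omega> / lil_scale h = \<sigma> * (V (t + h) \<omega> - V t \<omega> - sqrt 2 * W h \<omega>) / (sqrt 2 * lil_scale h)"
        using p by (simp add: Y_def sq diff_divide_distrib right_diff_distrib)
      then have "\<bar>Y h - \<sigma> * W h \<omega> / lil_scale h\<bar> = \<bar>V (t + h) \<omega> - V t \<omega> - sqrt 2 * W h \<omega>\<bar> / (sqrt 2 * lil_scale h)"
        using p \<sigma> by (auto simp: abs_mult)
      also have "\<dots> \<le> \<bar>R \<omega>\<bar> * h / (sqrt 2 * lil_scale h)"
        using p h by (intro divide_right_mono R) auto
      finally show "\<bar>Y h - \<sigma> * W h \<omega> / lil_scale h\<bar> \<le> \<rho> h" by (simp add: \<rho>_def)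
    qed
    have "Limsup (at_right 0) (\<lambda>h. ereal (Y h)) = ereal 1"
    proof (rule Limsup_ereal_eqI)
      fix \<epsilon> :: real assume \<epsilon>: "0 < \<epsilon>"
      obtain n :: nat where "inverse (of_nat (Suc n)) < \<epsilon> / 2"
        using reals_Archimedean[of "\<epsilon> / 2"] \<epsilon> by auto
      moreover have "1 / real (n + 2) \<le> inverse (of_nat (Suc n))" by (simp add: field_simps)
      ultimately have n: "1 / real (n + 2) < \<epsilon> / 2" by linarith
      have \<rho>\<epsilon>: "\<forall>\<^sub>F h in at_right 0. \<rho> h < \<epsilon> / 2"
        using \<rho>0 \<epsilon> by (intro order_tendstoD(2)[OF \<rho>0]) auto
      show "\<forall>\<^sub>F h in at_right 0. Y h \<le> 1 + \<epsilon>"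
        using up[rule_format, of n] pos Y \<rho>\<epsilon>
      proof eventually_elim
        fix h assume u: "\<sigma> * W h \<omega> \<le> (1 + 1 / real (n + 2)) * lil_scale h" and p: "0 < lil_scale h"
          and y: "\<bar>Y h - \<sigma> * W h \<omega> / lil_scale h\<bar> \<le> \<rho> h" and r: "\<rho> h < \<epsilon> / 2"
        have "\<sigma> * W h \<omega> / lil_scale h \<le> 1 + 1 / real (n + 2)"
          using u p by (simp only: pos_divide_le_eq)
        then show "Y h \<le> 1 + \<epsilon>" using y r n by linarith
      qed
      have "\<exists>\<^sub>F h in at_right 0. (0 < lil_scale h \<and> \<bar>Y h - \<sigma> * W h \<omega> / lil_scale h\<bar> \<le> \<rho> h \<and> \<rho> h < \<epsilon> / 2) \<and>
          (1 - 1 / real (n + 2)) * lil_scale h \<le> \<sigma> * W h \<omega>"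
        by (rule frequently_eventually_conj[OF low[rule_format, of n] eventually_conj[OF pos eventually_conj[OF Y \<rho>\<epsilon>]]])
      then show "\<exists>\<^sub>F h in at_right 0. 1 - \<epsilon> \<le> Y h"
      proof (rule frequently_elim1)
        fix h assume *: "(0 < lil_scale h \<and> \<bar>Y h - \<sigma> * W h \<omega> / lil_scale h\<bar> \<le> \<rho> h \<and> \<rho> h < \<epsilon> / 2) \<and>
          (1 - 1 / real (n + 2)) * lil_scale h \<le> \<sigma> * W h \<omega>"
        then have "1 - 1 / real (n + 2) \<le> \<sigma> * W h \<omega> / lil_scale h"
          by (simp only: pos_le_divide_eq)
        then show "1 - \<epsilon> \<le> Y h" using * n by linarith
      qed
    qed
    then show "Limsup (at_right 0)
        (\<lambda>h. ereal (\<sigma> * ((V (t + h) \<omega> - V t \<omega>) / sqrt (4 * h * ln (ln (1 / h)))))) = 1"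
      unfolding Y_def by (simp add: one_ereal_def)
  qed
qed

lemma vector_matrix_mult_quadratic:
  fixes v :: "real^'n" and A :: "real^'n^'n"
  shows "v v* (c *\<^sub>R mat 1 + d *\<^sub>R A) = c *\<^sub>R v + d *\<^sub>R (v v* A)"
proof -
  have "v v* (c *\<^sub>R mat 1 + d *\<^sub>R A) = c *\<^sub>R (v v* mat 1) + d *\<^sub>R (v v* A)"
    by (simp add: vec_eq_iff vector_matrix_mult_def distrib_left sum.distrib sum_distrib_left mult_ac)
  then show ?thesis by simp
qed

lemma A_mat_square: "A_mat \<alpha>\<^sub>1 \<alpha>\<^sub>2 ** A_mat \<alpha>\<^sub>1 \<alpha>\<^sub>2 = (\<alpha>\<^sub>1 * \<alpha>\<^sub>2) *\<^sub>R mat 1"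
  by (simp add: vec_eq_iff A_mat_def matrix_matrix_mult_def sum_2 forall_2 mat_def mult.commute)

lemma norm_e_vec: "norm e_vec = sqrt 2"
  by (simp add: e_vec_def norm_vec_def L2_set_def sum_2)

lemma regular_kernel_matrix:
  assumes t: "0 < t"
  shows "\<exists>h0 C L. regular_kernel (\<lambda>u s. e_vec v* powr_matrix (u / s) (A_mat \<alpha>\<^sub>1 \<alpha>\<^sub>2)) e_vec t h0 C L"
proof -
  obtain c d :: "real \<Rightarrow> real"
    where mx: "\<And>x. matrix_exp (x *\<^sub>R A_mat \<alpha>\<^sub>1 \<alpha>\<^sub>2) = c x *\<^sub>R mat 1 + d x *\<^sub>R A_mat \<alpha>\<^sub>1 \<alpha>\<^sub>2"
      and c': "\<And>x. (c has_real_derivative (\<alpha>\<^sub>1 * \<alpha>\<^sub>2) * d x) (at x)"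
      and d': "\<And>x. (d has_real_derivative c x) (at x)"
      and 0: "c 0 = 1" "d 0 = 0"
    using matrix_exp_quadratic[OF A_mat_square] by metis
  show ?thesis
    by (rule regular_kernel_quadratic[OF c' d' 0 t, of _ e_vec "e_vec v* A_mat \<alpha>\<^sub>1 \<alpha>\<^sub>2"])
       (simp add: powr_matrix_def mx vector_matrix_mult_quadratic)
qed

theorem proposition5p6:
  fixes M :: "'a measure" and V :: "real \<Rightarrow> 'a \<Rightarrow> real" and \<alpha>\<^sub>1 \<alpha>\<^sub>2 t \<sigma> :: real
  assumes "prob_space M"
    and "\<alpha>\<^sub>1 \<in> {-1..1}" and "\<alpha>\<^sub>2 \<in> {-1..1}"
    and "\<alpha>\<^sub>1 * \<alpha>\<^sub>2 < 1/4 \<or> (\<alpha>\<^sub>1 = \<alpha>\<^sub>2 \<and> \<alpha>\<^sub>1 \<in> {1/2..<1})"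
    and "V_process M \<alpha>\<^sub>1 \<alpha>\<^sub>2 V"
    and "t > 0"
    and "\<sigma> \<in> {1, -1}"
  shows "AE \<omega> in M. Limsup (at_right 0)
           (\<lambda>h. ereal (\<sigma> * ((V (t + h) \<omega> - V t \<omega>) / sqrt (4 * h * ln (ln (1 / h)))))) = 1"
proof -
  have contV: "AE \<omega> in M. continuous_on {0..} (\<lambda>t. V t \<omega>)"
    using assms(5) by (simp add: V_process_def)
  show ?thesis
    using assms(4)
  proof
    assume "\<alpha>\<^sub>1 * \<alpha>\<^sub>2 < 1/4"
    then obtain B where bv: "brownian_motion_vec M B" and V: "V_repr_a M \<alpha>\<^sub>1 \<alpha>\<^sub>2 B V"
      using assms(5) by (auto simp: V_process_def)
    have "AE \<omega> in M. \<forall>i. continuous_on {0..} (\<lambda>t. B t \<omega> $ i)"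
      using brownian_motionD(6)[OF brownian_motion_vecD(1)[OF bv]] by (subst AE_all_countable) auto
    then have contB: "AE \<omega> in M. continuous_on {0..} (\<lambda>t. B t \<omega>)"
    proof eventually_elim
      fix \<omega> assume "\<forall>i. continuous_on {0..} (\<lambda>t. B t \<omega> $ i)"
      then have "continuous_on {0..} (\<lambda>t. \<chi> i. B t \<omega> $ i)" by (intro continuous_on_vec_lambda) auto
      then show "continuous_on {0..} (\<lambda>t. B t \<omega>)" by simp
    qed
    obtain h0 C L where reg: "regular_kernel (\<lambda>u s. e_vec v* powr_matrix (u / s) (A_mat \<alpha>\<^sub>1 \<alpha>\<^sub>2)) e_vec t h0 C L"
      using regular_kernel_matrix[OF \<open>t > 0\<close>] by blast
    then have h0: "0 < h0" by (simp add: regular_kernel_def)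
    obtain R where err: "\<And>h. h \<in> {0<..h0} \<Longrightarrow>
        AE \<omega> in M. \<bar>V (t + h) \<omega> - V t \<omega> - e_vec \<bullet> (B (t + h) \<omega> - B t \<omega>)\<bar> \<le> R \<omega> * h"
      using wiener_increment_linear_error[OF orthonormal_increments_brownian_motion_vec[OF bv] contB
          V[unfolded V_repr_a_def, rule_format] \<open>t > 0\<close> reg]
      by blast
    \<comment> \<open>\<open>e_vec\<close> has length \<open>sqrt 2\<close>, so its multiple of length \<open>1\<close> carries the factor \<open>sqrt 2\<close>.\<close>
    define e where "e = (1 / sqrt 2) *\<^sub>R e_vec"
    have "norm e = 1" by (simp add: e_def norm_e_vec)
    then have bm: "brownian_motion M (\<lambda>h \<omega>. e \<bullet> B (t + h) \<omega> - e \<bullet> B t \<omega>)"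
      using \<open>t > 0\<close> by (intro brownian_motion_shift brownian_motion_inner[OF bv]) auto
    have "sqrt 2 * (e \<bullet> B (t + h) \<omega> - e \<bullet> B t \<omega>) = e_vec \<bullet> (B (t + h) \<omega> - B t \<omega>)" for h \<omega>
      by (simp add: e_def inner_diff_right right_diff_distrib)
    then show ?thesis
      using err \<open>t > 0\<close> by (intro lil_of_linear_error[OF bm _ contV h0 _ assms(7), where R=R]) auto
  next
    assume \<alpha>: "\<alpha>\<^sub>1 = \<alpha>\<^sub>2 \<and> \<alpha>\<^sub>1 \<in> {1/2..<1}"
    then obtain W where bm: "brownian_motion M W" and V: "V_repr_b M \<alpha>\<^sub>1 W V"
      using assms(5) by (auto simp: V_process_def)
    \<comment> \<open>The integrals are chosen for each time separately; continuity of the paths is known for \<open>V\<close> alone.\<close>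
    have "\<exists>I. 0 < u \<longrightarrow> has_wiener_integral M W u (\<lambda>s. (u / s) powr (- \<alpha>\<^sub>1)) I \<and>
        (AE \<omega> in M. V u \<omega> = sqrt 2 * I \<omega>)" for u
      using V unfolding V_repr_b_def by blast
    from choice[OF allI[OF this]] obtain I where
      I: "\<forall>u. 0 < u \<longrightarrow> has_wiener_integral M W u (\<lambda>s. (u / s) powr (- \<alpha>\<^sub>1)) (I u) \<and>
        (AE \<omega> in M. V u \<omega> = sqrt 2 * I u \<omega>)" ..
    have "0 \<le> \<alpha>\<^sub>1" using \<alpha> by simp
    obtain R where err: "\<And>h. h \<in> {0<..1} \<Longrightarrow>
        AE \<omega> in M. \<bar>I (t + h) \<omega> - I t \<omega> - 1 \<bullet> (W (t + h) \<omega> - W t \<omega>)\<bar> \<le> R \<omega> * h"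
      using wiener_increment_linear_error[OF orthonormal_increments_brownian_motion[OF bm]
          brownian_motionD(6)[OF bm] _ \<open>t > 0\<close> regular_kernel_powr[OF \<open>t > 0\<close> \<open>0 \<le> \<alpha>\<^sub>1\<close>], of I] I
      by blast
    have "AE \<omega> in M. \<bar>V (t + h) \<omega> - V t \<omega> - sqrt 2 * (W (t + h) \<omega> - W t \<omega>)\<bar> \<le> (sqrt 2 * R \<omega>) * h"
      if h: "h \<in> {0<..1}" for h
    proof -
      have "AE \<omega> in M. V (t + h) \<omega> = sqrt 2 * I (t + h) \<omega>" "AE \<omega> in M. V t \<omega> = sqrt 2 * I t \<omega>"
        using I \<open>t > 0\<close> h by auto
      then show ?thesis
        using err[OF h]
      proof eventually_elim
        fix \<omega>
        assume *: "V (t + h) \<omega> = sqrt 2 * I (t + h) \<omega>" "V t \<omega> = sqrt 2 * I t \<omega>"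
          "\<bar>I (t + h) \<omega> - I t \<omega> - 1 \<bullet> (W (t + h) \<omega> - W t \<omega>)\<bar> \<le> R \<omega> * h"
        have "V (t + h) \<omega> - V t \<omega> - sqrt 2 * (W (t + h) \<omega> - W t \<omega>)
            = sqrt 2 * (I (t + h) \<omega> - I t \<omega> - 1 \<bullet> (W (t + h) \<omega> - W t \<omega>))"
          by (simp add: * right_diff_distrib)
        then show "\<bar>V (t + h) \<omega> - V t \<omega> - sqrt 2 * (W (t + h) \<omega> - W t \<omega>)\<bar> \<le> (sqrt 2 * R \<omega>) * h"
          using mult_left_mono[OF *(3), of "sqrt 2"] by (simp only: abs_mult) simp
      qed
    qed
    then show ?thesis
      using \<open>t > 0\<close> brownian_motion_shift[OF bm, of t]
      by (intro lil_of_linear_error[OF _ _ contV zero_less_one _ assms(7), where R="\<lambda>\<omega>. sqrt 2 * R \<omega>"]) auto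
  qed
qed

end
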